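(* For each $n\ge 1$ let $(X_{ij})_{1\le i,j\le n}$ be i.i.d. standard Gaussian random variables, let $S(\pi)=\sum_{i=1}^n X_{i\pi(i)}$ for every permutation $\pi$ of $\{1,\dots,n\}$, and let $\pi^*$ be the greedy random permutation of $\{1,\dots,n\}$ associated with $(X_{ij})$. Put $A_n=\mathbb{E}\,S(\pi^* )$ and $B_n=\sqrt{\mathrm{Var}\,S(\pi^* )}$. Then, as $n\to\infty$, \[ \frac{S(\pi^* )-A_n}{B_n}\longrightarrow \mathcal{N}(0,1)\quad\text{in distribution}, \] where \[ A_n=n\sqrt{2\log n}+O\left(\frac{n\log\log n}{\sqrt{\log n}}\right),\qquad B_n^2=\frac{\pi^2}{12}\,\frac{n}{\log n}+o\left(\frac{n}{\log n}\right) \] (in the last formula $\pi$ denotes the number $3.14159\ldots$). Moreover, \[ \sup_{r\in\mathbb{R}}\left|\mathbb{P}\left\{\frac{S(\pi^* )-A_n}{B_n}\le r\right\}-\Phi(r)\right|=O\left(\frac{1}{\sqrt n}\right), \] where $\Phi$ denotes the standard normal distribution function.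
   Context: Here $\log$ is the natural logarithm. Write $[i]=\{1,2,\dots,i\}$. The greedy random permutation $\pi^*$ is defined recursively by \[ \pi^*(1)=\arg\max_{j\in[n]}X_{1j},\qquad \pi^*(i)=\arg\max_{j\in[n]\setminus\pi^*([i-1])}X_{ij}\quad (i=2,\dots,n). \] The maximizers are almost surely unique. Accordingly, $S(\pi^* )=\sum_{i=1}^n X_{i\pi^*(i)}$. The dependence of $X_{ij}$, $S$ and $\pi^*$ on $n$ is suppressed from the notation. The $O$ and $o$ relations are as $n\to\infty$. *)

theory Defs
  imports "HOL-Probability.Probability" "HOL-Library.Landau_Symbols" "HOL-Combinatorics.Permutations"
begin

definition perm_sum :: "nat \<Rightarrow> (nat \<Rightarrow> nat \<Rightarrow> real) \<Rightarrow> (nat \<Rightarrow> nat) \<Rightarrow> real" where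
  "perm_sum n x p = (\<Sum>i=1..n. x i (p i))"

(* For i = 1 the image is empty, so the first choice ranges over all of {1..n}. Ties, which have
   probability zero for the Gaussian matrices considered here, are broken by the choice operator
   inside arg_max_on. Outside {1..n} the function is the identity, so that it is a permutation of
   {1..n} in the sense of permutes for every matrix x (see greedy_perm_permutes). *)
function greedy_perm :: "nat \<Rightarrow> (nat \<Rightarrow> nat \<Rightarrow> real) \<Rightarrow> nat \<Rightarrow> nat" where
  "greedy_perm n x i =
     (if i \<in> {1..n} then arg_max_on (x i) ({1..n} - greedy_perm n x ` {1..<i}) else i)"
  by pat_completeness auto
termination
  by (relation "Wellfounded.measure (\<lambda>(n, x, i). i)") auto

declare greedy_perm.simps [simp del]

lemma greedy_perm_in:
  assumes "i \<in> {1..n}"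
  shows "greedy_perm n x i \<in> {1..n} - greedy_perm n x ` {1..<i}"
proof -
  let ?S = "{1..n} - greedy_perm n x ` {1..<i}"
  have "card (greedy_perm n x ` {1..<i}) \<le> card {1..<i}"
    by (rule card_image_le) simp
  also have "\<dots> < card {1..n}" using assms by auto
  finally have "\<not> {1..n} \<subseteq> greedy_perm n x ` {1..<i}"
    using card_mono[of "greedy_perm n x ` {1..<i}" "{1..n}"] by auto
  then have "Max (x i ` ?S) \<in> x i ` ?S"
    by (intro Max_in) auto
  then obtain m where m: "m \<in> ?S" "x i m = Max (x i ` ?S)"
    by force
  have "\<not> x i m < x i y" if "y \<in> ?S" for y
    using m(2) that by (simp add: not_less)
  with m(1) have "\<exists>y. is_arg_max (x i) (\<lambda>j. j \<in> ?S) y"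
    unfolding is_arg_max_def by blast
  then have "is_arg_max (x i) (\<lambda>j. j \<in> ?S) (arg_max_on (x i) ?S)"
    unfolding arg_max_on_def arg_max_def by (rule someI_ex)
  then have "arg_max_on (x i) ?S \<in> ?S"
    unfolding is_arg_max_def by (rule conjunct1)
  moreover have "greedy_perm n x i = arg_max_on (x i) ?S"
    using assms by (simp only: greedy_perm.simps[of n x i] if_True)
  ultimately show ?thesis
    by (simp only:)
qed

lemma greedy_perm_permutes: "greedy_perm n x permutes {1..n}"
proof -
  have "inj_on (greedy_perm n x) {1..n}"
  proof (rule linorder_inj_onI')
    fix i j assume ij: "i \<in> {1..n}" "j \<in> {1..n}" "i < j"
    have "greedy_perm n x i \<in> greedy_perm n x ` {1..<j}"
      using ij by (intro imageI) auto
    then show "greedy_perm n x i \<noteq> greedy_perm n x j"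
      using greedy_perm_in[OF ij(2), of x] by (metis DiffD2)
  qed
  moreover have "greedy_perm n x ` {1..n} \<subseteq> {1..n}"
    using greedy_perm_in by blast
  ultimately have "bij_betw (greedy_perm n x) {1..n} {1..n}"
    by (simp add: bij_betw_def endo_inj_surj)
  then show ?thesis
  proof (rule bij_imp_permutes)
    show "greedy_perm n x i = i" if "i \<notin> {1..n}" for i
      using that by (simp only: greedy_perm.simps[of n x i] if_False)
  qed
qed

end

theory Submission
  imports Defs "HOL-Real_Asymp.Real_Asymp"
begin

text \<open>Once the first \<open>k\<close> rows have been used, the next greedy entry is the maximum of \<open>n - k\<close> entries
  that are independent of the past. Hence \<open>S\<close> is distributed like a sum of independent variables
  \<open>Z\<^sub>1, \<dots>, Z\<^sub>n\<close>, where \<open>Z\<^sub>m\<close> is the maximum of \<open>m\<close> independent standard Gaussians.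

  If \<open>E\<close> is standard exponential, then \<open>Y = - ln E\<close> is Gumbel distributed, and with
  \<open>r x = - ln (- ln (\<Phi> x))\<close> and \<open>g = r\<^sup>-\<^sup>1\<close> the variable \<open>g (ln m + Y)\<close> has the law of \<open>Z\<^sub>m\<close>, for all \<open>m\<close>
  simultaneously. As \<open>r' x\<close> is asymptotic to \<open>x\<close>, the differences \<open>g (ln m + Y) - g (ln m)\<close>, multiplied by
  \<open>(2 ln m)\<^sup>1\<^sup>/\<^sup>2\<close>, converge to \<open>Y\<close> and are dominated by a variable with moments of all orders. This gives the
  mean, the variance (asymptotically \<open>\<pi>\<^sup>2 / 6 / (2 ln m)\<close>, as \<open>Y\<close> has variance \<open>\<pi>\<^sup>2 / 6\<close>) and the third absolute central moment
  (of order \<open>(ln m)\<^sup>-\<^sup>3\<^sup>/\<^sup>2\<close>) of \<open>Z\<^sub>m\<close>, and the last two claims follow from the Berry--Esseen theorem for independent,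
  not identically distributed summands, which is proved by characteristic functions and Esseen's smoothing
  inequality.\<close>

section \<open>Esseen smoothing\<close>

text \<open>The variables g (ln m + Y) built from a single Y have the right marginal laws only; they
  are not the summands of S. They serve to compute moments, where one common probability space makes
  dominated convergence available. The law of S is reached through its characteristic function,
  which is shown to be the product of those of the maxima by summing over the possible sets of used
  columns; this sum replaces conditioning on the past. The delicate point of the domination is Y
  very negative: then g (ln m + Y) is far from g (ln m), but by monotonicity it stays above g Y, and
  g Y is standard Gaussian, being the case m = 1. Indices m below sqrt n are few, and for the others
  ln m is at least ln n / 2, so the sums over m are governed by the size of the terms near m = n.
  The Lyapunov ratio is then of order n (ln n)^(-3/2) / (n / ln n)^(3/2) = n^(-1/2): the logarithms
  cancel, whence the classical rate although the variance is not linear in n.\<close>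

definition fejer_raw :: "real \<Rightarrow> real" where
  "fejer_raw x = (1 - cos x) / x\<^sup>2"

definition fejer_mass :: real where
  "fejer_mass = (\<integral>x. fejer_raw x \<partial>lborel)"

text \<open>A smoothing kernel whose characteristic function has compact support. The normalising
  constant is kept as an integral; at 0 the unnormalised density is 0 by the convention for
  division, which changes it on a null set only.\<close>

definition fejer :: "real measure" where
  "fejer = density lborel (\<lambda>x. ennreal (fejer_raw x / fejer_mass))"

lemma fejer_raw_nonneg: "0 \<le> fejer_raw x"
  by (simp add: fejer_raw_def)

lemma borel_measurable_fejer_raw [measurable]: "fejer_raw \<in> borel_measurable borel"
  unfolding fejer_raw_def by measurable

lemma one_minus_cos_le: "1 - cos x \<le> x\<^sup>2 / 2" for x :: real
proof -
  have "cos x = 1 - 2 * (sin (x / 2))\<^sup>2" using cos_double_sin[of "x/2"] by simp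
  moreover have "(sin (x / 2))\<^sup>2 \<le> (x / 2)\<^sup>2"
    using abs_sin_x_le_abs_x[of "x/2"] abs_le_square_iff by blast
  ultimately show ?thesis by (simp add: power_divide)
qed

lemma integrable_one_div_one_plus_square: "integrable lborel (\<lambda>x::real. 1 / (1 + x\<^sup>2))"
  using integrable_inverse_1_plus_square
  by (simp add: set_integrable_def inverse_eq_divide)

lemma integrable_fejer_raw [simp, intro]: "integrable lborel fejer_raw"
proof (rule Bochner_Integration.integrable_bound)
  show "integrable lborel (\<lambda>x::real. 5 / 2 * (1 / (1 + x\<^sup>2)))"
    by (intro integrable_mult_right integrable_one_div_one_plus_square)
  show "AE x in lborel. norm (fejer_raw x) \<le> norm (5 / 2 * (1 / (1 + x\<^sup>2)))"
  proof (rule AE_I2)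
    fix x :: real
    \<comment> \<open>The constant adds the bound x^2 / 2 for 1 - cos x, which controls the origin,
      and the bound 2, which controls infinity.\<close>
    have "(1 - cos x) * (1 + x\<^sup>2) \<le> 5 / 2 * x\<^sup>2"
    proof -
      have "1 - cos x \<le> 2" using cos_ge_minus_one[of x] by linarith
      then have "(1 - cos x) * x\<^sup>2 \<le> 2 * x\<^sup>2" by (intro mult_right_mono) auto
      then show ?thesis using one_minus_cos_le[of x] by (simp add: algebra_simps)
    qed
    moreover have "1 + x\<^sup>2 > 0" by (simp add: add_pos_nonneg)
    ultimately have "fejer_raw x \<le> 5 / 2 * (1 / (1 + x\<^sup>2))"
      by (cases "x = 0") (auto simp: fejer_raw_def field_simps)
    then show "norm (fejer_raw x) \<le> norm (5 / 2 * (1 / (1 + x\<^sup>2)))"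
      using fejer_raw_nonneg[of x] by simp
  qed
qed simp

lemma fejer_mass_pos: "0 < fejer_mass"
proof -
  have "(\<integral>x. fejer_raw x \<partial>lborel) \<noteq> 0"
  proof
    assume "(\<integral>x. fejer_raw x \<partial>lborel) = 0"
    then have "AE x in lborel. fejer_raw x = 0"
      by (subst (asm) integral_nonneg_eq_0_iff_AE) (auto simp: fejer_raw_nonneg)
    then have "AE x in lborel. x \<notin> {1..2::real}"
    proof eventually_elim
      case (elim x)
      have "cos x < 1" if "1 \<le> x" "x \<le> 2"
        using cos_monotone_0_pi[of 0 x] that pi_gt3 by simp
      with elim show ?case by (auto simp: fejer_raw_def)
    qed
    then have "emeasure lborel {1..2::real} = 0"
      using AE_iff_measurable[of "{1..2::real}" lborel "\<lambda>x. x \<notin> {1..2}"]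
      by (simp add: atLeastAtMost_def atLeast_def atMost_def Int_def del: emeasure_lborel_Icc_eq)
    moreover have "emeasure lborel {1..2::real} = ennreal (2 - 1)"
      by (rule emeasure_lborel_Icc) simp
    ultimately show False by (simp del: emeasure_lborel_Icc_eq)
  qed
  moreover have "(\<integral>x. fejer_raw x \<partial>lborel) \<ge> 0"
    by (intro integral_nonneg_AE AE_I2 fejer_raw_nonneg)
  ultimately show ?thesis by (simp add: fejer_mass_def)
qed

lemma real_distribution_fejer: "real_distribution fejer"
proof -
  have "(\<integral>\<^sup>+x. ennreal (fejer_raw x / fejer_mass) \<partial>lborel) = ennreal (\<integral>x. fejer_raw x / fejer_mass \<partial>lborel)"
    by (intro nn_integral_eq_integral AE_I2)
       (use fejer_mass_pos in \<open>auto intro!: divide_nonneg_pos fejer_raw_nonneg\<close>)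
  also have "(\<integral>x. fejer_raw x / fejer_mass \<partial>lborel) = 1"
    using fejer_mass_pos by (simp add: fejer_mass_def[symmetric])
  finally have "prob_space fejer"
    by (intro prob_spaceI) (simp add: fejer_def emeasure_density)
  then show ?thesis
    by (simp add: real_distribution_def real_distribution_axioms_def fejer_def)
qed

text \<open>Substitution in the integral defining \<open>fejer_mass\<close>. As the result is
  proportional to |a|, second differences in the frequency turn into second differences of the
  absolute value.\<close>

lemma fejer_scaled_integral:
  "(\<integral>x. (1 - cos (a * x)) / x\<^sup>2 \<partial>lborel) = \<bar>a\<bar> * fejer_mass"
  and integrable_fejer_scaled: "integrable lborel (\<lambda>x. (1 - cos (a * x)) / x\<^sup>2)"
proof -
  have eq: "(1 - cos (a * x)) / x\<^sup>2 = a\<^sup>2 * fejer_raw (0 + a * x)" if "a \<noteq> 0" for x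
    using that by (simp add: fejer_raw_def power_mult_distrib)
  show "integrable lborel (\<lambda>x. (1 - cos (a * x)) / x\<^sup>2)"
  proof (cases "a = 0")
    case False
    then have "integrable lborel (\<lambda>x. a\<^sup>2 * fejer_raw (0 + a * x))"
      by (intro integrable_mult_right lborel_integrable_real_affine[OF integrable_fejer_raw])
    then show ?thesis by (simp only: eq[OF False])
  qed simp
  show "(\<integral>x. (1 - cos (a * x)) / x\<^sup>2 \<partial>lborel) = \<bar>a\<bar> * fejer_mass"
  proof (cases "a = 0")
    case False
    have fm: "fejer_mass = \<bar>a\<bar> * (\<integral>x. fejer_raw (0 + a * x) \<partial>lborel)"
      unfolding fejer_mass_def using lborel_integral_real_affine[OF False, of fejer_raw 0] by simp
    show ?thesis
      unfolding eq[OF False] integral_mult_right_zero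
      by (subst fm) (simp add: power2_eq_square flip: mult.assoc)
  qed simp
qed

text \<open>Writing cos (t x) (1 - cos x) through 1 - cos of the frequencies 1 + t, 1 - t and t
  gives the real part as a multiple of (|1 + t| + |1 - t|) / 2 - |t|, the triangle function, which
  vanishes once |t| reaches 1.\<close>

lemma char_fejer_eq_0:
  assumes "1 \<le> \<bar>t\<bar>"
  shows "char fejer t = 0"
proof -
  interpret real_distribution fejer by (rule real_distribution_fejer)
  have int: "integrable lborel (\<lambda>x. iexp (t * x) * complex_of_real (fejer_raw x))"
    by (rule Bochner_Integration.integrable_bound[OF integrable_fejer_raw])
       (auto simp: norm_mult fejer_raw_nonneg)
  have c: "char fejer t = (\<integral>x. iexp (t * x) * complex_of_real (fejer_raw x) \<partial>lborel) / fejer_mass"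
    unfolding char_def fejer_def using fejer_mass_pos
    by (subst integral_density)
       (auto simp: divide_nonneg_pos fejer_raw_nonneg scaleR_conv_of_real mult.commute
          simp flip: integral_divide_zero)
  have "(\<integral>x. iexp (t * x) * complex_of_real (fejer_raw x) \<partial>lborel) = 0"
  proof (rule complex_eqI)
    have "(\<integral>x. cos (t * x) * fejer_raw x \<partial>lborel) =
      (\<integral>x. ((1 - cos ((1 + t) * x)) / x\<^sup>2 + (1 - cos ((1 - t) * x)) / x\<^sup>2) / 2
              - (1 - cos (t * x)) / x\<^sup>2 \<partial>lborel)"
    proof (intro Bochner_Integration.integral_cong refl)
      fix x :: real
      have "cos (t * x) * (1 - cos x) = (1 - cos ((1 + t) * x) + (1 - cos ((1 - t) * x))) / 2 - (1 - cos (t * x))"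
        by (simp add: ring_distribs cos_add cos_diff diff_divide_distrib add_divide_distrib)
      then have "cos (t * x) * fejer_raw x =
          ((1 - cos ((1 + t) * x) + (1 - cos ((1 - t) * x))) / 2 - (1 - cos (t * x))) / x\<^sup>2"
        by (simp only: fejer_raw_def times_divide_eq_right)
      then show "cos (t * x) * fejer_raw x = ((1 - cos ((1 + t) * x)) / x\<^sup>2 + (1 - cos ((1 - t) * x)) / x\<^sup>2) / 2
              - (1 - cos (t * x)) / x\<^sup>2"
        by (simp add: add_divide_distrib diff_divide_distrib)
    qed
    also have "\<dots> = (\<bar>1 + t\<bar> * fejer_mass + \<bar>1 - t\<bar> * fejer_mass) / 2 - \<bar>t\<bar> * fejer_mass"
      by (simp add: integrable_fejer_scaled fejer_scaled_integral Bochner_Integration.integral_diff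
          Bochner_Integration.integral_add)
    also have "\<dots> = (\<bar>1 + t\<bar> / 2 + \<bar>1 - t\<bar> / 2 - \<bar>t\<bar>) * fejer_mass"
      by (simp add: algebra_simps add_divide_distrib)
    also have "\<bar>1 + t\<bar> / 2 + \<bar>1 - t\<bar> / 2 - \<bar>t\<bar> = 0" using assms by (auto simp: abs_if field_simps split: if_splits)
    finally show "Re (\<integral>x. iexp (t * x) * complex_of_real (fejer_raw x) \<partial>lborel) = Re 0"
      using int by (simp add: integral_Re[symmetric] Re_exp)
    \<comment> \<open>The imaginary part is the integral of an odd function: reflect x.\<close>
    have "(\<integral>x. sin (t * x) * fejer_raw x \<partial>lborel) = - (\<integral>x. sin (t * x) * fejer_raw x \<partial>lborel)"
      using lborel_integral_real_affine[of "-1" "\<lambda>x. sin (t * x) * fejer_raw x" 0]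
      by (simp add: fejer_raw_def)
    then have "(\<integral>x. sin (t * x) * fejer_raw x \<partial>lborel) = 0" by simp
    then show "Im (\<integral>x. iexp (t * x) * complex_of_real (fejer_raw x) \<partial>lborel) = Im 0"
      using int by (simp add: integral_Im[symmetric] Im_exp)
  qed
  with c show ?thesis by simp
qed

lemma fejer_singleton: "emeasure fejer {x} = 0"
proof -
  have "emeasure fejer {x} = (\<integral>\<^sup>+y. ennreal (fejer_raw y / fejer_mass) * indicator {x} y \<partial>lborel)"
    unfolding fejer_def by (subst emeasure_density) auto
  also have "\<dots> = (\<integral>\<^sup>+y. 0 \<partial>(lborel::real measure))"
    by (intro nn_integral_cong_AE, use AE_lborel_singleton[of x] in eventually_elim) auto
  finally show ?thesis by simp
qed

section \<open>Convolutions and inversion of characteristic functions\<close>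

lemma real_distribution_convolution:
  assumes "real_distribution M" "real_distribution N"
  shows "real_distribution (M \<star> N)"
proof -
  interpret M: real_distribution M by fact
  interpret N: real_distribution N by fact
  interpret P: pair_prob_space M N ..
  have "(\<lambda>(x, y). x + y) \<in> borel_measurable (M \<Otimes>\<^sub>M N)" by measurable
  then show ?thesis unfolding convolution_def by (rule P.real_distribution_distr)
qed

lemma char_convolution:
  assumes "real_distribution M" "real_distribution N"
  shows "char (M \<star> N) t = char M t * char N t"
proof -
  interpret M: real_distribution M by fact
  interpret N: real_distribution N by fact
  interpret P: pair_prob_space M N ..
  have "char (M \<star> N) t = (\<integral>p. iexp (t * (fst p + snd p)) \<partial>(M \<Otimes>\<^sub>M N))"
    unfolding char_def convolution_def by (subst integral_distr) (auto simp: case_prod_beta)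
  also have "\<dots> = (\<integral>x. (\<integral>y. iexp (t * x) * iexp (t * y) \<partial>N) \<partial>M)"
  proof (subst P.integral_fst'[symmetric])
    show "integrable (M \<Otimes>\<^sub>M N) (\<lambda>p. iexp (t * (fst p + snd p)))"
      by (intro P.integrable_const_bound[where B = 1]) auto
  qed (simp add: distrib_left exp_add)
  finally show ?thesis by (simp add: char_def)
qed

lemma (in finite_borel_measure) borel_measurable_cdf [measurable]: "cdf M \<in> borel_measurable borel"
  by (intro borel_measurable_mono monoI cdf_nondecreasing)

lemma cdf_convolution:
  assumes "real_distribution M" "real_distribution N"
  shows "cdf (M \<star> N) y = (\<integral>v. cdf M (y - v) \<partial>N)"
proof -
  interpret M: real_distribution M by fact
  interpret N: real_distribution N by fact
  interpret MN: real_distribution "M \<star> N" by (intro real_distribution_convolution assms)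
  note fin = M.finite_measure_axioms N.finite_measure_axioms
  have "emeasure (M \<star> N) {..y} = emeasure (N \<star> M) {..y}"
    by (subst convolution_commutative) (auto simp: fin)
  also have "\<dots> = (\<integral>\<^sup>+v. emeasure M {a. a + v \<in> {..y}} \<partial>N)"
    by (intro convolution_emeasure) (auto simp: fin)
  also have "\<dots> = (\<integral>\<^sup>+v. ennreal (cdf M (y - v)) \<partial>N)"
    by (intro nn_integral_cong) (auto simp: cdf_def M.emeasure_eq_measure intro!: arg_cong[where f = "Sigma_Algebra.measure M"])
  also have "\<dots> = ennreal (\<integral>v. cdf M (y - v) \<partial>N)"
    by (intro nn_integral_eq_integral N.integrable_const_bound[where B = 1])
       (auto simp: M.cdf_nonneg M.cdf_bounded_prob)
  finally show ?thesis
    by (simp add: cdf_def measure_def M.cdf_nonneg integral_nonneg_AE)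
qed

text \<open>Smoothing by an atomless law removes all atoms, so the inversion formula, which wants
  endpoints of mass zero, applies at every point.\<close>

lemma convolution_singleton_eq_0:
  assumes "real_distribution M" "real_distribution N" "\<And>x. emeasure N {x} = 0"
  shows "measure (M \<star> N) {x} = 0"
proof -
  interpret M: real_distribution M by fact
  interpret N: real_distribution N by fact
  note fin = M.finite_measure_axioms N.finite_measure_axioms
  have "emeasure (M \<star> N) {x} = (\<integral>\<^sup>+a. emeasure N {v. v + a \<in> {x}} \<partial>M)"
    by (intro convolution_emeasure) (auto simp: fin)
  also have "\<dots> = (\<integral>\<^sup>+a. emeasure N {x - a} \<partial>M)"
    by (intro nn_integral_cong arg_cong[where f = "emeasure N"]) auto
  finally show ?thesis by (simp add: assms(3) measure_def)
qed

text \<open>Levy inversion applied to both laws and subtracted. The inversion kernel is at most 2 /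
  |t|, which cancels the factor |t| in the hypothesis and leaves a bound that does not depend on the
  interval.\<close>

lemma measure_Ioc_diff_le_char:
  assumes M: "real_distribution M" and N: "real_distribution N"
    and ab: "a \<le> b"
    and atoms: "measure M {a} = 0" "measure M {b} = 0" "measure N {a} = 0" "measure N {b} = 0"
    and \<beta>: "integrable lborel \<beta>" "\<And>t. 0 \<le> \<beta> t"
    and le: "\<And>t. cmod (char M t - char N t) \<le> \<bar>t\<bar> * \<beta> t"
  shows "\<bar>measure M {a<..b} - measure N {a<..b}\<bar> \<le> (\<integral>t. \<beta> t \<partial>lborel)"
proof -
  interpret M: real_distribution M by fact
  interpret N: real_distribution N by fact
  define c where "c t = (iexp (-(t * a)) - iexp (-(t * b))) / (\<i> * complex_of_real t)" for t
  have [measurable]: "c \<in> borel_measurable borel" unfolding c_def by measurable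
  \<comment> \<open>This bound tames the singularity at 0 and makes the integrals over finite
    windows exist; the bound 2 / |t| below is the one that enters the estimate.\<close>
  have c1: "cmod (c t) \<le> b - a" if "t \<noteq> 0" for t
    using Levy_Inversion_aux2[of "-b" "-a" t] that ab by (simp add: c_def)
  have c1': "cmod (c t) \<le> b - a" for t
    using c1[of t] ab by (cases "t = 0") (auto simp: c_def)
  have c2: "cmod (c t) * \<bar>t\<bar> \<le> 2" for t
  proof (cases "t = 0")
    case False
    have "cmod (iexp (-(t * a)) - iexp (-(t * b))) \<le> 1 + 1"
      by (rule order_trans[OF norm_triangle_ineq4]) (simp add: norm_exp_i_times flip: of_real_mult of_real_minus)
    then show ?thesis using False by (simp add: c_def norm_divide norm_mult)
  qed auto
  define I where "I L n = (CLBINT t=-real n..real n. c t * char L t)" for L :: "real measure" and n :: nat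
  have int: "set_integrable lborel {-real n<..<real n} (\<lambda>t. c t * char L t)"
    if "real_distribution L" for L n
  proof -
    interpret L: real_distribution L by fact
    show ?thesis unfolding set_integrable_def
    proof (rule Bochner_Integration.integrable_bound)
      show "integrable lborel (\<lambda>t. (b - a) * indicator {-real n<..<real n} t)"
        by (intro integrable_mult_right integrable_real_indicator) (auto simp: emeasure_lborel_Ioo)
      show "AE t in lborel. norm (indicator {-real n<..<real n} t *\<^sub>R (c t * char L t))
          \<le> norm ((b - a) * indicator {-real n<..<real n} t)"
      proof (rule AE_I2)
        fix t
        have "cmod (c t) * cmod (char L t) \<le> (b - a) * 1"
          using c1'[of t] L.cmod_char_le_1[of t] ab by (intro mult_mono) auto
        then show "norm (indicator {-real n<..<real n} t *\<^sub>R (c t * char L t))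
          \<le> norm ((b - a) * indicator {-real n<..<real n} t)"
          using ab by (auto simp: norm_mult split: split_indicator)
      qed
    qed simp
  qed
  have I_eq: "I L n = (CLINT t:{-real n<..<real n}|lborel. c t * char L t)" for L n
    unfolding I_def by (subst interval_lebesgue_integral_le_eq) (auto simp: einterval_eq)
  have lim: "(\<lambda>n. complex_of_real (1 / (2 * pi)) * I L n) \<longlonglongrightarrow> measure L {a<..b}"
    if "real_distribution L" "measure L {a} = 0" "measure L {b} = 0" for L
    using real_distribution.Levy_Inversion[OF that(1) ab that(2,3)] by (simp add: I_def c_def)
  have "(\<lambda>n. norm (complex_of_real (1 / (2 * pi)) * I M n - complex_of_real (1 / (2 * pi)) * I N n)) \<longlonglongrightarrow>
    norm (complex_of_real (measure M {a<..b}) - complex_of_real (measure N {a<..b}))"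
    by (intro tendsto_intros lim M N atoms)
  moreover have "norm (complex_of_real (1 / (2 * pi)) * I M n - complex_of_real (1 / (2 * pi)) * I N n)
      \<le> (\<integral>t. \<beta> t \<partial>lborel)" for n
  proof -
    have "I M n - I N n = (CLINT t:{-real n<..<real n}|lborel. c t * char M t - c t * char N t)"
      unfolding I_eq by (rule set_integral_diff(2)[symmetric]; intro int M N)
    also have "norm \<dots> \<le> (\<integral>t. 2 * \<beta> t \<partial>lborel)"
      unfolding set_lebesgue_integral_def
    proof (rule Bochner_Integration.integral_norm_bound_integral)
      show "integrable lborel (\<lambda>t. indicator {-real n<..<real n} t *\<^sub>R (c t * char M t - c t * char N t))"
        using set_integral_diff(1)[OF int[OF M] int[OF N]] by (simp add: set_integrable_def)
      show "norm (indicator {-real n<..<real n} t *\<^sub>R (c t * char M t - c t * char N t)) \<le> 2 * \<beta> t" for t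
      proof -
        have "norm (c t * char M t - c t * char N t) = cmod (c t) * cmod (char M t - char N t)"
          by (simp add: norm_mult flip: right_diff_distrib)
        also have "\<dots> \<le> cmod (c t) * (\<bar>t\<bar> * \<beta> t)" by (intro mult_left_mono le) auto
        also have "\<dots> \<le> 2 * \<beta> t"
          using mult_right_mono[OF c2[of t] \<beta>(2)[of t]] by (simp add: mult.assoc)
        finally show ?thesis using \<beta>(2)[of t] by (auto split: split_indicator)
      qed
    qed (use \<beta> in auto)
    finally have "norm (I M n - I N n) \<le> 2 * (\<integral>t. \<beta> t \<partial>lborel)" by simp
    moreover have "norm (complex_of_real (1 / (2 * pi)) * I M n - complex_of_real (1 / (2 * pi)) * I N n)
        = 1 / (2 * pi) * norm (I M n - I N n)"
      by (simp add: norm_mult norm_divide flip: right_diff_distrib diff_divide_distrib)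
    ultimately have "norm (complex_of_real (1 / (2 * pi)) * I M n - complex_of_real (1 / (2 * pi)) * I N n)
      \<le> 1 / (2 * pi) * (2 * (\<integral>t. \<beta> t \<partial>lborel))"
      by (simp only:) (intro mult_left_mono, auto)
    \<comment> \<open>The true factor is 1 / pi.\<close>
    also have "\<dots> \<le> 1 * (\<integral>t. \<beta> t \<partial>lborel)"
      using pi_gt3 Bochner_Integration.integral_nonneg[of lborel \<beta>] \<beta>(2)
      by (simp add: field_simps mult_le_cancel_right1 not_less)
    finally show ?thesis by simp
  qed
  ultimately have "norm (complex_of_real (measure M {a<..b}) - complex_of_real (measure N {a<..b})) \<le> (\<integral>t. \<beta> t \<partial>lborel)"
    by (intro LIMSEQ_le_const2) auto
  then show ?thesis by (simp flip: of_real_diff)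
qed

text \<open>The interval bound is uniform, so the left endpoint may tend to minus infinity.\<close>

lemma cdf_diff_le_char:
  assumes M: "real_distribution M" and N: "real_distribution N"
    and atoms: "\<And>x. measure M {x} = 0" "\<And>x. measure N {x} = 0"
    and \<beta>: "integrable lborel \<beta>" "\<And>t. 0 \<le> \<beta> t"
    and le: "\<And>t. cmod (char M t - char N t) \<le> \<bar>t\<bar> * \<beta> t"
  shows "\<bar>cdf M b - cdf N b\<bar> \<le> (\<integral>t. \<beta> t \<partial>lborel)"
proof (rule LIMSEQ_le_const2)
  interpret M: real_distribution M by fact
  interpret N: real_distribution N by fact
  show "(\<lambda>n. \<bar>(cdf M b - cdf M (- real n)) - (cdf N b - cdf N (- real n))\<bar>) \<longlonglongrightarrow> \<bar>cdf M b - cdf N b\<bar>"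
    using tendsto_rabs[OF tendsto_diff[OF tendsto_diff[OF tendsto_const M.cdf_lim_neg_infty]
        tendsto_diff[OF tendsto_const N.cdf_lim_neg_infty]]] by simp
  show "\<exists>k. \<forall>n\<ge>k. \<bar>(cdf M b - cdf M (- real n)) - (cdf N b - cdf N (- real n))\<bar> \<le> (\<integral>t. \<beta> t \<partial>lborel)"
  proof (intro exI allI impI)
    fix n assume "n \<ge> nat \<lceil>\<bar>b\<bar>\<rceil> + 1"
    then have "- real n < b" by linarith
    then show "\<bar>(cdf M b - cdf M (- real n)) - (cdf N b - cdf N (- real n))\<bar> \<le> (\<integral>t. \<beta> t \<partial>lborel)"
      using measure_Ioc_diff_le_char[OF M N _ atoms(1,1,2,2) \<beta> le, of "- real n" b]
      by (simp add: M.cdf_diff_eq N.cdf_diff_eq)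
  qed
qed

text \<open>Convolving with the kernel scaled by 1 / T kills all frequencies beyond T, so the
  smoothed distribution functions differ by at most the integral of \<open>\<beta>\<close>. To undo
  the smoothing: where the difference is nearly extremal it stays so on a one-sided window, because
  one function is monotone and the other Lipschitz; most of the kernel can be placed on that window.
  The number h depends on the kernel alone and is therefore quantified first.\<close>

theorem esseen_smoothing:
  "\<exists>h>0. \<forall>M N T m \<beta>. real_distribution M \<longrightarrow> real_distribution N \<longrightarrow> 0 < T \<longrightarrow>
     (\<forall>x y. x \<le> y \<longrightarrow> cdf N y - cdf N x \<le> m * (y - x)) \<longrightarrow>
     integrable lborel \<beta> \<longrightarrow> (\<forall>t. 0 \<le> \<beta> t) \<longrightarrow>
     (\<forall>t. \<bar>t\<bar> \<le> T \<longrightarrow> cmod (char M t - char N t) \<le> \<bar>t\<bar> * \<beta> t) \<longrightarrow>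
     (\<forall>x. \<bar>cdf M x - cdf N x\<bar> \<le> 2 * (\<integral>t. \<beta> t \<partial>lborel) + 3 * h * m / T)"
proof -
  interpret K: real_distribution fejer by (rule real_distribution_fejer)
  have "(\<lambda>n. cdf fejer (real n) - cdf fejer (- real n)) \<longlonglongrightarrow> 1 - 0"
    by (intro tendsto_diff K.cdf_lim_infty_prob K.cdf_lim_neg_infty)
  \<comment> \<open>If the window carries mass p, the remaining mass contributes (1 - p) / p times
    the supremum D. Any p above 1/2 lets D be absorbed; 3/4 gives the factor 1/3.\<close>
  then have "eventually (\<lambda>n. cdf fejer (real n) - cdf fejer (- real n) > 3 / 4) sequentially"
    by (intro order_tendstoD(1)) auto
  then obtain n0 where "cdf fejer (real n0) - cdf fejer (- real n0) > 3 / 4"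
    by (auto simp: eventually_sequentially)
  moreover from this have "n0 \<noteq> 0" by (intro notI) simp
  ultimately obtain h where h: "h > 0" and "cdf fejer h - cdf fejer (- h) > 3 / 4"
    by (metis of_nat_0_less_iff bot_nat_0.not_eq_extremum)
  then have hp: "measure fejer {-h<..h} \<ge> 3 / 4" by (subst (asm) K.cdf_diff_eq) auto
  show ?thesis
  proof (intro exI[of _ h] conjI allI impI h)
    fix M N T m \<beta> and x0 :: real
    assume M: "real_distribution M" and N: "real_distribution N" and T: "0 < T"
      and lip: "\<forall>x y. x \<le> y \<longrightarrow> cdf N y - cdf N x \<le> m * (y - x)"
      and \<beta>: "integrable lborel \<beta>" "\<forall>t. 0 \<le> \<beta> t"
      and le: "\<forall>t. \<bar>t\<bar> \<le> T \<longrightarrow> cmod (char M t - char N t) \<le> \<bar>t\<bar> * \<beta> t"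
    interpret M: real_distribution M by fact
    interpret N: real_distribution N by fact
    define KT where "KT = distr fejer borel (\<lambda>v. v / T)"
    interpret KT: real_distribution KT unfolding KT_def by (rule K.real_distribution_distr) simp
    have KT: "real_distribution KT" ..
    have KT0: "emeasure KT {x} = 0" for x
    proof -
      have "(\<lambda>v. v / T) -` {x} \<inter> space fejer = {x * T}" using T by auto
      then show ?thesis unfolding KT_def by (subst emeasure_distr) (auto simp: fejer_singleton)
    qed
    have charKT: "char KT t = char fejer (t / T)" for t
      unfolding char_def KT_def by (subst integral_distr) auto
    define \<epsilon> where "\<epsilon> = (\<integral>t. \<beta> t \<partial>lborel)"
    have conv: "\<bar>cdf (M \<star> KT) y - cdf (N \<star> KT) y\<bar> \<le> \<epsilon>" for y
      unfolding \<epsilon>_def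
    proof (rule cdf_diff_le_char)
      fix t
      show "cmod (char (M \<star> KT) t - char (N \<star> KT) t) \<le> \<bar>t\<bar> * \<beta> t"
      proof (cases "\<bar>t\<bar> \<le> T")
        case True
        have "cmod (char (M \<star> KT) t - char (N \<star> KT) t) = cmod (char M t - char N t) * cmod (char KT t)"
          by (simp add: char_convolution M N KT norm_mult flip: left_diff_distrib)
        also have "\<dots> \<le> \<bar>t\<bar> * \<beta> t * 1"
          using True le \<beta>(2) by (intro mult_mono KT.cmod_char_le_1) auto
        finally show ?thesis by simp
      next
        case False
        then have "char KT t = 0" using T by (simp add: charKT char_fejer_eq_0)
        then show ?thesis using \<beta>(2) by (simp add: char_convolution M N KT)
      qed
    qed (use \<beta> M N KT in \<open>auto intro!: real_distribution_convolution convolution_singleton_eq_0 KT0\<close>)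
    define \<Delta> where "\<Delta> x = cdf M x - cdf N x" for x
    have [measurable]: "\<Delta> \<in> borel_measurable borel" unfolding \<Delta>_def by measurable
    have \<Delta>1: "\<bar>\<Delta> x\<bar> \<le> 1" for x
      using M.cdf_nonneg[of x] M.cdf_bounded_prob[of x] N.cdf_nonneg[of x] N.cdf_bounded_prob[of x]
      by (auto simp: \<Delta>_def)
    have int\<Delta>: "integrable fejer (\<lambda>v. \<Delta> (y - v / T))" for y
      by (intro K.integrable_const_bound[where B = 1]) (auto simp: \<Delta>1)
    have convD: "\<bar>\<integral>v. \<Delta> (y - v / T) \<partial>fejer\<bar> \<le> \<epsilon>" for y
    proof -
      have i: "integrable fejer (\<lambda>v. cdf L (y - v / T))" if "real_distribution L" for L
      proof -
        interpret L: real_distribution L by fact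
        show ?thesis by (intro K.integrable_const_bound[where B = 1]) (auto simp: L.cdf_nonneg L.cdf_bounded_prob)
      qed
      have "cdf (M \<star> KT) y - cdf (N \<star> KT) y = (\<integral>v. \<Delta> (y - v / T) \<partial>fejer)"
        unfolding \<Delta>_def using i[OF M] i[OF N]
        by (simp add: cdf_convolution M N KT) (simp add: KT_def integral_distr)
      with conv[of y] show ?thesis by simp
    qed
    define D where "D = (SUP x. \<bar>\<Delta> x\<bar>)"
    have bdd: "bdd_above (range (\<lambda>x. \<bar>\<Delta> x\<bar>))" by (intro bdd_aboveI[of _ 1]) (auto simp: \<Delta>1)
    have \<Delta>D: "\<bar>\<Delta> x\<bar> \<le> D" for x unfolding D_def by (intro cSUP_upper bdd) auto
    \<comment> \<open>The largest rise of \<open>cdf N\<close> over the window, whose length is 2 h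
      / T.\<close>
    define q where "q = 2 * h * m / T"
    \<comment> \<open>On the window the smoothed difference is at least s - q, elsewhere at least
      -D. The sign \<open>\<sigma>\<close> covers both one-sided deviations, and z is the point
      shifted by h / T so that the window lies to its right or to its left.\<close>
    have key: "s \<le> 4 / 3 * \<epsilon> + D / 3 + q"
      if near: "\<And>v. v \<in> {-h<..h} \<Longrightarrow> s - q \<le> \<sigma> * \<Delta> (z - v / T)" and \<sigma>: "\<bar>\<sigma>\<bar> = 1" for s z \<sigma> :: real
    proof -
      have far: "- D \<le> \<sigma> * \<Delta> x" for x using \<Delta>D[of x] \<sigma> by (auto simp: abs_if split: if_splits)
      have indi: "integrable fejer (\<lambda>v. indicator {-h<..h} v * (s - q + D))"
        by (intro integrable_mult_left integrable_real_indicator) (auto simp: K.emeasure_eq_measure)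
      have "(\<integral>v. indicator {-h<..h} v * (s - q + D) - D \<partial>fejer) \<le> (\<integral>v. \<sigma> * \<Delta> (z - v / T) \<partial>fejer)"
      proof (rule integral_mono)
        fix v
        show "indicator {-h<..h} v * (s - q + D) - D \<le> \<sigma> * \<Delta> (z - v / T)"
          using near[of v] far[of "z - v / T"] by (auto split: split_indicator)
      qed (use int\<Delta> indi in auto)
      also have "\<dots> \<le> \<epsilon>" using convD[of z] \<sigma> by (auto simp: abs_if split: if_splits)
      also have "(\<integral>v. indicator {-h<..h} v * (s - q + D) - D \<partial>fejer) = measure fejer {-h<..h} * (s - q + D) - D"
        using indi by (simp add: K.prob_space[simplified])
      finally have le: "measure fejer {-h<..h} * (s - q + D) \<le> \<epsilon> + D" by simp
      have "0 \<le> \<epsilon>" unfolding \<epsilon>_def using \<beta>(2) by (intro integral_nonneg_AE) auto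
      moreover have "0 \<le> D" using \<Delta>D[of 0] by linarith
      moreover have "3 / 4 * (s - q + D) \<le> measure fejer {-h<..h} * (s - q + D)" if "s - q + D \<ge> 0"
        using hp that by (intro mult_right_mono)
      ultimately show ?thesis using le by (cases "s - q + D \<ge> 0") (auto simp: field_simps)
    qed
    have lipN: "cdf N y - cdf N x \<le> q" if "x \<le> y" "y \<le> x + 2 * h / T" for x y
    proof -
      have "m \<ge> 0" using lip[rule_format, of 0 1] N.cdf_nondecreasing[of 0 1] by simp
      then have "m * (y - x) \<le> m * (2 * h / T)" using that by (intro mult_left_mono) auto
      then show ?thesis using lip[rule_format, OF that(1)] by (simp add: q_def mult_ac)
    qed
    have bound: "\<bar>\<Delta> x\<bar> \<le> 4 / 3 * \<epsilon> + D / 3 + q" for x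
    proof -
      have "\<Delta> x \<le> 4 / 3 * \<epsilon> + D / 3 + q"
      proof (rule key[of "\<Delta> x" 1 "x + h / T"])
        fix v assume v: "v \<in> {-h<..h}"
        have 1: "x \<le> x + h / T - v / T" using v T by (simp add: divide_right_mono)
        have "(h - v) / T \<le> 2 * h / T" using v T by (intro divide_right_mono) auto
        then have 2: "x + h / T - v / T \<le> x + 2 * h / T" by (simp add: diff_divide_distrib)
        show "\<Delta> x - q \<le> 1 * \<Delta> (x + h / T - v / T)"
          using lipN[OF 1 2] M.cdf_nondecreasing[OF 1] by (simp add: \<Delta>_def)
      qed simp
      moreover have "- \<Delta> x \<le> 4 / 3 * \<epsilon> + D / 3 + q"
      proof (rule key[of "- \<Delta> x" "- 1" "x - h / T"])
        fix v assume v: "v \<in> {-h<..h}"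
        have "(- h - v) / T \<le> 0" using v T by (auto simp: divide_le_0_iff)
        then have 1: "x - h / T - v / T \<le> x" by (simp add: diff_divide_distrib)
        have "(h + v) / T \<le> 2 * h / T" using v T by (intro divide_right_mono) auto
        then have 2: "x \<le> x - h / T - v / T + 2 * h / T" by (simp add: add_divide_distrib)
        show "- \<Delta> x - q \<le> - 1 * \<Delta> (x - h / T - v / T)"
          using lipN[OF 1 2] M.cdf_nondecreasing[OF 1] by (simp add: \<Delta>_def)
      qed simp
      ultimately show ?thesis by simp
    qed
    then have "D \<le> 4 / 3 * \<epsilon> + D / 3 + q" unfolding D_def by (intro cSUP_least) auto
    then have "D \<le> 2 * \<epsilon> + 3 / 2 * q" by simp
    then have "\<bar>\<Delta> x0\<bar> \<le> 2 * \<epsilon> + 3 / 2 * q" using \<Delta>D[of x0] by simp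
    then show "\<bar>cdf M x0 - cdf N x0\<bar> \<le> 2 * (\<integral>t. \<beta> t \<partial>lborel) + 3 * h * m / T"
      by (simp add: \<Delta>_def \<epsilon>_def q_def)
  qed
qed

section \<open>A Berry--Esseen bound\<close>

text \<open>Multiply by 1 + y + y^2 / 2, a lower bound for exp y: the product of the two quadratics
  is 1 + y^4 / 4, hence at least 1.\<close>

lemma exp_minus_le_quadratic:
  fixes y :: real
  assumes "0 \<le> y"
  shows "exp (- y) \<le> 1 - y + y\<^sup>2 / 2"
proof -
  have "(1 - y + y\<^sup>2 / 2) * (1 + y + y\<^sup>2 / 2) = 1 + y ^ 4 / 4"
    by (simp add: algebra_simps power2_eq_square power4_eq_xxxx)
  moreover have "(1 - y + y\<^sup>2 / 2) * (1 + y + y\<^sup>2 / 2) \<le> (1 - y + y\<^sup>2 / 2) * exp y"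
  proof (rule mult_left_mono)
    show "1 + y + y\<^sup>2 / 2 \<le> exp y" using assms by (rule exp_lower_Taylor_quadratic)
    have "0 \<le> (1 - y)\<^sup>2 + 1" by simp
    also have "\<dots> = 2 * (1 - y + y\<^sup>2 / 2)" by (simp add: power2_eq_square algebra_simps)
    finally show "0 \<le> 1 - y + y\<^sup>2 / 2" by simp
  qed
  moreover have "0 \<le> y ^ 4 / 4" using assms by simp
  ultimately have "1 \<le> (1 - y + y\<^sup>2 / 2) * exp y" by linarith
  then show ?thesis by (simp add: exp_minus field_simps)
qed

text \<open>The error is cubic, like the Taylor error of a characteristic function, so that both can
  be compared through the same quadratic polynomial. Beyond w = 1 the trivial bound w^2 / 2 is
  already below w^3 / 2.\<close>

lemma abs_exp_minus_half_square_le: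
  fixes w :: real
  assumes "0 \<le> w"
  shows "\<bar>exp (- (w\<^sup>2 / 2)) - (1 - w\<^sup>2 / 2)\<bar> \<le> w ^ 3 / 2"
proof -
  have lower: "1 - w\<^sup>2 / 2 \<le> exp (- (w\<^sup>2 / 2))"
    using exp_ge_add_one_self[of "- (w\<^sup>2 / 2)"] by simp
  show ?thesis
  proof (cases "w \<le> 1")
    case True
    have "exp (- (w\<^sup>2 / 2)) - (1 - w\<^sup>2 / 2) \<le> (w\<^sup>2 / 2)\<^sup>2 / 2"
      using exp_minus_le_quadratic[of "w\<^sup>2 / 2"] by simp
    also have "\<dots> = w ^ 3 * (w / 8)" by (simp add: power2_eq_square power3_eq_cube)
    also have "\<dots> \<le> w ^ 3 * (1 / 2)" using assms True by (intro mult_left_mono) auto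
    finally show ?thesis using lower by simp
  next
    case False
    have "exp (- (w\<^sup>2 / 2)) - (1 - w\<^sup>2 / 2) \<le> w\<^sup>2 / 2" by simp
    also have "w\<^sup>2 / 2 * 1 \<le> w\<^sup>2 / 2 * w" using False by (intro mult_left_mono) auto
    then have "w\<^sup>2 / 2 \<le> w ^ 3 / 2" by (simp add: power2_eq_square power3_eq_cube)
    finally show ?thesis using lower by simp
  qed
qed

text \<open>Telescoping, with the majorants of the other factors kept instead of being bounded by 1:
  the product of the remaining majorants will supply the Gaussian decay in the Berry--Esseen
  proof.\<close>

lemma norm_prod_diff_le:
  fixes a b :: "'i \<Rightarrow> complex"
  assumes "finite I" "\<And>i. i \<in> I \<Longrightarrow> norm (a i) \<le> m i" "\<And>i. i \<in> I \<Longrightarrow> norm (b i) \<le> m i"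
  shows "norm ((\<Prod>i\<in>I. a i) - (\<Prod>i\<in>I. b i)) \<le> (\<Sum>j\<in>I. norm (a j - b j) * (\<Prod>i\<in>I - {j}. m i))"
  using assms
proof (induction I)
  case (insert k I)
  have prod_a: "norm (\<Prod>i\<in>I. a i) \<le> (\<Prod>i\<in>I. m i)"
    unfolding prod_norm[symmetric] using insert by (intro prod_mono) auto
  have mk: "0 \<le> m k" using insert.prems(1)[of k] norm_ge_zero[of "a k"] by (simp del: norm_ge_zero)
  have "(\<Prod>i\<in>insert k I. a i) - (\<Prod>i\<in>insert k I. b i) =
      (a k - b k) * (\<Prod>i\<in>I. a i) + b k * ((\<Prod>i\<in>I. a i) - (\<Prod>i\<in>I. b i))"
    using insert.hyps by (simp add: algebra_simps)
  also have "norm \<dots> \<le> norm (a k - b k) * norm (\<Prod>i\<in>I. a i) + norm (b k) * norm ((\<Prod>i\<in>I. a i) - (\<Prod>i\<in>I. b i))"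
    by (rule order_trans[OF norm_triangle_ineq]) (simp add: norm_mult)
  also have "\<dots> \<le> norm (a k - b k) * (\<Prod>i\<in>I. m i) + m k * (\<Sum>j\<in>I. norm (a j - b j) * (\<Prod>i\<in>I - {j}. m i))"
    using insert prod_a mk by (intro add_mono mult_mono) auto
  also have "m k * (\<Sum>j\<in>I. norm (a j - b j) * (\<Prod>i\<in>I - {j}. m i)) =
      (\<Sum>j\<in>I. norm (a j - b j) * (\<Prod>i\<in>insert k I - {j}. m i))"
    unfolding sum_distrib_left
  proof (rule sum.cong[OF refl])
    fix j assume "j \<in> I"
    then have "insert k I - {j} = insert k (I - {j})" using insert.hyps by auto
    then show "m k * (norm (a j - b j) * (\<Prod>i\<in>I - {j}. m i)) = norm (a j - b j) * (\<Prod>i\<in>insert k I - {j}. m i)"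
      using insert.hyps by simp
  qed
  also have "norm (a k - b k) * (\<Prod>i\<in>I. m i) = norm (a k - b k) * (\<Prod>i\<in>insert k I - {k}. m i)"
    using insert.hyps by simp
  finally show ?case using insert.hyps by simp
qed simp

section \<open>Characteristic function of one centred summand\<close>

locale centered_distribution = real_distribution +
  assumes integrable_third: "integrable M (\<lambda>x. \<bar>x\<bar> ^ 3)"
    and mean_0: "expectation (\<lambda>x. x) = 0"
begin

definition "\<rho> = expectation (\<lambda>x. \<bar>x\<bar> ^ 3)"
definition "\<sigma>2 = expectation (\<lambda>x. x\<^sup>2)"

lemma integrable_first: "integrable M (\<lambda>x. x)"
proof (rule Bochner_Integration.integrable_bound)
  show "integrable M (\<lambda>x. 1 + \<bar>x\<bar> ^ 3)" using integrable_third by auto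
  have "\<bar>x\<bar> \<le> 1 + \<bar>x\<bar> ^ 3" for x :: real
    using self_le_power[of "\<bar>x\<bar>" 3] by (cases "1 \<le> \<bar>x\<bar>") (auto intro: add_increasing2)
  then show "AE x in M. norm x \<le> norm (1 + \<bar>x\<bar> ^ 3)" by simp
qed simp

lemma integrable_second: "integrable M (\<lambda>x. x\<^sup>2)"
proof (rule Bochner_Integration.integrable_bound)
  show "integrable M (\<lambda>x. 1 + \<bar>x\<bar> ^ 3)" using integrable_third by auto
  have "x\<^sup>2 \<le> 1 + \<bar>x\<bar> ^ 3" for x :: real
    using power_increasing[of 2 3 "\<bar>x\<bar>"] power_le_one[of "\<bar>x\<bar>" 2]
    by (cases "1 \<le> \<bar>x\<bar>") (auto intro: add_increasing add_increasing2)
  then show "AE x in M. norm (x\<^sup>2) \<le> norm (1 + \<bar>x\<bar> ^ 3)" by simp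
qed simp

lemma \<sigma>2_nonneg: "0 \<le> \<sigma>2" and \<rho>_nonneg: "0 \<le> \<rho>"
  by (auto simp: \<sigma>2_def \<rho>_def intro!: integral_nonneg_AE)

text \<open>Lyapunov's inequality, obtained by integrating the pointwise inequality 3 a x^2 \<le> 2
  |x|^3 + a^3, which is an equality at |x| = a, for a = sqrt \<open>\<sigma>2\<close>.\<close>

lemma sqrt_\<sigma>2_cubed_le: "sqrt \<sigma>2 ^ 3 \<le> \<rho>"
proof -
  define a where "a = sqrt \<sigma>2"
  have a: "0 \<le> a" "a\<^sup>2 = \<sigma>2" using \<sigma>2_nonneg by (auto simp: a_def)
  have "expectation (\<lambda>x. 3 * a * x\<^sup>2) \<le> expectation (\<lambda>x. 2 * \<bar>x\<bar> ^ 3 + a ^ 3)"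
  proof (rule integral_mono)
    fix x :: real
    have "0 \<le> (\<bar>x\<bar> - a)\<^sup>2 * (2 * \<bar>x\<bar> + a)" using a by simp
    also have "\<dots> = 2 * \<bar>x\<bar> ^ 3 + a ^ 3 - 3 * a * \<bar>x\<bar>\<^sup>2"
      by (simp add: power2_eq_square power3_eq_cube algebra_simps del: power2_abs abs_mult_self_eq)
    finally show "3 * a * x\<^sup>2 \<le> 2 * \<bar>x\<bar> ^ 3 + a ^ 3" by simp
  qed (use integrable_second integrable_third in auto)
  then have "3 * a * a\<^sup>2 \<le> 2 * \<rho> + a ^ 3"
    using integrable_second integrable_third
    by (simp add: a(2)[symmetric] \<rho>_def[symmetric] prob_space[simplified])
       (simp add: a(2) \<sigma>2_def)
  then show ?thesis by (simp add: a_def[symmetric] power2_eq_square power3_eq_cube)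
qed

lemma char_taylor: "cmod (char M t - (1 - t\<^sup>2 * \<sigma>2 / 2)) \<le> \<rho> * \<bar>t\<bar> ^ 3 / 6"
proof -
  have "cmod (char M t - (1 - t\<^sup>2 * \<sigma>2 / 2)) \<le> (t\<^sup>2 / 6) * expectation (\<lambda>x. min (6 * x\<^sup>2) (\<bar>t\<bar> * \<bar>x\<bar> ^ 3))"
    using char_approx3[OF integrable_first mean_0 integrable_second, of \<sigma>2 t]
    by (simp add: mean_0 \<sigma>2_def)
  also have "\<dots> \<le> (t\<^sup>2 / 6) * expectation (\<lambda>x. \<bar>t\<bar> * \<bar>x\<bar> ^ 3)"
    using integrable_second integrable_third
    by (intro mult_left_mono integral_mono integrable_min) auto
  also have "\<dots> = (t\<^sup>2 / 6) * (\<bar>t\<bar> * \<rho>)" by (simp add: \<rho>_def)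
  also have "\<dots> = \<rho> * \<bar>t\<bar> ^ 3 / 6"
    by (simp add: power3_eq_cube power2_eq_square)
  finally show ?thesis .
qed

text \<open>While \<open>\<sigma>2\<close> t^2 is at most 2 the quadratic Taylor polynomial is
  nonnegative and 1 + u \<le> exp u applies. Beyond that, Lyapunov's inequality makes the exponent
  nonnegative and the trivial bound 1 suffices; this case is the reason for the coefficient 1/2
  instead of the Taylor constant 1/6.\<close>

lemma cmod_char_le: "cmod (char M t) \<le> exp (- (\<sigma>2 * t\<^sup>2 / 2) + \<rho> * \<bar>t\<bar> ^ 3 / 2)"
proof (cases "\<sigma>2 * t\<^sup>2 \<le> 2")
  case True
  have "cmod (char M t) \<le> cmod (complex_of_real (1 - t\<^sup>2 * \<sigma>2 / 2)) + cmod (char M t - (1 - t\<^sup>2 * \<sigma>2 / 2))"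
    using norm_triangle_sub[of "char M t" "complex_of_real (1 - t\<^sup>2 * \<sigma>2 / 2)"] by simp
  also have "cmod (complex_of_real (1 - t\<^sup>2 * \<sigma>2 / 2)) = 1 - t\<^sup>2 * \<sigma>2 / 2"
    unfolding norm_of_real using True by (simp add: mult.commute)
  also have "1 - t\<^sup>2 * \<sigma>2 / 2 + cmod (char M t - (1 - t\<^sup>2 * \<sigma>2 / 2)) \<le> 1 + (- (\<sigma>2 * t\<^sup>2 / 2) + \<rho> * \<bar>t\<bar> ^ 3 / 6)"
    using char_taylor[of t] by (simp add: mult.commute)
  also have "\<dots> \<le> exp (- (\<sigma>2 * t\<^sup>2 / 2) + \<rho> * \<bar>t\<bar> ^ 3 / 6)" by (rule exp_ge_add_one_self)
  also have "\<dots> \<le> exp (- (\<sigma>2 * t\<^sup>2 / 2) + \<rho> * \<bar>t\<bar> ^ 3 / 2)"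
    using \<rho>_nonneg by (simp add: mult_nonneg_nonneg)
  finally show ?thesis .
next
  case False
  define w where "w = sqrt \<sigma>2 * \<bar>t\<bar>"
  have w: "0 \<le> w" "w\<^sup>2 = \<sigma>2 * t\<^sup>2" using \<sigma>2_nonneg by (auto simp: w_def power_mult_distrib)
  have "1 \<le> w"
  proof (rule ccontr)
    assume "\<not> 1 \<le> w"
    then have "w\<^sup>2 \<le> 1" using w by (intro power_le_one) auto
    with False w show False by simp
  qed
  then have "w\<^sup>2 * 1 \<le> w\<^sup>2 * w" by (intro mult_left_mono) auto
  also have "w\<^sup>2 * w = w ^ 3" by (simp add: power2_eq_square power3_eq_cube)
  also have "\<dots> = sqrt \<sigma>2 ^ 3 * \<bar>t\<bar> ^ 3" by (simp add: w_def power_mult_distrib)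
  also have "\<dots> \<le> \<rho> * \<bar>t\<bar> ^ 3" by (intro mult_right_mono sqrt_\<sigma>2_cubed_le) auto
  finally have "0 \<le> - (\<sigma>2 * t\<^sup>2 / 2) + \<rho> * \<bar>t\<bar> ^ 3 / 2" using w by simp
  then have "1 \<le> exp (- (\<sigma>2 * t\<^sup>2 / 2) + \<rho> * \<bar>t\<bar> ^ 3 / 2)" by simp
  with cmod_char_le_1[of t] show ?thesis by linarith
qed

lemma char_minus_gaussian_le: "cmod (char M t - exp (- (\<sigma>2 * t\<^sup>2 / 2))) \<le> \<rho> * \<bar>t\<bar> ^ 3"
proof -
  define w where "w = sqrt \<sigma>2 * \<bar>t\<bar>"
  have w: "0 \<le> w" "w\<^sup>2 = \<sigma>2 * t\<^sup>2" using \<sigma>2_nonneg by (auto simp: w_def power_mult_distrib)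
  have "cmod (char M t - exp (- (\<sigma>2 * t\<^sup>2 / 2))) \<le>
      cmod (char M t - (1 - t\<^sup>2 * \<sigma>2 / 2)) + cmod (complex_of_real (exp (- (\<sigma>2 * t\<^sup>2 / 2)) - (1 - \<sigma>2 * t\<^sup>2 / 2)))"
    using norm_triangle_ineq4[of "char M t - (1 - t\<^sup>2 * \<sigma>2 / 2)" "complex_of_real (exp (- (\<sigma>2 * t\<^sup>2 / 2)) - (1 - \<sigma>2 * t\<^sup>2 / 2))"]
    by (simp add: mult.commute)
  also have "\<dots> \<le> \<rho> * \<bar>t\<bar> ^ 3 / 6 + w ^ 3 / 2"
    unfolding norm_of_real using abs_exp_minus_half_square_le[OF w(1)] char_taylor[of t]
    by (intro add_mono) (simp_all add: w(2))
  also have "w ^ 3 \<le> \<rho> * \<bar>t\<bar> ^ 3"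
    unfolding w_def power_mult_distrib by (intro mult_right_mono sqrt_\<sigma>2_cubed_le) auto
  then have "\<rho> * \<bar>t\<bar> ^ 3 / 6 + w ^ 3 / 2 \<le> \<rho> * \<bar>t\<bar> ^ 3"
    using mult_nonneg_nonneg[OF \<rho>_nonneg, of "\<bar>t\<bar> ^ 3"] by simp
  finally show ?thesis .
qed

end

lemma std_normal_cdf_lipschitz:
  assumes "x \<le> y"
  shows "cdf std_normal_distribution y - cdf std_normal_distribution x \<le> 1 * (y - x)"
proof -
  interpret N: real_distribution std_normal_distribution by (rule real_dist_normal_dist)
  have le1: "std_normal_density u \<le> 1" for u
  proof -
    have "1 / sqrt (2 * pi) \<le> 1" using pi_gt3 by simp
    then have "1 / sqrt (2 * pi) * exp (- u\<^sup>2 / 2) \<le> 1 * 1" by (intro mult_mono) auto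
    then show ?thesis by (simp add: std_normal_density_def)
  qed
  have "emeasure std_normal_distribution {x<..y} \<le> (\<integral>\<^sup>+u. indicator {x<..y} u \<partial>lborel)"
    by (subst emeasure_density) (simp, simp, intro nn_integral_mono, auto simp: le1 split: split_indicator)
  also have "\<dots> = ennreal (y - x)" using assms by simp
  finally have "measure std_normal_distribution {x<..y} \<le> y - x"
    using assms by (simp add: N.emeasure_eq_measure)
  then show ?thesis using N.cdf_diff_eq[of x y] assms by (cases "x = y") auto
qed

lemma integrable_square_times_gaussian: "integrable lborel (\<lambda>t::real. t\<^sup>2 * exp (- (t\<^sup>2 / 8)))"
proof -
  \<comment> \<open>The weight exp (- t^2 / 8) is sqrt (8 pi) times the density of variance
    4.\<close>
  have "integrable lborel (\<lambda>t. sqrt (8 * pi) * (normal_density 0 2 t * (t - 0) ^ 2))"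
    by (intro integrable_mult_right integrable_normal_moment) auto
  then show ?thesis by (simp add: normal_density_def mult_ac)
qed

text \<open>Smoothing with T of the order of the inverse Lyapunov ratio. The normalised sum enters
  only through its characteristic function, so no variables have to be exhibited. The bound of a
  quarter on each share of the variance guarantees Gaussian decay of the product even after one
  factor has been removed by the telescoping.\<close>

theorem berry_esseen:
  "\<exists>C. \<forall>(I :: 'i set) N B M. finite I \<longrightarrow> (\<forall>i\<in>I. centered_distribution (N i)) \<longrightarrow>
     real_distribution M \<longrightarrow> 0 < B \<longrightarrow> B\<^sup>2 = (\<Sum>i\<in>I. \<integral>x. x\<^sup>2 \<partial>N i) \<longrightarrow>
     (\<forall>i\<in>I. (\<integral>x. x\<^sup>2 \<partial>N i) \<le> B\<^sup>2 / 4) \<longrightarrow>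
     (\<forall>t. char M t = (\<Prod>i\<in>I. char (N i) (t / B))) \<longrightarrow>
     (\<forall>x. \<bar>cdf M x - cdf std_normal_distribution x\<bar> \<le> C * (\<Sum>i\<in>I. \<integral>x. \<bar>x\<bar> ^ 3 \<partial>N i) / B ^ 3)"
proof -
  obtain h where h: "h > 0 \<and> (\<forall>M N T m \<beta>. real_distribution M \<longrightarrow> real_distribution N \<longrightarrow> 0 < T \<longrightarrow>
     (\<forall>x y. x \<le> y \<longrightarrow> cdf N y - cdf N x \<le> m * (y - x)) \<longrightarrow>
     integrable lborel \<beta> \<longrightarrow> (\<forall>t. 0 \<le> \<beta> t) \<longrightarrow>
     (\<forall>t. \<bar>t\<bar> \<le> T \<longrightarrow> cmod (char M t - char N t) \<le> \<bar>t\<bar> * \<beta> t) \<longrightarrow>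
     (\<forall>x. \<bar>cdf M x - cdf N x\<bar> \<le> 2 * (\<integral>t. \<beta> t \<partial>lborel) + 3 * h * m / T))"
    using esseen_smoothing by (rule exE)
  note smoothing = h[THEN conjunct2, rule_format]
  define c where "c = (\<integral>t. (t::real)\<^sup>2 * exp (- (t\<^sup>2 / 8)) \<partial>lborel)"
  show ?thesis
  proof (intro exI[of _ "2 * c + 6 * h"] allI impI)
    fix I :: "'i set" and N B M and x0 :: real
    assume I: "finite I" and N: "\<forall>i\<in>I. centered_distribution (N i)" and M: "real_distribution M"
      and B: "0 < B" and B2: "B\<^sup>2 = (\<Sum>i\<in>I. \<integral>x. x\<^sup>2 \<partial>N i)"
      and small: "\<forall>i\<in>I. (\<integral>x. x\<^sup>2 \<partial>N i) \<le> B\<^sup>2 / 4"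
      and char_M: "\<forall>t. char M t = (\<Prod>i\<in>I. char (N i) (t / B))"
    define v where "v i = (\<integral>x. x\<^sup>2 \<partial>N i)" for i
    define r where "r i = (\<integral>x. \<bar>x\<bar> ^ 3 \<partial>N i)" for i
    define R where "R = (\<Sum>i\<in>I. r i)"
    have v_def': "centered_distribution.\<sigma>2 (N i) = v i" and r_def': "centered_distribution.\<rho> (N i) = r i" if "i \<in> I" for i
      using that N by (auto simp: v_def r_def centered_distribution.\<sigma>2_def centered_distribution.\<rho>_def)
    have v0: "0 \<le> v i" and r0: "0 \<le> r i" and vr: "sqrt (v i) ^ 3 \<le> r i" if "i \<in> I" for i
      using that N centered_distribution.\<sigma>2_nonneg[of "N i"] centered_distribution.\<rho>_nonneg[of "N i"]
        centered_distribution.sqrt_\<sigma>2_cubed_le[of "N i"] by (auto simp: v_def' r_def')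
    have B2': "B\<^sup>2 = (\<Sum>i\<in>I. v i)" by (simp add: v_def B2)
    \<comment> \<open>Needed to divide by R in T: vanishing third moments would, by Lyapunov's
      inequality, make all variances vanish.\<close>
    have "0 < R"
    proof (rule ccontr)
      assume "\<not> 0 < R"
      then have "R = 0" unfolding R_def using r0 by (simp add: sum_nonneg antisym not_less)
      then have "r i = 0" if "i \<in> I" for i using that I r0 unfolding R_def by (simp add: sum_nonneg_eq_0_iff)
      then have "v i = 0" if "i \<in> I" for i
        using vr[OF that] v0[OF that] that by (metis less_eq_real_def linorder_not_le real_sqrt_gt_zero zero_less_power)
      then have "B\<^sup>2 = 0" unfolding B2' by simp
      then show False using B by simp
    qed
    \<comment> \<open>Chosen so that for |t| \<le> T the total cubic term R |s|^3 is at most half of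
      B^2 s^2.\<close>
    define T where "T = B ^ 3 / (2 * R)"
    define \<beta> where "\<beta> t = R / B ^ 3 * (t\<^sup>2 * exp (- (t\<^sup>2 / 8)))" for t
    have "\<bar>cdf M x0 - cdf std_normal_distribution x0\<bar> \<le> 2 * (\<integral>t. \<beta> t \<partial>lborel) + 3 * h * 1 / T"
    proof (rule smoothing[OF M real_dist_normal_dist])
      show "0 < T" using B \<open>0 < R\<close> by (simp add: T_def)
      show "integrable lborel \<beta>" unfolding \<beta>_def
        by (intro integrable_mult_right integrable_square_times_gaussian)
      show "0 \<le> \<beta> t" for t using B \<open>0 < R\<close> by (simp add: \<beta>_def)
      fix t assume t: "\<bar>t\<bar> \<le> T"
      define s where "s = t / B"
      define m where "m i = exp (- (v i * s\<^sup>2 / 2) + r i * \<bar>s\<bar> ^ 3 / 2)" for i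
      have Bs: "B * s = t" using B by (simp add: s_def)
      have "R * \<bar>s\<bar> \<le> B\<^sup>2 / 2"
        using t B \<open>0 < R\<close> by (simp add: s_def T_def field_simps power2_eq_square power3_eq_cube)
      then have "R * \<bar>s\<bar> * s\<^sup>2 \<le> B\<^sup>2 / 2 * s\<^sup>2" by (intro mult_right_mono) auto
      then have Rs: "R * \<bar>s\<bar> ^ 3 \<le> B\<^sup>2 * s\<^sup>2 / 2" by (simp add: power2_eq_square power3_eq_cube mult_ac)
      have prod_m: "(\<Prod>i\<in>I - {j}. m i) \<le> exp (- (t\<^sup>2 / 8))" if j: "j \<in> I" for j
      proof -
        have "(\<Prod>i\<in>I - {j}. m i) = exp (\<Sum>i\<in>I - {j}. - (v i * s\<^sup>2 / 2) + r i * \<bar>s\<bar> ^ 3 / 2)"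
          unfolding m_def using I by (simp add: exp_sum)
        also have "(\<Sum>i\<in>I - {j}. - (v i * s\<^sup>2 / 2) + r i * \<bar>s\<bar> ^ 3 / 2) =
            (\<Sum>i\<in>I. - (v i * s\<^sup>2 / 2) + r i * \<bar>s\<bar> ^ 3 / 2) - (- (v j * s\<^sup>2 / 2) + r j * \<bar>s\<bar> ^ 3 / 2)"
          using I j by (simp add: sum_diff1)
        also have "(\<Sum>i\<in>I. - (v i * s\<^sup>2 / 2) + r i * \<bar>s\<bar> ^ 3 / 2) = - (B\<^sup>2 * s\<^sup>2 / 2) + R * \<bar>s\<bar> ^ 3 / 2"
          by (simp add: B2' R_def sum.distrib sum_subtractf sum_negf sum_distrib_right sum_divide_distrib)
        \<comment> \<open>In units of B^2 s^2 the exponent is at most -1/2, plus 1/4 from the cubic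
          terms, plus 1/8 from the missing factor j, in total -1/8.\<close>
        also have "\<dots> - (- (v j * s\<^sup>2 / 2) + r j * \<bar>s\<bar> ^ 3 / 2) \<le> - (B\<^sup>2 * s\<^sup>2 / 8)"
        proof -
          have "v j * s\<^sup>2 \<le> B\<^sup>2 / 4 * s\<^sup>2" using small j by (intro mult_right_mono) (auto simp: v_def)
          moreover have "0 \<le> r j * \<bar>s\<bar> ^ 3" using r0[OF j] by simp
          ultimately show ?thesis using Rs by simp
        qed
        also have "- (B\<^sup>2 * s\<^sup>2 / 8) = - (t\<^sup>2 / 8)" by (simp add: Bs[symmetric] power_mult_distrib)
        finally show ?thesis by simp
      qed
      have g: "exp (- (t\<^sup>2 / 2)) = (\<Prod>i\<in>I. exp (- (v i * s\<^sup>2 / 2)))"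
      proof -
        have "(\<Sum>i\<in>I. - (v i * s\<^sup>2 / 2)) = - (t\<^sup>2 / 2)"
          unfolding sum_negf sum_divide_distrib[symmetric] sum_distrib_right[symmetric] B2'[symmetric]
          by (simp add: Bs[symmetric] power_mult_distrib)
        then show ?thesis using I by (simp add: exp_sum[symmetric])
      qed
      have "cmod (char M t - char std_normal_distribution t) =
          cmod ((\<Prod>i\<in>I. char (N i) s) - (\<Prod>i\<in>I. complex_of_real (exp (- (v i * s\<^sup>2 / 2)))))"
        unfolding of_real_prod[symmetric] g[symmetric]
        by (simp add: char_M s_def char_std_normal_distribution)
      also have "\<dots> \<le> (\<Sum>j\<in>I. cmod (char (N j) s - exp (- (v j * s\<^sup>2 / 2))) * (\<Prod>i\<in>I - {j}. m i))"
      proof (rule norm_prod_diff_le[OF I])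
        fix i assume i: "i \<in> I"
        show "cmod (char (N i) s) \<le> m i"
          using centered_distribution.cmod_char_le[of "N i" s] N i by (simp add: m_def v_def' r_def')
        show "cmod (complex_of_real (exp (- (v i * s\<^sup>2 / 2)))) \<le> m i"
          using r0[OF i] by (simp add: m_def)
      qed
      also have "\<dots> \<le> (\<Sum>j\<in>I. (r j * \<bar>s\<bar> ^ 3) * exp (- (t\<^sup>2 / 8)))"
      proof (intro sum_mono mult_mono prod_m)
        fix i assume i: "i \<in> I"
        show "cmod (char (N i) s - exp (- (v i * s\<^sup>2 / 2))) \<le> r i * \<bar>s\<bar> ^ 3"
          using centered_distribution.char_minus_gaussian_le[of "N i" s] N i by (simp add: v_def' r_def')
        show "0 \<le> r i * \<bar>s\<bar> ^ 3" using r0[OF i] by simp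
      qed (auto intro!: prod_nonneg simp: m_def)
      also have "\<dots> = R * \<bar>s\<bar> ^ 3 * exp (- (t\<^sup>2 / 8))" by (simp add: R_def sum_distrib_right)
      also have "\<dots> = \<bar>t\<bar> * \<beta> t"
        using B by (simp add: s_def \<beta>_def power_divide abs_div power3_eq_cube power2_eq_square)
      finally show "cmod (char M t - char std_normal_distribution t) \<le> \<bar>t\<bar> * \<beta> t" .
    qed (use std_normal_cdf_lipschitz in auto)
    also have "(\<integral>t. \<beta> t \<partial>lborel) = R / B ^ 3 * c" unfolding \<beta>_def c_def by simp
    also have "2 * (R / B ^ 3 * c) + 3 * h * 1 / T = (2 * c + 6 * h) * R / B ^ 3"
      using B \<open>0 < R\<close> by (simp add: T_def field_simps)
    finally show "\<bar>cdf M x0 - cdf std_normal_distribution x0\<bar> \<le> (2 * c + 6 * h) * (\<Sum>i\<in>I. \<integral>x. \<bar>x\<bar> ^ 3 \<partial>N i) / B ^ 3"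
      by (simp add: R_def r_def)
  qed
qed

section \<open>Extreme quantiles of the Gaussian distribution\<close>

interpretation std_normal: real_distribution std_normal_distribution by (rule real_dist_normal_dist)

abbreviation "\<Phi> \<equiv> cdf std_normal_distribution"

text \<open>The fundamental theorem is used on the interval from z - 1 to z + 1, where the
  distribution function is a constant plus a proper integral; as z is an interior point, the
  one-interval derivative is the full one.\<close>

lemma DERIV_std_normal_cdf [derivative_intros]:
  assumes "(f has_real_derivative f') (at x within s)"
  shows "((\<lambda>x. \<Phi> (f x)) has_real_derivative std_normal_density (f x) * f') (at x within s)"
proof -
  have "(\<Phi> has_real_derivative std_normal_density z) (at z)" for z
  proof -
    have cont: "continuous_on S std_normal_density" for S
      unfolding std_normal_density_def by (intro continuous_intros) auto
    have eq: "\<Phi> y = \<Phi> (z - 1) + (LBINT u=ereal (z - 1)..ereal y. std_normal_density u)" if "y \<in> {z - 1..z + 1}" for y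
    proof (cases "y = z - 1")
      case False
      then have y: "z - 1 < y" using that by auto
      have "\<Phi> y - \<Phi> (z - 1) = measure std_normal_distribution {z - 1<..y}"
        by (rule std_normal.cdf_diff_eq[OF y])
      also have "\<dots> = (\<integral>u. indicator {z - 1<..y} u * std_normal_density u \<partial>lborel)"
      proof -
        have "measure std_normal_distribution {z - 1<..y} = (\<integral>u. indicator {z - 1<..y} u \<partial>std_normal_distribution)" by simp
        also have "\<dots> = (\<integral>u. indicator {z - 1<..y} u * std_normal_density u \<partial>lborel)"
          by (subst integral_density) (auto simp: mult.commute)
        finally show ?thesis .
      qed
      also have "\<dots> = (LBINT u=ereal (z - 1)..ereal y. std_normal_density u)"
        using y by (subst interval_integral_Ioc) (auto simp: set_lebesgue_integral_def)
      finally show ?thesis by simp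
    qed simp
    have "((\<lambda>y. LBINT u=ereal (z - 1)..ereal y. std_normal_density u) has_vector_derivative std_normal_density z) (at z within {z - 1..z + 1})"
      by (rule interval_integral_FTC2[OF _ _ cont]) auto
    from DERIV_add[OF DERIV_const[of "\<Phi> (z - 1)"] this[unfolded has_real_derivative_iff_has_vector_derivative[symmetric]]]
    have "((\<lambda>y. \<Phi> (z - 1) + (LBINT u=ereal (z - 1)..ereal y. std_normal_density u)) has_real_derivative std_normal_density z) (at z within {z - 1..z + 1})"
      by simp
    then have "(\<Phi> has_real_derivative std_normal_density z) (at z within {z - 1..z + 1})"
      by (rule has_field_derivative_transform_within[where d = 1]) (auto simp: eq[symmetric])
    then have "(\<Phi> has_real_derivative std_normal_density z) (at z within {z - 1<..<z + 1})"
      by (rule DERIV_subset) auto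
    then show ?thesis using at_within_open[of z "{z - 1<..<z + 1}"] by simp
  qed
  from DERIV_chain2[OF this assms] show ?thesis .
qed

lemma DERIV_std_normal_density [derivative_intros]:
  assumes "(f has_real_derivative f') (at x within s)"
  shows "((\<lambda>x. std_normal_density (f x)) has_real_derivative - f x * std_normal_density (f x) * f') (at x within s)"
proof -
  have "(std_normal_density has_real_derivative - z * std_normal_density z) (at z)" for z
  proof -
    have "((\<lambda>x::real. exp (- x\<^sup>2 / 2)) has_real_derivative - z * exp (- z\<^sup>2 / 2)) (at z)"
      by (auto intro!: derivative_eq_intros)
    from DERIV_cmult[OF this, of "1 / sqrt (2 * pi)"] show ?thesis
      unfolding std_normal_density_def by (rule DERIV_cong) simp
  qed
  from DERIV_chain2[OF this assms] show ?thesis .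
qed

lemma std_normal_cdf_strict_mono: "strict_mono \<Phi>"
proof (rule strict_monoI)
  fix x y :: real assume "x < y"
  then show "\<Phi> x < \<Phi> y"
  proof (rule DERIV_pos_imp_increasing[of x y \<Phi>])
    fix z
    show "\<exists>d. (\<Phi> has_real_derivative d) (at z) \<and> 0 < d"
      using DERIV_std_normal_cdf[OF DERIV_ident, of z] normal_density_pos[of 1 0 z] by auto
  qed
qed

lemma std_normal_cdf_pos: "0 < \<Phi> x" and std_normal_cdf_less_1: "\<Phi> x < 1"
  using std_normal.cdf_nonneg[of "x - 1"] strict_monoD[OF std_normal_cdf_strict_mono, of "x - 1" x]
    std_normal.cdf_bounded_prob[of "x + 1"] strict_monoD[OF std_normal_cdf_strict_mono, of x "x + 1"]
  by auto

text \<open>The difference of the two sides tends to 0 at infinity and is strictly decreasing, with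
  derivative minus the density over z^2, so it is positive.\<close>

lemma std_normal_tail_le:
  assumes "0 < x"
  shows "1 - \<Phi> x \<le> std_normal_density x / x"
proof -
  let ?f = "\<lambda>x. std_normal_density x / x - (1 - \<Phi> x)"
  have "0 < ?f x"
  proof (rule DERIV_neg_imp_decreasing_at_top[where f = ?f and b = x])
    fix z assume z: "x \<le> z"
    have "(?f has_real_derivative - std_normal_density z / z\<^sup>2) (at z)"
      using z assms by (auto intro!: derivative_eq_intros simp: field_simps power2_eq_square)
    moreover have "- std_normal_density z / z\<^sup>2 < 0" using z assms normal_density_pos[of 1 0 z] by simp
    ultimately show "\<exists>y. (?f has_real_derivative y) (at z) \<and> y < 0" by blast
  next
    show "(?f \<longlongrightarrow> 0) at_top"
    proof -
      have "((\<lambda>x. std_normal_density x / x) \<longlongrightarrow> 0) at_top" unfolding std_normal_density_def by real_asymp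
      from tendsto_diff[OF this tendsto_diff[OF tendsto_const[of 1] std_normal.cdf_lim_at_top_prob]]
      show ?thesis by simp
    qed
  qed
  then show ?thesis by simp
qed

text \<open>Same argument; here the derivative of the difference collapses to -2 times the density
  over (1 + z^2)^2, which is negative on the whole line.\<close>

lemma std_normal_tail_ge: "x / (1 + x\<^sup>2) * std_normal_density x \<le> 1 - \<Phi> x"
proof -
  let ?f = "\<lambda>x. (1 - \<Phi> x) - x / (1 + x\<^sup>2) * std_normal_density x"
  have "0 < ?f x"
  proof (rule DERIV_neg_imp_decreasing_at_top[where f = ?f and b = x])
    fix z :: real
    have nz: "1 + z\<^sup>2 > 0" by (simp add: add_pos_nonneg)
    have "((\<lambda>x. x / (1 + x\<^sup>2)) has_real_derivative (1 - z\<^sup>2) / (1 + z\<^sup>2)\<^sup>2) (at z)"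
      using nz by (auto intro!: derivative_eq_intros simp: power2_eq_square)
    from DERIV_diff[OF DERIV_diff[OF DERIV_const DERIV_std_normal_cdf[OF DERIV_ident]]
        DERIV_mult[OF this DERIV_std_normal_density[OF DERIV_ident]]]
    have "(?f has_real_derivative - (1 + (1 - z\<^sup>2) / (1 + z\<^sup>2)\<^sup>2 - z\<^sup>2 / (1 + z\<^sup>2)) * std_normal_density z) (at z)"
      by (rule DERIV_cong) (simp add: left_diff_distrib distrib_right power2_eq_square[of z])
    moreover have "1 + (1 - z\<^sup>2) / (1 + z\<^sup>2)\<^sup>2 - z\<^sup>2 / (1 + z\<^sup>2) = 2 / (1 + z\<^sup>2)\<^sup>2"
    proof -
      define w where "w = 1 + z\<^sup>2"
      have w: "w > 0" and z2: "z\<^sup>2 = w - 1" using nz by (auto simp: w_def)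
      show ?thesis unfolding w_def[symmetric] z2 using w by (simp add: field_simps power2_eq_square)
    qed
    ultimately have "(?f has_real_derivative - 2 * std_normal_density z / (1 + z\<^sup>2)\<^sup>2) (at z)"
      by simp
    moreover have "- 2 * std_normal_density z / (1 + z\<^sup>2)\<^sup>2 < 0" using nz normal_density_pos[of 1 0 z] by simp
    ultimately show "\<exists>y. (?f has_real_derivative y) (at z) \<and> y < 0" by blast
  next
    show "(?f \<longlongrightarrow> 0) at_top"
    proof -
      have "((\<lambda>x. x / (1 + x\<^sup>2) * std_normal_density x) \<longlongrightarrow> 0) at_top" unfolding std_normal_density_def by real_asymp
      from tendsto_diff[OF tendsto_diff[OF tendsto_const[of 1] std_normal.cdf_lim_at_top_prob] this]
      show ?thesis by simp
    qed
  qed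
  then show ?thesis by simp
qed

text \<open>If \<open>Y\<close> is Gumbel distributed, then the \<open>gumbel_quantile\<close> of \<open>ln m + Y\<close> is distributed like
  the maximum of \<open>m\<close> independent standard Gaussians.\<close>

definition gumbel_score :: "real \<Rightarrow> real" where
  "gumbel_score x = - ln (- ln (\<Phi> x))"

definition gumbel_quantile :: "real \<Rightarrow> real" where
  "gumbel_quantile = the_inv gumbel_score"

text \<open>For large x this is close to the Gaussian hazard rate, since - ln \<open>\<Phi>\<close>
  is close to 1 - \<open>\<Phi>\<close>; hence the Mills ratio bounds show that it grows like
  x.\<close>

definition gumbel_score_deriv :: "real \<Rightarrow> real" where
  "gumbel_score_deriv x = std_normal_density x / (\<Phi> x * (- ln (\<Phi> x)))"

lemma neg_ln_std_normal_cdf_pos: "0 < - ln (\<Phi> x)"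
  using std_normal_cdf_pos[of x] std_normal_cdf_less_1[of x] by simp

lemma neg_ln_std_normal_cdf_ge: "1 - \<Phi> x \<le> - ln (\<Phi> x)"
  using ln_le_minus_one[OF std_normal_cdf_pos[of x]] by simp

lemma neg_ln_std_normal_cdf_le: "\<Phi> x * (- ln (\<Phi> x)) \<le> 1 - \<Phi> x"
proof -
  have "- ln (\<Phi> x) \<le> 1 / \<Phi> x - 1"
    using ln_le_minus_one[of "1 / \<Phi> x"] std_normal_cdf_pos[of x] by (simp add: ln_div)
  then have "\<Phi> x * (- ln (\<Phi> x)) \<le> \<Phi> x * (1 / \<Phi> x - 1)"
    using std_normal_cdf_pos[of x] by (intro mult_left_mono) auto
  then show ?thesis using std_normal_cdf_pos[of x] by (simp add: right_diff_distrib)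
qed

lemma DERIV_gumbel_score: "(gumbel_score has_real_derivative gumbel_score_deriv x) (at x)"
  unfolding gumbel_score_def gumbel_score_deriv_def
  using neg_ln_std_normal_cdf_pos[of x] std_normal_cdf_pos[of x]
  by (auto intro!: derivative_eq_intros simp: field_simps)

lemma gumbel_score_deriv_ge: "std_normal_density x / (1 - \<Phi> x) \<le> gumbel_score_deriv x"
  unfolding gumbel_score_deriv_def
  using neg_ln_std_normal_cdf_le[of x] neg_ln_std_normal_cdf_pos[of x] std_normal_cdf_pos[of x]
  by (intro divide_left_mono mult_pos_pos) (auto simp: std_normal_cdf_less_1)

lemma gumbel_score_deriv_pos: "0 < gumbel_score_deriv x"
  unfolding gumbel_score_deriv_def
  by (intro divide_pos_pos mult_pos_pos neg_ln_std_normal_cdf_pos std_normal_cdf_pos normal_density_pos) auto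

lemma gumbel_score_deriv_ge_self:
  assumes "0 < x"
  shows "x \<le> gumbel_score_deriv x"
proof -
  have "x * (1 - \<Phi> x) \<le> std_normal_density x"
    using std_normal_tail_le[OF assms] assms by (simp add: field_simps)
  then have "x \<le> std_normal_density x / (1 - \<Phi> x)"
    using std_normal_cdf_less_1[of x] by (simp add: field_simps)
  with gumbel_score_deriv_ge[of x] show ?thesis by linarith
qed

lemma gumbel_score_deriv_le:
  assumes "0 < x"
  shows "gumbel_score_deriv x \<le> (1 + x\<^sup>2) / x / \<Phi> x"
proof -
  have nz: "1 + x\<^sup>2 > 0" by (simp add: add_pos_nonneg)
  have "gumbel_score_deriv x \<le> std_normal_density x / (\<Phi> x * (1 - \<Phi> x))"
    unfolding gumbel_score_deriv_def
    using neg_ln_std_normal_cdf_ge[of x] neg_ln_std_normal_cdf_pos[of x] std_normal_cdf_pos[of x] std_normal_cdf_less_1[of x]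
    by (intro divide_left_mono mult_left_mono mult_pos_pos) auto
  also have "\<dots> = std_normal_density x / (1 - \<Phi> x) / \<Phi> x" by simp
  also have "\<dots> \<le> (1 + x\<^sup>2) / x / \<Phi> x"
  proof (rule divide_right_mono)
    show "std_normal_density x / (1 - \<Phi> x) \<le> (1 + x\<^sup>2) / x"
      using std_normal_tail_ge[of x] assms std_normal_cdf_less_1[of x] nz by (simp add: field_simps)
  qed (use std_normal_cdf_pos[of x] in simp)
  finally show ?thesis .
qed

lemma gumbel_score_deriv_over_self: "((\<lambda>x. gumbel_score_deriv x / x) \<longlongrightarrow> 1) at_top"
proof (rule tendsto_sandwich)
  show "eventually (\<lambda>x. 1 \<le> gumbel_score_deriv x / x) at_top"
    using eventually_gt_at_top[of 0] by eventually_elim (auto simp: gumbel_score_deriv_ge_self)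
  show "eventually (\<lambda>x. gumbel_score_deriv x / x \<le> (1 + x\<^sup>2) / x / x / \<Phi> x) at_top"
    using eventually_gt_at_top[of 0]
  proof eventually_elim
    case (elim x)
    with gumbel_score_deriv_le[of x] have "gumbel_score_deriv x / x \<le> (1 + x\<^sup>2) / x / \<Phi> x / x"
      by (intro divide_right_mono) auto
    then show ?case by (simp add: field_simps)
  qed
  have "((\<lambda>x::real. (1 + x\<^sup>2) / x / x) \<longlongrightarrow> 1) at_top" by real_asymp
  from tendsto_divide[OF this std_normal.cdf_lim_at_top_prob]
  show "((\<lambda>x. (1 + x\<^sup>2) / x / x / \<Phi> x) \<longlongrightarrow> 1) at_top" by simp
qed auto

lemma gumbel_score_strict_mono: "strict_mono gumbel_score"
proof (rule strict_monoI)
  fix x y :: real assume "x < y"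
  then show "gumbel_score x < gumbel_score y"
  proof (rule DERIV_pos_imp_increasing[of x y gumbel_score])
    fix z
    show "\<exists>d. (gumbel_score has_real_derivative d) (at z) \<and> 0 < d"
      using DERIV_gumbel_score[of z] gumbel_score_deriv_pos[of z] by blast
  qed
qed

lemma gumbel_score_at_top: "filterlim gumbel_score at_top at_top"
proof -
  have 1: "((\<lambda>x. - ln (\<Phi> x)) \<longlongrightarrow> 0) at_top"
    using tendsto_minus[OF tendsto_ln[OF std_normal.cdf_lim_at_top_prob]] by simp
  have "filterlim (\<lambda>x. - ln (\<Phi> x)) (at_right 0) at_top"
    using 1 neg_ln_std_normal_cdf_pos
    by (intro tendsto_imp_filterlim_at_right always_eventually allI) auto
  then have "filterlim (\<lambda>x. ln (- ln (\<Phi> x))) at_bot at_top"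
    by (rule filterlim_compose[OF ln_at_0])
  then show ?thesis unfolding gumbel_score_def by (simp add: filterlim_uminus_at_top)
qed

lemma gumbel_score_at_bot: "filterlim gumbel_score at_bot at_bot"
proof -
  have "filterlim \<Phi> (at_right 0) at_bot"
    using std_normal.cdf_lim_at_bot std_normal_cdf_pos
    by (intro tendsto_imp_filterlim_at_right always_eventually allI) auto
  then have "filterlim (\<lambda>x. ln (\<Phi> x)) at_bot at_bot"
    by (rule filterlim_compose[OF ln_at_0])
  then have "filterlim (\<lambda>x. - ln (\<Phi> x)) at_top at_bot"
    by (simp add: filterlim_uminus_at_bot)
  then have "filterlim (\<lambda>x. ln (- ln (\<Phi> x))) at_top at_bot"
    by (rule filterlim_compose[OF ln_at_top])
  then show ?thesis unfolding gumbel_score_def by (simp add: filterlim_uminus_at_top)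
qed

lemma gumbel_score_bij: "bij gumbel_score"
proof (rule bijI)
  show "inj gumbel_score" using gumbel_score_strict_mono by (rule strict_mono_imp_inj_on)
  show "surj gumbel_score"
    unfolding surj_def
  proof
    fix y
    obtain a where a: "gumbel_score a \<le> y"
      using gumbel_score_at_bot[unfolded filterlim_at_bot, rule_format, of y]
      by (auto simp: eventually_at_bot_linorder)
    obtain b where b: "y \<le> gumbel_score b"
      using gumbel_score_at_top[unfolded filterlim_at_top, rule_format, of y]
      by (auto simp: eventually_at_top_linorder)
    have "a \<le> b" using a b strict_mono_less_eq[OF gumbel_score_strict_mono, of a b] by linarith
    then have "\<exists>x\<ge>a. x \<le> b \<and> gumbel_score x = y"
      using a b DERIV_isCont[OF DERIV_gumbel_score] by (intro IVT) auto
    then show "\<exists>x. y = gumbel_score x" by blast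
  qed
qed

section \<open>The inverse of the score, and growth estimates for both\<close>

lemma gumbel_score_quantile [simp]: "gumbel_score (gumbel_quantile y) = y"
  unfolding gumbel_quantile_def
  using gumbel_score_bij by (intro f_the_inv_into_f) (auto simp: bij_def)

lemma gumbel_quantile_score [simp]: "gumbel_quantile (gumbel_score x) = x"
  unfolding gumbel_quantile_def
  using gumbel_score_bij by (intro the_inv_f_f) (auto simp: bij_def)

lemma gumbel_quantile_le_iff: "gumbel_quantile y \<le> x \<longleftrightarrow> y \<le> gumbel_score x"
  using strict_mono_less_eq[OF gumbel_score_strict_mono, of "gumbel_quantile y" x] by simp

lemma gumbel_quantile_mono: "x \<le> y \<Longrightarrow> gumbel_quantile x \<le> gumbel_quantile y"
  by (simp add: gumbel_quantile_le_iff)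

lemma borel_measurable_gumbel_quantile [measurable]: "gumbel_quantile \<in> borel_measurable borel"
  by (intro borel_measurable_mono monoI gumbel_quantile_mono)

lemma gumbel_quantile_at_top: "filterlim gumbel_quantile at_top at_top"
  unfolding filterlim_at_top
proof
  fix Z
  show "eventually (\<lambda>x. Z \<le> gumbel_quantile x) at_top"
    using eventually_ge_at_top[of "gumbel_score Z"]
  proof eventually_elim
    case (elim x)
    then show ?case using gumbel_quantile_mono[OF elim] by simp
  qed
qed

text \<open>A lower bound on the slope of the score, that is, an upper bound on increments of the
  quantile. For x at least 1 the derivative exceeds x; on the unit interval it exceeds the density,
  which is smallest at 1. This fixes the constant d / 2.\<close>

lemma gumbel_score_increment_ge:
  "\<exists>c>0. \<forall>a b. 0 \<le> a \<longrightarrow> a \<le> b \<longrightarrow> c * (1 + a) * (b - a) \<le> gumbel_score b - gumbel_score a"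
proof -
  define d where "d = std_normal_density 1"
  have d0: "0 < d" unfolding d_def by (rule normal_density_pos) simp
  have "1 / sqrt (2 * pi) * exp (- 1\<^sup>2 / 2) \<le> 1 * (1::real)" using pi_gt3 by (intro mult_mono) auto
  then have d1: "d \<le> 1" by (simp add: d_def std_normal_density_def)
  have le: "d / 2 * (1 + x) \<le> gumbel_score_deriv x" if "0 \<le> x" for x
  proof (cases "1 \<le> x")
    case True
    have "d / 2 * (1 + x) \<le> 1 / 2 * (1 + x)" using d1 that by (intro mult_right_mono) auto
    also have "\<dots> \<le> x" using True by simp
    finally show ?thesis using gumbel_score_deriv_ge_self[of x] True by linarith
  next
    case False
    have "d / 2 * (1 + x) \<le> d / 2 * 2" using d0 False by (intro mult_left_mono) auto
    also have "\<dots> \<le> std_normal_density x"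
      using that False d0 power_mono[of x 1 2] by (simp add: d_def std_normal_density_def divide_right_mono)
    also have "\<dots> \<le> std_normal_density x / (1 - \<Phi> x)"
      using std_normal_cdf_less_1[of x] std_normal_cdf_pos[of x] by (simp add: field_simps mult_left_le)
    finally show ?thesis using gumbel_score_deriv_ge[of x] by linarith
  qed
  show ?thesis
  proof (intro exI[of _ "d / 2"] conjI allI impI)
    fix a b :: real assume ab: "0 \<le> a" "a \<le> b"
    show "d / 2 * (1 + a) * (b - a) \<le> gumbel_score b - gumbel_score a"
    proof (cases "a = b")
      case False
      then have "a < b" using ab by simp
      from MVT2[OF this DERIV_gumbel_score] obtain z where z: "a < z" "z < b"
        "gumbel_score b - gumbel_score a = (b - a) * gumbel_score_deriv z" by auto
      have "d / 2 * (1 + a) \<le> d / 2 * (1 + z)" using d0 z by (intro mult_left_mono) auto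
      also have "\<dots> \<le> gumbel_score_deriv z" using le[of z] z ab by simp
      finally have "d / 2 * (1 + a) * (b - a) \<le> gumbel_score_deriv z * (b - a)"
        using ab by (intro mult_right_mono) auto
      then show ?thesis unfolding z(3) by (simp only: mult.commute[of "b - a"])
    qed simp
  qed (use d0 in simp)
qed

text \<open>Take logarithms in the two Mills ratio bounds: the density contributes x^2 / 2 plus a
  constant, and its factor of order 1 / x contributes ln x.\<close>

lemma gumbel_score_asymp:
  "\<exists>C\<ge>0. \<forall>x\<ge>1. \<bar>gumbel_score x - x\<^sup>2 / 2\<bar> \<le> C + ln x"
proof -
  define K where "K = ln (sqrt (2 * pi))"
  define P where "P = - ln (\<Phi> 1)"
  have P: "0 \<le> P" unfolding P_def using neg_ln_std_normal_cdf_pos[of 1] by simp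
  have ln_density: "ln (std_normal_density x) = - x\<^sup>2 / 2 - K" for x
    by (simp add: std_normal_density_def K_def ln_div)
  have dpos: "0 < std_normal_density x" for x by (rule normal_density_pos) simp
  show ?thesis
  proof (intro exI[of _ "P + \<bar>K\<bar> + ln 2"] conjI allI impI)
    fix x :: real assume x: "1 \<le> x"
    have nz: "1 + x\<^sup>2 > 0" by (simp add: add_pos_nonneg)
    have Q: "0 < 1 - \<Phi> x" using std_normal_cdf_less_1[of x] by simp
    have "\<Phi> x * (- ln (\<Phi> x)) \<le> std_normal_density x / x"
      using neg_ln_std_normal_cdf_le[of x] std_normal_tail_le[of x] x by linarith
    then have "- ln (\<Phi> x) \<le> (std_normal_density x / x) / \<Phi> x"
      by (subst pos_le_divide_eq[OF std_normal_cdf_pos]) (simp only: mult.commute)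
    then have "ln (- ln (\<Phi> x)) \<le> ln ((std_normal_density x / x) / \<Phi> x)"
      using neg_ln_std_normal_cdf_pos[of x] x dpos[of x] std_normal_cdf_pos[of x] by simp
    also have "\<dots> = ln (std_normal_density x) - ln x - ln (\<Phi> x)"
      using x dpos[of x] std_normal_cdf_pos[of x] by (simp add: ln_div ln_mult)
    finally have "ln (- ln (\<Phi> x)) \<le> ln (std_normal_density x) - ln x - ln (\<Phi> x)" .
    moreover have "- ln (\<Phi> x) \<le> P"
      using x std_normal_cdf_pos[of 1] std_normal_cdf_pos[of x] std_normal.cdf_nondecreasing[OF x] by (simp add: P_def)
    ultimately have lower: "x\<^sup>2 / 2 + K + ln x - P \<le> gumbel_score x"
      by (simp add: gumbel_score_def ln_density)
    have "x / (1 + x\<^sup>2) * std_normal_density x \<le> - ln (\<Phi> x)"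
      using std_normal_tail_ge[of x] neg_ln_std_normal_cdf_ge[of x] by linarith
    then have "ln (x / (1 + x\<^sup>2) * std_normal_density x) \<le> ln (- ln (\<Phi> x))"
      using x nz dpos[of x] neg_ln_std_normal_cdf_pos[of x] by simp
    moreover have "ln (x / (1 + x\<^sup>2) * std_normal_density x) = ln x - ln (1 + x\<^sup>2) + ln (std_normal_density x)"
      using x nz dpos[of x] by (simp add: ln_mult ln_div)
    moreover have "ln (1 + x\<^sup>2) \<le> ln (2 * x\<^sup>2)" using x nz one_le_power[of x 2] by simp
    moreover have "ln (2 * x\<^sup>2) = ln 2 + 2 * ln x" using x by (simp add: ln_mult ln_realpow)
    ultimately have upper: "gumbel_score x \<le> x\<^sup>2 / 2 + K + ln 2 + ln x"
      by (simp add: gumbel_score_def ln_density)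
    have "0 \<le> ln x" "0 \<le> ln (2::real)" using x by auto
    then show "\<bar>gumbel_score x - x\<^sup>2 / 2\<bar> \<le> P + \<bar>K\<bar> + ln 2 + ln x"
      using lower upper P abs_ge_self[of K] abs_ge_minus_self[of K] unfolding abs_le_iff by linarith
  qed (use P in auto)
qed

text \<open>Inversion of the preceding expansion: for x the quantile at u, x^2 - 2 u is of order ln
  u, and division by x + sqrt (2 u) gains a factor sqrt u. The threshold 3 ensures ln u \<ge> 1, so
  that constants can be absorbed.\<close>

lemma gumbel_quantile_asymp:
  "\<exists>C\<ge>0. \<exists>u0\<ge>3. \<forall>u\<ge>u0. \<bar>gumbel_quantile u - sqrt (2 * u)\<bar> \<le> C * ln u / sqrt u"
proof -
  obtain C where C: "C \<ge> 0" "\<And>x. 1 \<le> x \<Longrightarrow> \<bar>gumbel_score x - x\<^sup>2 / 2\<bar> \<le> C + ln x"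
    using gumbel_score_asymp by blast
  define u0 where "u0 = Max {3, gumbel_score 1, C + 1}"
  have u0: "3 \<le> u0" "gumbel_score 1 \<le> u0" "C + 1 \<le> u0" unfolding u0_def by auto
  have main: "\<bar>gumbel_quantile u - sqrt (2 * u)\<bar> \<le> 2 * (C + 3) * ln u / sqrt u" if u: "u0 \<le> u" for u
  proof -
    define x where "x = gumbel_quantile u"
    have x1: "1 \<le> x"
      using gumbel_quantile_mono[of "gumbel_score 1" u] u u0 by (simp add: x_def)
    have ux: "\<bar>u - x\<^sup>2 / 2\<bar> \<le> C + ln x" using C(2)[OF x1] by (simp add: x_def)
    \<comment> \<open>A crude a priori bound, x^2 \<le> 8 u, which allows ln x to be replaced by a
      multiple of ln u; it uses that u exceeds C.\<close>
    have "ln x \<le> x - 1" using x1 ln_le_minus_one by simp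
    also have "x - 1 \<le> x\<^sup>2 / 4"
    proof -
      have "0 \<le> (x / 2 - 1)\<^sup>2" by simp
      then show ?thesis by (simp add: power2_eq_square algebra_simps)
    qed
    finally have "x\<^sup>2 \<le> 8 * u" using ux u u0 by (simp add: abs_le_iff)
    then have "ln (x\<^sup>2) \<le> ln (8 * u)" using x1 u u0 by simp
    then have "2 * ln x \<le> ln 8 + ln u" using x1 u u0 by (simp add: ln_realpow ln_mult)
    moreover have "ln 8 \<le> (3::real)"
    proof -
      have "(8::real) = 2 ^ 3" by simp
      also have "ln (2 ^ 3 :: real) = 3 * ln 2" by (subst ln_realpow) auto
      also have "ln (2::real) \<le> 1" using ln_le_minus_one[of 2] by simp
      finally show ?thesis by simp
    qed
    moreover have lnu: "1 \<le> ln u"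
    proof -
      have "exp 1 \<le> u" using u u0 exp_le by linarith
      then show ?thesis using u u0 by (subst ln_ge_iff) auto
    qed
    ultimately have lnx: "ln x \<le> 2 * ln u" by simp
    have "C \<le> C * ln u" using C(1) lnu by (simp add: mult_le_cancel_left1)
    with lnx ux have "\<bar>u - x\<^sup>2 / 2\<bar> \<le> (C + 2) * ln u" by (simp add: algebra_simps)
    then have 1: "\<bar>x\<^sup>2 - 2 * u\<bar> \<le> 2 * (C + 2) * ln u" by (simp add: abs_le_iff algebra_simps)
    have su: "0 < sqrt u" "sqrt u \<le> sqrt (2 * u)" using u u0 by auto
    have "\<bar>x - sqrt (2 * u)\<bar> * (x + sqrt (2 * u)) = \<bar>(x - sqrt (2 * u)) * (x + sqrt (2 * u))\<bar>"
      using x1 u u0 by (simp add: abs_mult)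
    also have "(x - sqrt (2 * u)) * (x + sqrt (2 * u)) = x\<^sup>2 - 2 * u"
      using u u0 by (simp add: algebra_simps power2_eq_square)
    finally have "\<bar>x - sqrt (2 * u)\<bar> * (x + sqrt (2 * u)) \<le> 2 * (C + 2) * ln u" using 1 by simp
    moreover have "\<bar>x - sqrt (2 * u)\<bar> * sqrt u \<le> \<bar>x - sqrt (2 * u)\<bar> * (x + sqrt (2 * u))"
      using su x1 by (intro mult_left_mono, linarith) simp
    moreover have "2 * (C + 2) * ln u \<le> 2 * (C + 3) * ln u" using lnu by (intro mult_right_mono) auto
    ultimately have fin: "\<bar>x - sqrt (2 * u)\<bar> * sqrt u \<le> 2 * (C + 3) * ln u" by linarith
    show "\<bar>gumbel_quantile u - sqrt (2 * u)\<bar> \<le> 2 * (C + 3) * ln u / sqrt u"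
      using su fin by (simp add: x_def pos_le_divide_eq)
  qed
  show ?thesis
    by (rule exI[of _ "2 * (C + 3)"], rule conjI, use C(1) in simp, rule exI[of _ u0], use main u0 in auto)
qed

lemma gumbel_quantile_ratio: "((\<lambda>u. gumbel_quantile u / sqrt (2 * u)) \<longlongrightarrow> 1) at_top"
proof -
  let ?g = gumbel_quantile
  obtain C u0 where C: "C \<ge> 0" "u0 \<ge> 3" "\<And>u. u \<ge> u0 \<Longrightarrow> \<bar>?g u - sqrt (2 * u)\<bar> \<le> C * ln u / sqrt u"
    using gumbel_quantile_asymp by blast
  have "((\<lambda>u. ?g u / sqrt (2 * u) - 1) \<longlongrightarrow> 0) at_top"
  proof (rule Lim_null_comparison)
    show "eventually (\<lambda>u. norm (?g u / sqrt (2 * u) - 1) \<le> C * ln u / sqrt u / sqrt (2 * u)) at_top"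
      using eventually_ge_at_top[of u0]
    proof eventually_elim
      case (elim u)
      then have "?g u / sqrt (2 * u) - 1 = (?g u - sqrt (2 * u)) / sqrt (2 * u)"
        using C(2) by (simp add: diff_divide_distrib)
      then have "norm (?g u / sqrt (2 * u) - 1) = \<bar>?g u - sqrt (2 * u)\<bar> / sqrt (2 * u)"
        using elim C(2) by (simp add: abs_divide)
      also have "\<dots> \<le> C * ln u / sqrt u / sqrt (2 * u)"
        using C(3)[OF elim] elim C(2) by (intro divide_right_mono) auto
      finally show ?case .
    qed
    show "((\<lambda>u. C * ln u / sqrt u / sqrt (2 * u)) \<longlongrightarrow> 0) at_top" by real_asymp
  qed
  from tendsto_add[OF this tendsto_const[of 1]] show ?thesis by simp
qed

text \<open>By the mean value theorem y is the increment of the quantile times the score derivative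
  at an intermediate point \<open>\<xi>\<close>. Both ends, hence \<open>\<xi>\<close>, are
  asymptotic to sqrt (2 L), and so is the derivative there.\<close>

lemma gumbel_quantile_increment:
  "((\<lambda>L. sqrt (2 * L) * (gumbel_quantile (L + y) - gumbel_quantile L)) \<longlongrightarrow> y) at_top"
proof -
  let ?g = gumbel_quantile
  \<comment> \<open>The sign of y is free, so the endpoints may come in either order or
    coincide.\<close>
  have "\<exists>\<xi>. min (?g L) (?g (L + y)) \<le> \<xi> \<and> \<xi> \<le> max (?g L) (?g (L + y)) \<and>
      y = gumbel_score_deriv \<xi> * (?g (L + y) - ?g L)" for L
  proof (cases "?g L" "?g (L + y)" rule: linorder_cases)
    case less
    from MVT2[OF less DERIV_gumbel_score] obtain z where "?g L < z" "z < ?g (L + y)"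
      "y = (?g (L + y) - ?g L) * gumbel_score_deriv z" by auto
    then show ?thesis by (intro exI[of _ z]) (auto simp: mult.commute)
  next
    case equal
    then have "gumbel_score (?g L) = gumbel_score (?g (L + y))" by simp
    then show ?thesis by (intro exI[of _ "?g L"]) auto
  next
    case greater
    from MVT2[OF greater DERIV_gumbel_score] obtain z where z: "?g (L + y) < z" "z < ?g L"
      "L - (L + y) = (?g L - ?g (L + y)) * gumbel_score_deriv z" by auto
    then have "y = gumbel_score_deriv z * (?g (L + y) - ?g L)" by (simp add: algebra_simps)
    then show ?thesis using z by (intro exI[of _ z]) auto
  qed
  then obtain \<xi> where \<xi>: "min (?g L) (?g (L + y)) \<le> \<xi> L"
      "\<xi> L \<le> max (?g L) (?g (L + y))"
      "y = gumbel_score_deriv (\<xi> L) * (?g (L + y) - ?g L)" for L by metis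
  have shift: "filterlim (\<lambda>L. L + y) at_top at_top" by real_asymp
  have ratio_shift: "((\<lambda>L. ?g (L + y) / sqrt (2 * L)) \<longlongrightarrow> 1) at_top"
  proof -
    have "((\<lambda>L. sqrt (2 * (L + y)) / sqrt (2 * L)) \<longlongrightarrow> 1) at_top" by real_asymp
    from tendsto_mult[OF filterlim_compose[OF gumbel_quantile_ratio shift] this]
    have "((\<lambda>L. ?g (L + y) / sqrt (2 * (L + y)) * (sqrt (2 * (L + y)) / sqrt (2 * L))) \<longlongrightarrow> 1) at_top"
      by simp
    then show ?thesis
    proof (rule Lim_transform_eventually)
      show "eventually (\<lambda>L. ?g (L + y) / sqrt (2 * (L + y)) * (sqrt (2 * (L + y)) / sqrt (2 * L)) =
          ?g (L + y) / sqrt (2 * L)) at_top"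
        using eventually_gt_at_top[of "\<bar>y\<bar>"] by eventually_elim auto
    qed
  qed
  have \<xi>_ratio: "((\<lambda>L. \<xi> L / sqrt (2 * L)) \<longlongrightarrow> 1) at_top"
  proof (rule tendsto_sandwich)
    have "((\<lambda>L. min (?g L / sqrt (2 * L)) (?g (L + y) / sqrt (2 * L))) \<longlongrightarrow> min 1 1) at_top"
      by (intro tendsto_min gumbel_quantile_ratio ratio_shift)
    then show "((\<lambda>L. min (?g L / sqrt (2 * L)) (?g (L + y) / sqrt (2 * L))) \<longlongrightarrow> 1) at_top" by simp
    have "((\<lambda>L. max (?g L / sqrt (2 * L)) (?g (L + y) / sqrt (2 * L))) \<longlongrightarrow> max 1 1) at_top"
      by (intro tendsto_max gumbel_quantile_ratio ratio_shift)
    then show "((\<lambda>L. max (?g L / sqrt (2 * L)) (?g (L + y) / sqrt (2 * L))) \<longlongrightarrow> 1) at_top" by simp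
    show "eventually (\<lambda>L. min (?g L / sqrt (2 * L)) (?g (L + y) / sqrt (2 * L)) \<le> \<xi> L / sqrt (2 * L)) at_top"
      using eventually_gt_at_top[of 0]
    proof eventually_elim
      case (elim L)
      then show ?case using \<xi>(1)[of L] by (auto simp: min_le_iff_disj divide_right_mono)
    qed
    show "eventually (\<lambda>L. \<xi> L / sqrt (2 * L) \<le> max (?g L / sqrt (2 * L)) (?g (L + y) / sqrt (2 * L))) at_top"
      using eventually_gt_at_top[of 0]
    proof eventually_elim
      case (elim L)
      then show ?case using \<xi>(2)[of L] by (auto simp: le_max_iff_disj divide_right_mono)
    qed
  qed
  have "filterlim (\<lambda>L. min (?g L) (?g (L + y))) at_top at_top"
    unfolding filterlim_at_top
  proof
    fix Z
    show "eventually (\<lambda>L. Z \<le> min (?g L) (?g (L + y))) at_top"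
      using gumbel_quantile_at_top[unfolded filterlim_at_top, rule_format, of Z]
        filterlim_compose[OF gumbel_quantile_at_top shift, unfolded filterlim_at_top, rule_format, of Z]
      by eventually_elim auto
  qed
  then have \<xi>_top: "filterlim \<xi> at_top at_top"
    by (rule filterlim_at_top_mono) (use \<xi>(1) in auto)
  have "((\<lambda>L. gumbel_score_deriv (\<xi> L) / \<xi> L * (\<xi> L / sqrt (2 * L))) \<longlongrightarrow> 1 * 1) at_top"
    by (intro tendsto_mult \<xi>_ratio filterlim_compose[OF gumbel_score_deriv_over_self \<xi>_top])
  then have "((\<lambda>L. y / (gumbel_score_deriv (\<xi> L) / \<xi> L * (\<xi> L / sqrt (2 * L)))) \<longlongrightarrow> y / 1) at_top"
    by (intro tendsto_divide tendsto_const) auto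
  then have "((\<lambda>L. y / (gumbel_score_deriv (\<xi> L) / \<xi> L * (\<xi> L / sqrt (2 * L)))) \<longlongrightarrow> y) at_top" by simp
  then show ?thesis
  proof (rule Lim_transform_eventually)
    show "eventually (\<lambda>L. y / (gumbel_score_deriv (\<xi> L) / \<xi> L * (\<xi> L / sqrt (2 * L))) =
        sqrt (2 * L) * (?g (L + y) - ?g L)) at_top"
      using eventually_gt_at_top[of 0] \<xi>_top[unfolded filterlim_at_top, rule_format, of 1]
    proof eventually_elim
      case (elim L)
      have "gumbel_score_deriv (\<xi> L) \<noteq> 0" using gumbel_score_deriv_pos[of "\<xi> L"] by simp
      then have "?g (L + y) - ?g L = y / gumbel_score_deriv (\<xi> L)"
        using \<xi>(3)[of L] by (simp add: field_simps)
      then show ?case using elim by simp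
    qed
  qed
qed

text \<open>The domination for the limit above, uniform in L. The factor with the quantile at y
  itself is forced by very negative y and is harmless: at a Gumbel variable it is a standard
  Gaussian.\<close>

lemma gumbel_quantile_increment_bound:
  "\<exists>C\<ge>0. \<exists>L0\<ge>0. \<forall>L\<ge>L0. \<forall>y. sqrt L * \<bar>gumbel_quantile (L + y) - gumbel_quantile L\<bar>
      \<le> C * ((1 + \<bar>y\<bar>) * (1 + \<bar>gumbel_quantile y\<bar>))"
proof -
  let ?g = gumbel_quantile
  obtain c where c: "c > 0" "\<And>a b. 0 \<le> a \<Longrightarrow> a \<le> b \<Longrightarrow> c * (1 + a) * (b - a) \<le> gumbel_score b - gumbel_score a"
    using gumbel_score_increment_ge by blast
  have "eventually (\<lambda>u. 1 / 2 < ?g u / sqrt (2 * u)) at_top"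
    using gumbel_quantile_ratio by (rule order_tendstoD) simp
  moreover have "eventually (\<lambda>u. ?g u / sqrt (2 * u) < 2) at_top"
    using gumbel_quantile_ratio by (rule order_tendstoD) simp
  ultimately have "eventually (\<lambda>u. u > 0 \<and> 1 / 2 < ?g u / sqrt (2 * u) \<and> ?g u / sqrt (2 * u) < 2) at_top"
    using eventually_gt_at_top[of "0::real"] by eventually_elim auto
  then obtain u0 where u0: "\<And>u. u \<ge> u0 \<Longrightarrow> u > 0 \<and> 1 / 2 < ?g u / sqrt (2 * u) \<and> ?g u / sqrt (2 * u) < 2"
    by (auto simp: eventually_at_top_linorder)
  have u0_pos: "0 < u0" using u0[of u0] by auto
  have low: "sqrt u / 2 \<le> ?g u" and high: "?g u \<le> 4 * sqrt u" if "u \<ge> u0" for u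
  proof -
    from u0[OF that] have "u > 0" "1 / 2 * sqrt (2 * u) < ?g u" "?g u < 2 * sqrt (2 * u)"
      by (auto simp: field_simps)
    moreover have "sqrt u \<le> sqrt (2 * u)" "sqrt (2 * u) \<le> sqrt (2\<^sup>2 * u)" using \<open>u > 0\<close> by auto
    moreover have "sqrt (2\<^sup>2 * u) = 2 * sqrt u" by (simp only: real_sqrt_mult real_sqrt_abs abs_numeral)
    ultimately show "sqrt u / 2 \<le> ?g u" "?g u \<le> 4 * sqrt u" by linarith+
  qed
  \<comment> \<open>The term 4 / c pays for moderate negative y, where passing from L + y to L costs
    a factor 2; the term 16 pays for y below - L / 2.\<close>
  define C where "C = 4 / c + 16"
  have C: "4 / c \<le> C" "16 \<le> C" "0 \<le> C" using c(1) by (auto simp: C_def)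
  have step: "sqrt a * (?g b - ?g a) \<le> 2 / c * (b - a)" if "u0 \<le> a" "a \<le> b" for a b
  proof -
    have "0 \<le> sqrt a" using that u0_pos by simp
    then have g: "sqrt a / 2 \<le> ?g a" "0 \<le> ?g a" "?g a \<le> ?g b"
      using low[OF that(1)] gumbel_quantile_mono[OF that(2)] by linarith+
    have "c * (sqrt a / 2) * (?g b - ?g a) \<le> c * (1 + ?g a) * (?g b - ?g a)"
      using g c(1) by (intro mult_right_mono mult_left_mono) auto
    also have "\<dots> \<le> b - a" using c(2)[OF g(2,3)] by simp
    finally show ?thesis using c(1) by (simp add: field_simps)
  qed
  have main: "sqrt L * \<bar>?g (L + y) - ?g L\<bar>
      \<le> C * ((1 + \<bar>y\<bar>) * (1 + \<bar>?g y\<bar>))" if L: "L \<ge> 2 * u0" for L y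
  proof -
    define D where "D = (1 + \<bar>y\<bar>) * (1 + \<bar>?g y\<bar>)"
    have D: "\<bar>y\<bar> \<le> D" "0 \<le> D" by (auto simp: D_def algebra_simps)
    show "sqrt L * \<bar>?g (L + y) - ?g L\<bar> \<le> C * ((1 + \<bar>y\<bar>) * (1 + \<bar>?g y\<bar>))"
    proof -
      \<comment> \<open>In the first two cases both arguments exceed L / 2 \<ge> \<open>u0\<close>
        and the slope bound applies. In the third, L < 2 |y|, so powers of L turn into powers of
        |y|, while the quantile at L + y is caught between those at y and at L.\<close>
      consider "0 \<le> y" | "y < 0" "L / 2 \<le> L + y" | "L + y < L / 2" by linarith
      then have "sqrt L * \<bar>?g (L + y) - ?g L\<bar> \<le> C * D"
      proof cases
        case 1
        have "sqrt L * \<bar>?g (L + y) - ?g L\<bar> \<le> 2 / c * \<bar>y\<bar>"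
          using step[of L "L + y"] 1 L u0_pos gumbel_quantile_mono[of L "L + y"] by simp
        also have "\<dots> \<le> C * D" using c(1) C D by (intro mult_mono) (auto simp: C_def field_simps)
        finally show ?thesis .
      next
        case 2
        have "sqrt L * \<bar>?g (L + y) - ?g L\<bar> \<le> 2 * (sqrt (L + y) * (?g L - ?g (L + y)))"
        proof -
          have "sqrt L \<le> sqrt (2\<^sup>2 * (L + y))" using 2 L u0_pos by (intro real_sqrt_le_mono) auto
          also have "\<dots> = 2 * sqrt (L + y)" by (simp only: real_sqrt_mult real_sqrt_abs abs_numeral)
          finally have "sqrt L * (?g L - ?g (L + y)) \<le> 2 * sqrt (L + y) * (?g L - ?g (L + y))"
            using gumbel_quantile_mono[of "L + y" L] 2 by (intro mult_right_mono) auto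
          then show ?thesis using gumbel_quantile_mono[of "L + y" L] 2 by simp
        qed
        also have "\<dots> \<le> 2 * (2 / c * \<bar>y\<bar>)"
          using step[of "L + y" L] 2 L by simp
        also have "\<dots> \<le> C * D" using mult_mono[OF C(1) D(1)] C D by simp
        finally show ?thesis .
      next
        case 3
        have Ly: "L \<le> 2 * \<bar>y\<bar>" and y: "y < 0" using 3 L u0_pos by auto
        have "0 \<le> sqrt L" using L u0_pos by simp
        then have gL: "0 \<le> ?g L" "?g L \<le> 4 * sqrt L"
          using low[of L] high[of L] L u0_pos by linarith+
        have "?g y \<le> ?g (L + y)" "?g (L + y) \<le> ?g L"
          using y L u0_pos by (auto intro!: gumbel_quantile_mono)
        then have "\<bar>?g (L + y) - ?g L\<bar> \<le> \<bar>?g y\<bar> + 4 * sqrt L"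
          using gL by linarith
        then have "sqrt L * \<bar>?g (L + y) - ?g L\<bar> \<le> sqrt L * (\<bar>?g y\<bar> + 4 * sqrt L)"
          using L u0_pos by (intro mult_left_mono) auto
        also have "\<dots> = sqrt L * \<bar>?g y\<bar> + 4 * L" using L u0_pos by (simp add: algebra_simps)
        also have "sqrt L * \<bar>?g y\<bar> \<le> (1 + L) * \<bar>?g y\<bar>"
        proof (rule mult_right_mono)
          have "0 \<le> (sqrt L - 1)\<^sup>2" by simp
          then have "2 * sqrt L \<le> 1 + L" using L u0_pos by (simp add: power2_eq_square algebra_simps)
          moreover have "0 \<le> sqrt L" using L u0_pos by simp
          ultimately show "sqrt L \<le> 1 + L" by linarith
        qed simp
        also have "(1 + L) * \<bar>?g y\<bar> \<le> (1 + 2 * \<bar>y\<bar>) * \<bar>?g y\<bar>"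
          using Ly by (intro mult_right_mono) auto
        also have "(1 + 2 * \<bar>y\<bar>) * \<bar>?g y\<bar> + 4 * L \<le> 16 * D"
        proof -
          have "0 \<le> \<bar>y\<bar> * \<bar>?g y\<bar>" by simp
          moreover have "D = 1 + \<bar>y\<bar> + \<bar>?g y\<bar> + \<bar>y\<bar> * \<bar>?g y\<bar>"
            by (simp add: D_def algebra_simps)
          moreover have "(1 + 2 * \<bar>y\<bar>) * \<bar>?g y\<bar> = \<bar>?g y\<bar> + 2 * (\<bar>y\<bar> * \<bar>?g y\<bar>)"
            by (simp add: algebra_simps)
          ultimately show ?thesis using Ly abs_ge_zero[of y] abs_ge_zero[of "?g y"] by linarith
        qed
        also have "16 * D \<le> C * D" using C D by (intro mult_right_mono) auto
        finally show ?thesis by simp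
      qed
      then show ?thesis by (simp add: D_def)
    qed
  qed
  show ?thesis
    by (rule exI[of _ C], rule conjI[OF C(3)], rule exI[of _ "2 * u0"]) (use main u0_pos in auto)
qed

section \<open>Moments of the Gumbel distribution\<close>

abbreviation std_exponential :: "real measure" where
  "std_exponential \<equiv> density lborel (\<lambda>x. ennreal (exponential_density 1 x))"

interpretation std_exponential: prob_space std_exponential
  by (rule prob_space_exponential_density) simp

lemma AE_std_exponential_pos: "AE x in std_exponential. 0 < x"
  using AE_lborel_singleton[of "0::real"]
  by (subst AE_density) (auto simp: exponential_density_def elim!: eventually_mono)

lemma std_exponential_tail:
  assumes "0 \<le> a"
  shows "measure std_exponential {x. a < x} = exp (- a)"
proof -
  have "distributed std_exponential lborel (\<lambda>x. x) (exponential_density 1)"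
    by (auto simp: distributed_def distr_id2 exponential_density_nonneg)
  from std_exponential.exponential_distributedD_gt[OF this assms] show ?thesis by simp
qed

text \<open>For a standard exponential variable E this is the mean of E^(-s), which is Euler's
  integral.\<close>

lemma exp_neg_log_moment:
  assumes "\<bar>s\<bar> < 1"
  shows "integrable std_exponential (\<lambda>x. exp (s * (- ln x)))"
    and "(\<integral>x. exp (s * (- ln x)) \<partial>std_exponential) = Gamma (1 - s)"
proof -
  let ?f = "\<lambda>x. indicator {0<..} x * (x powr (- s) * exp (- x)) :: real"
  have eq: "AE x in lborel. exponential_density 1 x *\<^sub>R exp (s * (- ln x)) = ?f x"
    using AE_lborel_singleton[of 0]
    by eventually_elim (auto simp: exponential_density_def powr_def indicator_def)
  have "((\<lambda>t. t powr ((1 - s) - 1) / exp t) has_integral Gamma (1 - s)) {0..}"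
    using assms by (intro Gamma_integral_real) auto
  then have "((\<lambda>t. if t \<in> {0..} then t powr (- s) / exp t else 0) has_integral Gamma (1 - s)) UNIV"
    by (subst has_integral_restrict_UNIV) simp
  then have "(?f has_integral Gamma (1 - s)) UNIV"
    by (rule has_integral_spike[OF negligible_sing[of 0], rotated])
       (auto simp: indicator_def exp_minus divide_inverse)
  then have "(\<integral>\<^sup>+x. ennreal (?f x) \<partial>lborel) = ennreal (Gamma (1 - s))"
    by (intro nn_integral_has_integral_lborel) auto
  moreover have "0 \<le> Gamma (1 - s)" using assms by (intro less_imp_le Gamma_real_pos) auto
  ultimately have "has_bochner_integral lborel ?f (Gamma (1 - s))"
    by (intro has_bochner_integral_nn_integral) auto
  then have "has_bochner_integral lborel (\<lambda>x. exponential_density 1 x *\<^sub>R exp (s * (- ln x))) (Gamma (1 - s))"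
    by (subst has_bochner_integral_cong_AE[OF _ _ eq]) auto
  then have "has_bochner_integral std_exponential (\<lambda>x. exp (s * (- ln x))) (Gamma (1 - s))"
    by (subst has_bochner_integral_density) (auto simp: exponential_density_nonneg)
  then show "integrable std_exponential (\<lambda>x. exp (s * (- ln x)))"
    and "(\<integral>x. exp (s * (- ln x)) \<partial>std_exponential) = Gamma (1 - s)"
    by (auto simp: has_bochner_integral_iff)
qed

text \<open>A single term of the exponential series. It bounds moments here, and with x = n it gives
  n^n \<le> n! e^n for the sums of logarithms.\<close>

lemma power_le_fact_times_exp:
  fixes x :: real
  assumes "0 \<le> x"
  shows "x ^ n \<le> fact n * exp x"
proof -
  have "(\<Sum>k\<in>{n}. x ^ k / fact k) \<le> (\<Sum>k. x ^ k / fact k)"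
    using assms summable_exp[of x] by (intro sum_le_suminf) (auto simp: field_simps)
  also have "\<dots> = exp x" by (simp add: exp_def field_simps)
  finally show ?thesis by (simp add: field_simps)
qed

text \<open>A dominating function for differentiating the moment generating function. The power
  costs a further exponent 1/4, and 1/2 + 1/4 remains below the critical exponent 1.\<close>

lemma integrable_neg_log_power_exp:
  "integrable std_exponential (\<lambda>x. \<bar>- ln x\<bar> ^ j * exp (\<bar>- ln x\<bar> / 2))"
proof (rule Bochner_Integration.integrable_bound)
  let ?K = "4 ^ j * fact j :: real"
  show "integrable std_exponential (\<lambda>x. ?K * (exp (3 / 4 * (- ln x)) + exp (- (3 / 4) * (- ln x))))"
    by (intro integrable_mult_right Bochner_Integration.integrable_add exp_neg_log_moment) auto
  show "AE x in std_exponential. norm (\<bar>- ln x\<bar> ^ j * exp (\<bar>- ln x\<bar> / 2))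
      \<le> norm (?K * (exp (3 / 4 * (- ln x)) + exp (- (3 / 4) * (- ln x))))"
  proof (rule AE_I2)
    fix x :: real
    define y where "y = - ln x"
    have "(\<bar>y\<bar> / 4) ^ j \<le> fact j * exp (\<bar>y\<bar> / 4)" by (rule power_le_fact_times_exp) simp
    then have "\<bar>y\<bar> ^ j \<le> ?K * exp (\<bar>y\<bar> / 4)" by (simp add: power_divide field_simps)
    then have "\<bar>y\<bar> ^ j * exp (\<bar>y\<bar> / 2) \<le> ?K * exp (\<bar>y\<bar> / 4) * exp (\<bar>y\<bar> / 2)" by (intro mult_right_mono) auto
    also have "\<dots> = ?K * exp (3 / 4 * \<bar>y\<bar>)" by (simp flip: exp_add)
    also have "\<dots> \<le> ?K * (exp (3 / 4 * y) + exp (- (3 / 4) * y))"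
      by (intro mult_left_mono) (auto simp: abs_if)
    finally show "norm (\<bar>- ln x\<bar> ^ j * exp (\<bar>- ln x\<bar> / 2))
        \<le> norm (?K * (exp (3 / 4 * (- ln x)) + exp (- (3 / 4) * (- ln x))))"
      unfolding y_def by simp
  qed
qed simp

lemma integrable_neg_log_power: "integrable std_exponential (\<lambda>x. \<bar>- ln x\<bar> ^ j)"
proof (rule Bochner_Integration.integrable_bound[OF integrable_neg_log_power_exp])
  have "\<bar>y\<bar> ^ j * 1 \<le> \<bar>y\<bar> ^ j * exp (\<bar>y\<bar> / 2)" for y :: real by (intro mult_left_mono) auto
  then show "AE x in std_exponential. norm (\<bar>- ln x\<bar> ^ j) \<le> norm (\<bar>- ln x\<bar> ^ j * exp (\<bar>- ln x\<bar> / 2))"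
    by (intro AE_I2) simp
qed simp

lemma abs_exp_minus_one_le: "\<bar>exp u - 1\<bar> \<le> \<bar>u\<bar> * exp \<bar>u\<bar>" for u :: real
proof (cases "0 \<le> u")
  case True
  have "(1 - u) * exp u \<le> exp (- u) * exp u"
    using exp_ge_add_one_self[of "- u"] by (intro mult_right_mono) auto
  then show ?thesis using True by (simp add: algebra_simps flip: exp_add)
next
  case False
  have "1 - exp u \<le> - u" using exp_ge_add_one_self[of u] by linarith
  also have "- u * 1 \<le> - u * exp (- u)" using False by (intro mult_left_mono) auto
  finally show ?thesis using False by simp
qed

text \<open>Differentiation under the integral sign by dominated convergence along sequences. With s
  and the increment both below 1/4 in modulus, the difference quotients stay below the integrable
  envelope with exponent 1/2.\<close>

lemma DERIV_exp_neg_log_moment: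
  assumes s: "\<bar>s\<bar> < 1 / 4"
  shows "((\<lambda>s. \<integral>x. (- ln x) ^ k * exp (s * (- ln x)) \<partial>std_exponential) has_real_derivative
    (\<integral>x. (- ln x) ^ Suc k * exp (s * (- ln x)) \<partial>std_exponential)) (at s)"
proof -
  define Y :: "real \<Rightarrow> real" where "Y x = - ln x" for x
  have [measurable]: "Y \<in> borel_measurable borel" unfolding Y_def by measurable
  have int: "integrable std_exponential (\<lambda>x. \<bar>Y x\<bar> ^ j * exp (\<bar>Y x\<bar> / 2))" for j
    using integrable_neg_log_power_exp[of j] by (simp add: Y_def)
  have le: "t * y \<le> \<bar>y\<bar> / 2" if "\<bar>t\<bar> \<le> 1 / 2" for t y :: real
  proof -
    have "t * y \<le> \<bar>t\<bar> * \<bar>y\<bar>" by (metis abs_ge_self abs_mult)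
    also have "\<dots> \<le> 1 / 2 * \<bar>y\<bar>" using that by (intro mult_right_mono) auto
    finally show ?thesis by simp
  qed
  have int': "integrable std_exponential (\<lambda>x. Y x ^ j * exp (t * Y x))" if "\<bar>t\<bar> \<le> 1 / 2" for j t
    using le[OF that] by (intro Bochner_Integration.integrable_bound[OF int[of j]] AE_I2)
      (auto simp: abs_mult power_abs intro!: mult_left_mono)
  have "((\<lambda>h. ((\<integral>x. Y x ^ k * exp ((s + h) * Y x) \<partial>std_exponential) - (\<integral>x. Y x ^ k * exp (s * Y x) \<partial>std_exponential)) / h)
      \<longlongrightarrow> (\<integral>x. Y x ^ Suc k * exp (s * Y x) \<partial>std_exponential)) (at 0 within {- (1/4)<..<1/4})"
    unfolding tendsto_at_iff_sequentially comp_def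
  proof (intro allI impI)
    fix h :: "nat \<Rightarrow> real" assume h: "\<forall>i. h i \<in> {- (1/4)<..<1/4} - {0}" and h0: "h \<longlonglongrightarrow> 0"
    have "(\<lambda>i. \<integral>x. Y x ^ k * exp (s * Y x) * ((exp (h i * Y x) - 1) / h i) \<partial>std_exponential) \<longlonglongrightarrow>
       (\<integral>x. Y x ^ k * exp (s * Y x) * Y x \<partial>std_exponential)"
    proof (rule integral_dominated_convergence[where w = "\<lambda>x. \<bar>Y x\<bar> ^ Suc k * exp (\<bar>Y x\<bar> / 2)"])
      show "AE x in std_exponential. (\<lambda>i. Y x ^ k * exp (s * Y x) * ((exp (h i * Y x) - 1) / h i)) \<longlonglongrightarrow> Y x ^ k * exp (s * Y x) * Y x"
      proof (intro AE_I2 tendsto_mult tendsto_const)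
        fix x
        have "((\<lambda>h. exp (h * Y x)) has_real_derivative Y x) (at 0)" by (auto intro!: derivative_eq_intros)
        then have "((\<lambda>h. (exp (h * Y x) - 1) / h) \<longlongrightarrow> Y x) (at 0)" by (simp add: DERIV_def)
        then show "(\<lambda>i. (exp (h i * Y x) - 1) / h i) \<longlonglongrightarrow> Y x"
          by (rule filterlim_compose) (use h h0 in \<open>auto simp: filterlim_at\<close>)
      qed
      show "AE x in std_exponential. norm (Y x ^ k * exp (s * Y x) * ((exp (h i * Y x) - 1) / h i)) \<le> \<bar>Y x\<bar> ^ Suc k * exp (\<bar>Y x\<bar> / 2)" for i
      proof (rule AE_I2)
        fix x
        have hi: "h i \<noteq> 0" "\<bar>h i\<bar> \<le> 1 / 4" using h[rule_format, of i] by auto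
        have "\<bar>(exp (h i * Y x) - 1) / h i\<bar> \<le> \<bar>Y x\<bar> * exp (\<bar>h i\<bar> * \<bar>Y x\<bar>)"
          using abs_exp_minus_one_le[of "h i * Y x"] hi(1) by (simp add: abs_divide abs_mult field_simps)
        also have "\<dots> \<le> \<bar>Y x\<bar> * exp (1 / 4 * \<bar>Y x\<bar>)"
          using mult_right_mono[OF hi(2) abs_ge_zero[of "Y x"]] by (intro mult_left_mono) auto
        finally have 1: "\<bar>(exp (h i * Y x) - 1) / h i\<bar> \<le> \<bar>Y x\<bar> * exp (1 / 4 * \<bar>Y x\<bar>)" .
        have "s * Y x \<le> \<bar>s\<bar> * \<bar>Y x\<bar>" by (metis abs_ge_self abs_mult)
        also have "\<dots> \<le> 1 / 4 * \<bar>Y x\<bar>" using s by (intro mult_right_mono) auto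
        finally have 2: "exp (s * Y x) \<le> exp (1 / 4 * \<bar>Y x\<bar>)" by simp
        have "norm (Y x ^ k * exp (s * Y x) * ((exp (h i * Y x) - 1) / h i)) =
            \<bar>Y x\<bar> ^ k * exp (s * Y x) * \<bar>(exp (h i * Y x) - 1) / h i\<bar>"
          by (simp add: abs_mult power_abs)
        also have "\<dots> \<le> \<bar>Y x\<bar> ^ k * exp (1 / 4 * \<bar>Y x\<bar>) * (\<bar>Y x\<bar> * exp (1 / 4 * \<bar>Y x\<bar>))"
          using 1 2 by (intro mult_mono) auto
        also have "\<dots> = \<bar>Y x\<bar> ^ Suc k * exp (\<bar>Y x\<bar> / 2)" by (simp add: mult_ac flip: exp_add)
        finally show "norm (Y x ^ k * exp (s * Y x) * ((exp (h i * Y x) - 1) / h i)) \<le> \<bar>Y x\<bar> ^ Suc k * exp (\<bar>Y x\<bar> / 2)" .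
      qed
    qed (use int[of "Suc k"] in auto)
    also have "(\<integral>x. Y x ^ k * exp (s * Y x) * Y x \<partial>std_exponential) = (\<integral>x. Y x ^ Suc k * exp (s * Y x) \<partial>std_exponential)"
      by (simp add: mult_ac)
    also have "(\<lambda>i. \<integral>x. Y x ^ k * exp (s * Y x) * ((exp (h i * Y x) - 1) / h i) \<partial>std_exponential) =
      (\<lambda>i. ((\<integral>x. Y x ^ k * exp ((s + h i) * Y x) \<partial>std_exponential) - (\<integral>x. Y x ^ k * exp (s * Y x) \<partial>std_exponential)) / h i)"
    proof
      fix i
      have "\<bar>h i\<bar> < 1 / 4" using h[rule_format, of i] by auto
      then have "\<bar>s + h i\<bar> \<le> 1 / 2" "\<bar>s\<bar> \<le> 1 / 2" using s abs_triangle_ineq[of s "h i"] by linarith+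
      then have "(\<integral>x. Y x ^ k * exp ((s + h i) * Y x) \<partial>std_exponential) - (\<integral>x. Y x ^ k * exp (s * Y x) \<partial>std_exponential) =
        (\<integral>x. Y x ^ k * exp ((s + h i) * Y x) - Y x ^ k * exp (s * Y x) \<partial>std_exponential)"
        by (intro Bochner_Integration.integral_diff[symmetric] int')
      then have "((\<integral>x. Y x ^ k * exp ((s + h i) * Y x) \<partial>std_exponential) - (\<integral>x. Y x ^ k * exp (s * Y x) \<partial>std_exponential)) / h i =
        (\<integral>x. (Y x ^ k * exp ((s + h i) * Y x) - Y x ^ k * exp (s * Y x)) / h i \<partial>std_exponential)"
        by (simp only: integral_divide_zero)
      also have "\<dots> = (\<integral>x. Y x ^ k * exp (s * Y x) * ((exp (h i * Y x) - 1) / h i) \<partial>std_exponential)"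
        by (intro Bochner_Integration.integral_cong refl)
          (simp only: distrib_right exp_add right_diff_distrib mult.assoc times_divide_eq_right mult_1_right)
      finally show "(\<integral>x. Y x ^ k * exp (s * Y x) * ((exp (h i * Y x) - 1) / h i) \<partial>std_exponential) =
        ((\<integral>x. Y x ^ k * exp ((s + h i) * Y x) \<partial>std_exponential) - (\<integral>x. Y x ^ k * exp (s * Y x) \<partial>std_exponential)) / h i"
        by (rule sym)
    qed
    finally show "(\<lambda>i. ((\<integral>x. Y x ^ k * exp ((s + h i) * Y x) \<partial>std_exponential) - (\<integral>x. Y x ^ k * exp (s * Y x) \<partial>std_exponential)) / h i)
       \<longlonglongrightarrow> (\<integral>x. Y x ^ Suc k * exp (s * Y x) \<partial>std_exponential)" .
  qed
  then show ?thesis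
    unfolding DERIV_def Y_def using at_within_open[of 0 "{- (1/4)<..<1/4::real}"] by simp
qed

text \<open>Differentiate Gamma (1 - s) twice at 0. The value \<open>Digamma 1\<close> is left
  symbolic, as it cancels in the variance; \<open>Polygamma 1 1\<close> is the sum of the inverse
  squares.\<close>

lemma neg_log_moments:
  shows "(\<integral>x. - ln x \<partial>std_exponential) = - Digamma 1"
    and "(\<integral>x. (- ln x)\<^sup>2 \<partial>std_exponential) = (Digamma 1)\<^sup>2 + pi\<^sup>2 / 6"
proof -
  define mgf where "mgf k s = (\<integral>x. (- ln x) ^ k * exp (s * (- ln x)) \<partial>std_exponential)" for k s
  have D: "(mgf k has_real_derivative mgf (Suc k) s) (at s)" if "\<bar>s\<bar> < 1 / 4" for k s
    using DERIV_exp_neg_log_moment[OF that, of k] by (simp only: mgf_def[abs_def])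
  have nonint: "1 - s \<notin> \<int>\<^sub>\<le>\<^sub>0" if "\<bar>s\<bar> < 1 / 4" for s :: real
    using that by (auto elim!: nonpos_Ints_cases)
  have mgf0: "mgf 0 s = Gamma (1 - s)" if "\<bar>s\<bar> < 1 / 4" for s
    using exp_neg_log_moment(2)[of s] that by (simp add: mgf_def)
  have mgf1: "mgf 1 s = - Gamma (1 - s) * Digamma (1 - s)" if s: "\<bar>s\<bar> < 1 / 4" for s
  proof -
    have "((\<lambda>s. Gamma (1 - s)) has_real_derivative - Gamma (1 - s) * Digamma (1 - s)) (at s)"
      using nonint[OF s] by (auto intro!: derivative_eq_intros)
    then have "(mgf 0 has_real_derivative - Gamma (1 - s) * Digamma (1 - s)) (at s)"
      by (rule has_field_derivative_transform_within_open[where S = "{-(1/4)<..<1/4}"])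
         (use s mgf0 in auto)
    from DERIV_unique[OF D[OF s, of 0] this] show ?thesis by simp
  qed
  show "(\<integral>x. - ln x \<partial>std_exponential) = - Digamma 1"
    using mgf1[of 0] by (simp add: mgf_def)
  have "((\<lambda>s. - Gamma (1 - s) * Digamma (1 - s)) has_real_derivative (Digamma 1)\<^sup>2 + Polygamma 1 1) (at 0)"
    using nonint[of 0] by (auto intro!: derivative_eq_intros simp: power2_eq_square)
  then have "(mgf 1 has_real_derivative (Digamma 1)\<^sup>2 + Polygamma 1 1) (at 0)"
    by (rule has_field_derivative_transform_within_open[where S = "{-(1/4)<..<1/4}"])
       (use mgf1 in auto)
  from DERIV_unique[OF D[of 0 1] this] have "mgf (Suc 1) 0 = (Digamma 1)\<^sup>2 + Polygamma 1 1" by simp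
  moreover have "Polygamma 1 (1::real) = pi\<^sup>2 / 6"
  proof -
    have "(\<lambda>k. inverse ((1 + real k) ^ Suc 1)) = (\<lambda>k. 1 / (real k + 1)\<^sup>2)"
      by (simp add: fun_eq_iff inverse_eq_divide add.commute numeral_2_eq_2)
    then have "(\<Sum>k. inverse ((1 + real k) ^ Suc 1)) = pi\<^sup>2 / 6"
      using sums_unique[OF inverse_squares_sums] by (simp add: add.commute)
    then show ?thesis unfolding Polygamma_def by simp
  qed
  ultimately show "(\<integral>x. (- ln x)\<^sup>2 \<partial>std_exponential) = (Digamma 1)\<^sup>2 + pi\<^sup>2 / 6"
    by (simp add: mgf_def numeral_2_eq_2)
qed

section \<open>The maximum of independent Gaussians\<close>

definition gauss_max :: "nat \<Rightarrow> real measure" where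
  "gauss_max m = distr std_exponential borel (\<lambda>x. gumbel_quantile (ln (real m) + (- ln x)))"

lemma real_distribution_gauss_max: "real_distribution (gauss_max m)"
  unfolding gauss_max_def by (rule std_exponential.real_distribution_distr) measurable

text \<open>In terms of the exponential variable the event says that it is at least a = - m ln
  (\<open>\<Phi>\<close> x), up to null sets, and exp (- a) is the m-th power of
  \<open>\<Phi>\<close> x.\<close>

lemma cdf_gauss_max:
  assumes "1 \<le> m"
  shows "cdf (gauss_max m) x = \<Phi> x ^ m"
proof -
  define a where "a = real m * (- ln (\<Phi> x))"
  have a: "0 < a" using assms neg_ln_std_normal_cdf_pos[of x] by (simp add: a_def mult_pos_neg)
  have "ln a = ln (real m) - gumbel_score x"
    using assms neg_ln_std_normal_cdf_pos[of x] ln_mult[of "real m" "- ln (\<Phi> x)"] by (simp add: a_def gumbel_score_def)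
  then have iff: "gumbel_quantile (ln (real m) + (- ln e)) \<le> x \<longleftrightarrow> a \<le> e" if "0 < e" for e
    using that a ln_le_cancel_iff[OF a that] by (auto simp: gumbel_quantile_le_iff)
  have "cdf (gauss_max m) x = measure std_exponential {e. gumbel_quantile (ln (real m) + (- ln e)) \<le> x}"
    unfolding cdf_def gauss_max_def by (subst measure_distr) (auto intro!: arg_cong[where f = "measure _"])
  also have "\<dots> = measure std_exponential {e. a < e}"
  proof (rule std_exponential.finite_measure_eq_AE)
    have "AE e in std_exponential. e \<noteq> a"
      using AE_lborel_singleton[of a] by (subst AE_density) (auto elim!: eventually_mono)
    with AE_std_exponential_pos
    show "AE e in std_exponential. e \<in> {e. gumbel_quantile (ln (real m) + (- ln e)) \<le> x} \<longleftrightarrow> e \<in> {e. a < e}"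
      by eventually_elim (auto simp: iff[simplified])
  qed measurable
  also have "\<dots> = exp (- a)" using a by (intro std_exponential_tail) simp
  also have "\<dots> = \<Phi> x ^ m"
    using std_normal_cdf_pos[of x] by (simp add: a_def exp_of_nat_mult)
  finally show ?thesis .
qed

text \<open>Read backwards, this says that the quantile at a Gumbel variable is standard Gaussian,
  which yields all its moments.\<close>

lemma gauss_max_1: "gauss_max 1 = std_normal_distribution"
proof (rule cdf_unique)
  show "cdf (gauss_max 1) = \<Phi>" using cdf_gauss_max[of 1] by auto
qed (use real_distribution_gauss_max real_dist_normal_dist in auto)

text \<open>The right-hand side of the increment bound at y = - ln x, a majorant common to all large
  m.\<close>

definition gumbel_envelope :: "real \<Rightarrow> real" where
  "gumbel_envelope x = (1 + \<bar>- ln x\<bar>) * (1 + \<bar>gumbel_quantile (- ln x)\<bar>)"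

lemma borel_measurable_gumbel_envelope [measurable]: "gumbel_envelope \<in> borel_measurable borel"
  unfolding gumbel_envelope_def by measurable

lemma gumbel_envelope_ge_1: "1 \<le> gumbel_envelope x"
proof -
  have "1 * 1 \<le> (1 + \<bar>- ln x\<bar>) * (1 + \<bar>gumbel_quantile (- ln x)\<bar>)" by (intro mult_mono) auto
  then show ?thesis by (simp add: gumbel_envelope_def)
qed

lemma one_plus_power_le: "(1 + x) ^ n \<le> 2 ^ n * (1 + x ^ n)" if "0 \<le> x" for x :: real
proof -
  have "(1 + x) ^ n \<le> (2 * max 1 x) ^ n" using that by (intro power_mono) auto
  also have "\<dots> = 2 ^ n * max 1 x ^ n" by (simp add: power_mult_distrib)
  also have "max 1 x ^ n \<le> 1 + x ^ n" using that by (auto simp: max_def)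
  finally show ?thesis by simp
qed

text \<open>The two factors are dependent; the inequality a b \<le> a^2 + b^2 separates them. One
  then has exponential moments, the other Gaussian moments.\<close>

lemma integrable_gumbel_envelope_power: "integrable std_exponential (\<lambda>x. gumbel_envelope x ^ k)"
proof -
  let ?Y = "\<lambda>x. \<bar>- ln x\<bar> :: real" and ?G = "\<lambda>x. \<bar>gumbel_quantile (- ln x)\<bar>"
  have "integrable std_normal_distribution (\<lambda>x. \<bar>x\<bar> ^ n)" for n
    by (subst integrable_real_density) (auto intro: integrable_std_normal_moment_abs)
  then have "integrable (gauss_max 1) (\<lambda>x. \<bar>x\<bar> ^ n)" for n by (simp only: gauss_max_1)
  then have G: "integrable std_exponential (\<lambda>x. ?G x ^ n)" for n
    unfolding gauss_max_def by (subst (asm) integrable_distr_eq) auto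
  show ?thesis
  proof (rule Bochner_Integration.integrable_bound)
    show "integrable std_exponential (\<lambda>x. 2 ^ (2 * k) * (1 + ?Y x ^ (2 * k)) + 2 ^ (2 * k) * (1 + ?G x ^ (2 * k)))"
      by (intro Bochner_Integration.integrable_add integrable_mult_right integrable_neg_log_power G) auto
    show "AE x in std_exponential. norm (gumbel_envelope x ^ k) \<le>
        norm (2 ^ (2 * k) * (1 + ?Y x ^ (2 * k)) + 2 ^ (2 * k) * (1 + ?G x ^ (2 * k)))"
    proof (rule AE_I2)
      fix x :: real
      define a b where "a = (1 + ?Y x) ^ k" and "b = (1 + ?G x) ^ k"
      have "0 \<le> (a - b)\<^sup>2" by simp
      then have "2 * (a * b) \<le> a\<^sup>2 + b\<^sup>2" by (simp add: power2_eq_square algebra_simps)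
      moreover have "0 \<le> a * b" by (simp add: a_def b_def)
      ultimately have "a * b \<le> a\<^sup>2 + b\<^sup>2" by linarith
      also have "\<dots> = (1 + ?Y x) ^ (2 * k) + (1 + ?G x) ^ (2 * k)"
        by (simp add: a_def b_def mult.commute flip: power_mult)
      also have "\<dots> \<le> 2 ^ (2 * k) * (1 + ?Y x ^ (2 * k)) + 2 ^ (2 * k) * (1 + ?G x ^ (2 * k))"
        by (intro add_mono one_plus_power_le) auto
      finally have "gumbel_envelope x ^ k \<le> \<dots>"
        by (simp only: gumbel_envelope_def power_mult_distrib a_def b_def)
      moreover have "0 \<le> gumbel_envelope x ^ k" using gumbel_envelope_ge_1[of x] by simp
      ultimately show "norm (gumbel_envelope x ^ k) \<le>
        norm (2 ^ (2 * k) * (1 + ?Y x ^ (2 * k)) + 2 ^ (2 * k) * (1 + ?G x ^ (2 * k)))" unfolding real_norm_def by linarith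
    qed
  qed measurable
qed

text \<open>The increment bound holds for large L only. For any other L \<ge> 0, monotonicity
  squeezes the quantile at L + y between those at y and at \<open>L1\<close> + y; thus the maxima
  have moments also for small m.\<close>

lemma gumbel_quantile_shift_bound:
  assumes "0 \<le> L"
  shows "\<exists>K\<ge>0. \<forall>y. \<bar>gumbel_quantile (L + y)\<bar> \<le> K * ((1 + \<bar>y\<bar>) * (1 + \<bar>gumbel_quantile y\<bar>))"
proof -
  let ?g = gumbel_quantile
  obtain C L0 where C: "0 \<le> C" "0 \<le> L0" "\<And>L y. L0 \<le> L \<Longrightarrow> sqrt L * \<bar>?g (L + y) - ?g L\<bar>
      \<le> C * ((1 + \<bar>y\<bar>) * (1 + \<bar>?g y\<bar>))"
    using gumbel_quantile_increment_bound by blast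
  define L1 where "L1 = max 1 (max L L0)"
  define K where "K = 1 + (C + \<bar>?g L1\<bar>)"
  have L1: "1 \<le> L1" "L \<le> L1" "L0 \<le> L1" by (auto simp: L1_def)
  have "\<bar>?g (L + y)\<bar> \<le> K * ((1 + \<bar>y\<bar>) * (1 + \<bar>?g y\<bar>))" for y
  proof -
    define W where "W = (1 + \<bar>y\<bar>) * (1 + \<bar>?g y\<bar>)"
    have W: "1 \<le> W" "\<bar>?g y\<bar> \<le> W"
    proof -
      have "1 * (1 + \<bar>?g y\<bar>) \<le> W" unfolding W_def by (intro mult_right_mono) auto
      then show "1 \<le> W" "\<bar>?g y\<bar> \<le> W" by auto
    qed
    have "1 * \<bar>?g (L1 + y) - ?g L1\<bar> \<le> sqrt L1 * \<bar>?g (L1 + y) - ?g L1\<bar>"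
      using L1 by (intro mult_right_mono) auto
    also have "\<dots> \<le> C * W" using C(3)[OF L1(3)] by (simp add: W_def)
    finally have "\<bar>?g (L1 + y)\<bar> \<le> C * W + \<bar>?g L1\<bar> * 1"
      using abs_triangle_ineq2[of "?g (L1 + y)" "?g L1"] by simp
    also have "\<dots> \<le> C * W + \<bar>?g L1\<bar> * W" using W by (intro add_left_mono mult_left_mono) auto
    finally have 1: "\<bar>?g (L1 + y)\<bar> \<le> (C + \<bar>?g L1\<bar>) * W" by (simp add: algebra_simps)
    have "?g y \<le> ?g (L + y)" "?g (L + y) \<le> ?g (L1 + y)"
      using assms L1 by (auto intro!: gumbel_quantile_mono)
    then have "\<bar>?g (L + y)\<bar> \<le> \<bar>?g y\<bar> + \<bar>?g (L1 + y)\<bar>" by linarith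
    also have "\<dots> \<le> W + (C + \<bar>?g L1\<bar>) * W" using W 1 by simp
    also have "\<dots> = K * W" by (simp add: K_def algebra_simps)
    finally show ?thesis by (simp add: W_def)
  qed
  moreover have "0 \<le> K" using C by (simp add: K_def)
  ultimately show ?thesis by blast
qed

lemma integrable_gauss_max_abs_power:
  assumes "1 \<le> m"
  shows "integrable (gauss_max m) (\<lambda>x. \<bar>x\<bar> ^ k)"
proof -
  let ?g = gumbel_quantile
  obtain K where K: "0 \<le> K" "\<And>y. \<bar>?g (ln (real m) + y)\<bar> \<le> K * ((1 + \<bar>y\<bar>) * (1 + \<bar>?g y\<bar>))"
    using gumbel_quantile_shift_bound[of "ln (real m)"] assms by auto
  have "integrable std_exponential (\<lambda>x. \<bar>?g (ln (real m) + (- ln x))\<bar> ^ k)"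
  proof (rule Bochner_Integration.integrable_bound)
    show "integrable std_exponential (\<lambda>x. K ^ k * gumbel_envelope x ^ k)"
      by (intro integrable_mult_right integrable_gumbel_envelope_power)
    show "AE x in std_exponential. norm (\<bar>?g (ln (real m) + (- ln x))\<bar> ^ k) \<le> norm (K ^ k * gumbel_envelope x ^ k)"
    proof (rule AE_I2)
      fix x :: real
      have "\<bar>?g (ln (real m) + (- ln x))\<bar> ^ k \<le> (K * gumbel_envelope x) ^ k"
        unfolding gumbel_envelope_def by (intro power_mono K) auto
      then show "norm (\<bar>?g (ln (real m) + (- ln x))\<bar> ^ k) \<le> norm (K ^ k * gumbel_envelope x ^ k)"
        using K(1) gumbel_envelope_ge_1[of x] by (simp add: power_mult_distrib)
    qed
  qed measurable
  then show ?thesis unfolding gauss_max_def by (subst integrable_distr_eq) auto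
qed

section \<open>Mean, variance and third absolute central moment of the maxima\<close>

definition gauss_max_mean :: "nat \<Rightarrow> real" where
  "gauss_max_mean m = (\<integral>x. x \<partial>gauss_max m)"

definition gauss_max_var :: "nat \<Rightarrow> real" where
  "gauss_max_var m = (\<integral>x. (x - gauss_max_mean m)\<^sup>2 \<partial>gauss_max m)"

definition gauss_max_third :: "nat \<Rightarrow> real" where
  "gauss_max_third m = (\<integral>x. \<bar>x - gauss_max_mean m\<bar> ^ 3 \<partial>gauss_max m)"

definition gauss_max_dev :: "nat \<Rightarrow> real \<Rightarrow> real" where
  "gauss_max_dev m x = sqrt (2 * ln (real m)) *
     (gumbel_quantile (ln (real m) + (- ln x)) - gumbel_quantile (ln (real m)))"

lemma borel_measurable_gauss_max_dev [measurable]: "gauss_max_dev m \<in> borel_measurable borel"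
  unfolding gauss_max_dev_def by measurable

lemma gauss_max_dev_bound:
  "\<exists>C\<ge>0. \<exists>m0\<ge>3. \<forall>m\<ge>m0. \<forall>x. \<bar>gauss_max_dev m x\<bar> \<le> C * gumbel_envelope x"
proof -
  obtain C L0 where C: "0 \<le> C" "0 \<le> L0" "\<And>L y. L0 \<le> L \<Longrightarrow> sqrt L * \<bar>gumbel_quantile (L + y) - gumbel_quantile L\<bar>
      \<le> C * ((1 + \<bar>y\<bar>) * (1 + \<bar>gumbel_quantile y\<bar>))"
    using gumbel_quantile_increment_bound by blast
  define m0 where "m0 = max 3 (nat \<lceil>exp L0\<rceil>)"
  have "\<bar>gauss_max_dev m x\<bar> \<le> sqrt 2 * C * gumbel_envelope x" if "m0 \<le> m" for m x
  proof -
    have "exp L0 \<le> real m" using that unfolding m0_def by linarith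
    then have "L0 \<le> ln (real m)" using that by (subst ln_ge_iff) (auto simp: m0_def)
    then have "sqrt 2 * (sqrt (ln (real m)) * \<bar>gumbel_quantile (ln (real m) + (- ln x)) - gumbel_quantile (ln (real m))\<bar>)
       \<le> sqrt 2 * (C * gumbel_envelope x)"
      unfolding gumbel_envelope_def by (intro mult_left_mono C(3)) auto
    then show ?thesis
      using \<open>L0 \<le> ln (real m)\<close> C(2) by (simp add: gauss_max_dev_def abs_mult real_sqrt_mult mult.assoc)
  qed
  moreover have "3 \<le> m0" "0 \<le> sqrt 2 * C" using C by (auto simp: m0_def)
  ultimately show ?thesis by blast
qed

lemma gauss_max_dev_moments:
  shows "(\<lambda>m. \<integral>x. gauss_max_dev m x \<partial>std_exponential) \<longlonglongrightarrow> - Digamma 1" (is ?first)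
    and "(\<lambda>m. \<integral>x. (gauss_max_dev m x)\<^sup>2 \<partial>std_exponential) \<longlonglongrightarrow> (Digamma 1)\<^sup>2 + pi\<^sup>2 / 6" (is ?second)
    and "\<exists>C m0. \<forall>m\<ge>m0. (\<integral>x. \<bar>gauss_max_dev m x\<bar> ^ 3 \<partial>std_exponential) \<le> C" (is ?third)
    and "\<exists>m0. \<forall>m\<ge>m0. \<forall>k. integrable std_exponential (\<lambda>x. gauss_max_dev m x ^ k)" (is ?int)
proof -
  obtain C m0 where C: "0 \<le> C" "3 \<le> m0" "\<And>m x. m0 \<le> m \<Longrightarrow> \<bar>gauss_max_dev m x\<bar> \<le> C * gumbel_envelope x"
    using gauss_max_dev_bound by blast
  have Ck: "\<bar>gauss_max_dev m x\<bar> ^ k \<le> C ^ k * gumbel_envelope x ^ k" if "m0 \<le> m" for m x k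
    using power_mono[OF C(3)[OF that] abs_ge_zero] by (simp add: power_mult_distrib)
  have intE: "integrable std_exponential (\<lambda>x. C ^ k * gumbel_envelope x ^ k)" for k
    by (intro integrable_mult_right integrable_gumbel_envelope_power)
  have Epos: "0 \<le> C ^ k * gumbel_envelope x ^ k" for k x
    using C(1) gumbel_envelope_ge_1[of x] by simp
  have int: "integrable std_exponential (\<lambda>x. gauss_max_dev m x ^ k)" if "m0 \<le> m" for m k
    by (rule Bochner_Integration.integrable_bound[OF intE[of k]])
       (use Ck[OF that] Epos in \<open>auto simp: power_abs intro!: AE_I2\<close>)
  then show ?int by blast
  have lim: "(\<lambda>m. gauss_max_dev m x) \<longlonglongrightarrow> - ln x" for x
  proof -
    have "filterlim (\<lambda>m. ln (real m)) at_top sequentially" by real_asymp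
    from filterlim_compose[OF gumbel_quantile_increment this, of "- ln x"]
    show ?thesis by (simp add: gauss_max_dev_def)
  qed
  have conv: "(\<lambda>m. \<integral>x. gauss_max_dev m x ^ k \<partial>std_exponential) \<longlonglongrightarrow> (\<integral>x. (- ln x) ^ k \<partial>std_exponential)" for k
  \<comment> \<open>The majorant is valid from \<open>m0\<close> on, so the sequence is
    shifted.\<close>
  proof (rule LIMSEQ_offset[of _ m0], rule integral_dominated_convergence[OF _ _ intE[of k]])
    show "AE x in std_exponential. (\<lambda>m. gauss_max_dev (m + m0) x ^ k) \<longlonglongrightarrow> (- ln x) ^ k"
      by (intro AE_I2 tendsto_power LIMSEQ_ignore_initial_segment lim)
    show "AE x in std_exponential. norm (gauss_max_dev (m + m0) x ^ k) \<le> C ^ k * gumbel_envelope x ^ k" for m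
      using Ck[of "m + m0"] by (intro AE_I2) (auto simp: power_abs)
  qed measurable
  show ?first using conv[of 1] neg_log_moments(1) by simp
  show ?second using conv[of 2] neg_log_moments(2) by simp
  show ?third
  proof (intro exI allI impI)
    fix m assume m: "m0 \<le> m"
    show "(\<integral>x. \<bar>gauss_max_dev m x\<bar> ^ 3 \<partial>std_exponential) \<le> (\<integral>x. C ^ 3 * gumbel_envelope x ^ 3 \<partial>std_exponential)"
      using int[OF m, of 3] Ck[OF m, of _ 3] by (intro integral_mono intE) (auto simp: power_abs[symmetric])
  qed
qed

lemma gauss_max_integral:
  assumes [measurable]: "f \<in> borel_measurable borel"
  shows "(\<integral>x. f x \<partial>gauss_max m) = (\<integral>x. (f (gumbel_quantile (ln (real m) + (- ln x)))::real) \<partial>std_exponential)"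
  unfolding gauss_max_def by (subst integral_distr) auto

lemma gauss_max_quantile_eq:
  assumes "2 \<le> m"
  shows "gumbel_quantile (ln (real m) + (- ln x)) = gumbel_quantile (ln (real m)) + gauss_max_dev m x / sqrt (2 * ln (real m))"
  using assms by (simp add: gauss_max_dev_def)

text \<open>The maximum is an affine function of \<open>gauss_max_dev\<close>, so its moments are
  those of the rescaled deviation, with one factor 1 / sqrt (2 ln m) for each order.\<close>

lemma gauss_max_eventually:
  "\<exists>m0\<ge>3. \<forall>m\<ge>m0.
     gauss_max_mean m = gumbel_quantile (ln (real m)) + (\<integral>x. gauss_max_dev m x \<partial>std_exponential) / sqrt (2 * ln (real m)) \<and>
     ln (real m) * gauss_max_var m = ((\<integral>x. (gauss_max_dev m x)\<^sup>2 \<partial>std_exponential) - (\<integral>x. gauss_max_dev m x \<partial>std_exponential)\<^sup>2) / 2 \<and>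
     gauss_max_third m \<le> 8 * (\<integral>x. \<bar>gauss_max_dev m x\<bar> ^ 3 \<partial>std_exponential) / sqrt (2 * ln (real m)) ^ 3"
proof -
  obtain m1 where int: "\<And>m k. m1 \<le> m \<Longrightarrow> integrable std_exponential (\<lambda>x. gauss_max_dev m x ^ k)"
    using gauss_max_dev_moments(4) by blast
  have "gauss_max_mean m = gumbel_quantile (ln (real m)) + (\<integral>x. gauss_max_dev m x \<partial>std_exponential) / sqrt (2 * ln (real m)) \<and>
     ln (real m) * gauss_max_var m = ((\<integral>x. (gauss_max_dev m x)\<^sup>2 \<partial>std_exponential) - (\<integral>x. gauss_max_dev m x \<partial>std_exponential)\<^sup>2) / 2 \<and>
     gauss_max_third m \<le> 8 * (\<integral>x. \<bar>gauss_max_dev m x\<bar> ^ 3 \<partial>std_exponential) / sqrt (2 * ln (real m)) ^ 3"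
    if "max 3 m1 \<le> m" for m
  proof -
    have m: "3 \<le> m" "m1 \<le> m" using that by auto
    define s where "s = sqrt (2 * ln (real m))"
    define Z where "Z = gauss_max_dev m"
    have [measurable]: "Z \<in> borel_measurable borel" by (simp add: Z_def)
    define e where "e = (\<integral>x. Z x \<partial>std_exponential)"
    have s: "0 < s" "s\<^sup>2 = 2 * ln (real m)" using m by (auto simp: s_def)
    have intZ: "integrable std_exponential (\<lambda>x. Z x ^ k)" for k using int[OF m(2)] by (simp add: Z_def)
    have intZ1: "integrable std_exponential Z" using intZ[of 1] by simp
    have q: "gumbel_quantile (ln (real m) + (- ln x)) = gumbel_quantile (ln (real m)) + Z x / s" for x
      using gauss_max_quantile_eq[of m x] m by (simp add: Z_def s_def)
    have mean: "gauss_max_mean m = gumbel_quantile (ln (real m)) + e / s"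
      unfolding gauss_max_mean_def gauss_max_integral[of "\<lambda>x. x", OF measurable_ident_sets[OF refl]] q
      using intZ1 by (simp add: std_exponential.prob_space[simplified] e_def)
    have dev: "gumbel_quantile (ln (real m) + (- ln x)) - gauss_max_mean m = (Z x - e) / s" for x
      unfolding q mean by (simp add: diff_divide_distrib)
    have "gauss_max_var m = (\<integral>x. (Z x - e)\<^sup>2 / s\<^sup>2 \<partial>std_exponential)"
      unfolding gauss_max_var_def by (subst gauss_max_integral) (auto simp: dev[simplified] power_divide)
    also have "\<dots> = std_exponential.variance Z / s\<^sup>2" by (simp add: e_def)
    also have "std_exponential.variance Z = (\<integral>x. (Z x)\<^sup>2 \<partial>std_exponential) - e\<^sup>2"
      unfolding e_def using intZ1 intZ[of 2] by (rule std_exponential.variance_eq)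
    finally have var: "ln (real m) * gauss_max_var m = ((\<integral>x. (Z x)\<^sup>2 \<partial>std_exponential) - e\<^sup>2) / 2"
      using m by (simp add: s(2))
    have "gauss_max_third m = (\<integral>x. \<bar>Z x - e\<bar> ^ 3 / s ^ 3 \<partial>std_exponential)"
      unfolding gauss_max_third_def
      by (subst gauss_max_integral) (use s in \<open>auto simp: dev[simplified] power_divide abs_divide\<close>)
    also have "\<dots> = (\<integral>x. \<bar>Z x - e\<bar> ^ 3 \<partial>std_exponential) / s ^ 3" by simp
    also have "(\<integral>x. \<bar>Z x - e\<bar> ^ 3 \<partial>std_exponential) \<le> 8 * (\<integral>x. \<bar>Z x\<bar> ^ 3 \<partial>std_exponential)"
    proof -
      \<comment> \<open>Convexity of the cube; the factor 8 of the claim is 4 for the variable plus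
        4 for its mean.\<close>
      have cube: "(a + b) ^ 3 \<le> 4 * a ^ 3 + 4 * b ^ 3" if "0 \<le> a" "0 \<le> b" for a b :: real
      proof -
        have "0 \<le> (a + b) * (a - b)\<^sup>2" using that by simp
        then show ?thesis by (simp add: power2_eq_square power3_eq_cube algebra_simps)
      qed
      have int3: "integrable std_exponential (\<lambda>x. \<bar>Z x\<bar> ^ 3)" using intZ[of 3] by (simp flip: power_abs)
      \<comment> \<open>Jensen's inequality for the cube, by integrating the tangent line at a =
        |e|.\<close>
      have "\<bar>e\<bar> ^ 3 \<le> (\<integral>x. \<bar>Z x\<bar> ^ 3 \<partial>std_exponential)"
      proof (cases "e = 0")
        case False
        define a where "a = \<bar>e\<bar>"
        have a: "0 < a" using False by (simp add: a_def)
        have "3 * a\<^sup>2 * y \<le> y ^ 3 + 2 * a ^ 3" if "0 \<le> y" for y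
        proof -
          have "0 \<le> (y - a)\<^sup>2 * (y + 2 * a)" using that a by simp
          then show ?thesis by (simp add: power2_eq_square power3_eq_cube algebra_simps)
        qed
        then have "(\<integral>x. 3 * a\<^sup>2 * \<bar>Z x\<bar> \<partial>std_exponential) \<le> (\<integral>x. \<bar>Z x\<bar> ^ 3 + 2 * a ^ 3 \<partial>std_exponential)"
          using intZ1 int3 by (intro integral_mono) auto
        also have "\<dots> = (\<integral>x. \<bar>Z x\<bar> ^ 3 \<partial>std_exponential) + 2 * a ^ 3"
          using int3 by (simp add: std_exponential.prob_space[simplified])
        finally have "3 * a\<^sup>2 * (\<integral>x. \<bar>Z x\<bar> \<partial>std_exponential) \<le> (\<integral>x. \<bar>Z x\<bar> ^ 3 \<partial>std_exponential) + 2 * a ^ 3" by simp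
        moreover have "a \<le> (\<integral>x. \<bar>Z x\<bar> \<partial>std_exponential)" unfolding a_def e_def by (rule integral_abs_bound)
        then have "3 * a\<^sup>2 * a \<le> 3 * a\<^sup>2 * (\<integral>x. \<bar>Z x\<bar> \<partial>std_exponential)" by (intro mult_left_mono) auto
        ultimately show ?thesis by (simp add: a_def[symmetric] power2_eq_square power3_eq_cube)
      qed simp
      have "(\<integral>x. \<bar>Z x - e\<bar> ^ 3 \<partial>std_exponential) \<le> (\<integral>x. 4 * \<bar>Z x\<bar> ^ 3 + 4 * \<bar>e\<bar> ^ 3 \<partial>std_exponential)"
      proof (rule integral_mono')
        show "integrable std_exponential (\<lambda>x. 4 * \<bar>Z x\<bar> ^ 3 + 4 * \<bar>e\<bar> ^ 3)" using int3 by auto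
        fix x
        have "\<bar>Z x - e\<bar> ^ 3 \<le> (\<bar>Z x\<bar> + \<bar>e\<bar>) ^ 3" by (intro power_mono) auto
        also have "\<dots> \<le> 4 * \<bar>Z x\<bar> ^ 3 + 4 * \<bar>e\<bar> ^ 3" by (rule cube) auto
        finally show "\<bar>Z x - e\<bar> ^ 3 \<le> 4 * \<bar>Z x\<bar> ^ 3 + 4 * \<bar>e\<bar> ^ 3" .
      qed auto
      also have "\<dots> = 4 * (\<integral>x. \<bar>Z x\<bar> ^ 3 \<partial>std_exponential) + 4 * \<bar>e\<bar> ^ 3"
        using int3 by (simp add: std_exponential.prob_space[simplified])
      finally show ?thesis using \<open>\<bar>e\<bar> ^ 3 \<le> (\<integral>x. \<bar>Z x\<bar> ^ 3 \<partial>std_exponential)\<close> by simp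
    qed
    finally have "gauss_max_third m \<le> 8 * (\<integral>x. \<bar>Z x\<bar> ^ 3 \<partial>std_exponential) / s ^ 3"
      using s by (simp add: divide_right_mono)
    with mean var show ?thesis by (simp add: Z_def e_def s_def)
  qed
  then show ?thesis by (intro exI[of _ "max 3 m1"]) auto
qed

text \<open>Subtracting the squared mean cancels \<open>Digamma 1\<close>; the limit pi^2 / 6 is
  halved because the deviation is scaled with 2 ln m.\<close>

lemma gauss_max_var_asymp: "(\<lambda>m. ln (real m) * gauss_max_var m) \<longlonglongrightarrow> pi\<^sup>2 / 12"
proof -
  have "(\<lambda>m. ((\<integral>x. (gauss_max_dev m x)\<^sup>2 \<partial>std_exponential) - (\<integral>x. gauss_max_dev m x \<partial>std_exponential)\<^sup>2) / 2)
      \<longlonglongrightarrow> ((Digamma 1)\<^sup>2 + pi\<^sup>2 / 6 - (- Digamma 1)\<^sup>2) / 2"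
    by (intro tendsto_intros gauss_max_dev_moments) auto
  then have "(\<lambda>m. ((\<integral>x. (gauss_max_dev m x)\<^sup>2 \<partial>std_exponential) - (\<integral>x. gauss_max_dev m x \<partial>std_exponential)\<^sup>2) / 2)
      \<longlonglongrightarrow> pi\<^sup>2 / 12" by simp
  moreover obtain m0 where "\<forall>m\<ge>m0. ln (real m) * gauss_max_var m =
      ((\<integral>x. (gauss_max_dev m x)\<^sup>2 \<partial>std_exponential) - (\<integral>x. gauss_max_dev m x \<partial>std_exponential)\<^sup>2) / 2"
    using gauss_max_eventually by blast
  then have "eventually (\<lambda>m. ((\<integral>x. (gauss_max_dev m x)\<^sup>2 \<partial>std_exponential) - (\<integral>x. gauss_max_dev m x \<partial>std_exponential)\<^sup>2) / 2 =
      ln (real m) * gauss_max_var m) sequentially"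
    by (intro eventually_sequentiallyI[of m0]) simp
  ultimately show ?thesis by (rule Lim_transform_eventually)
qed

lemma gauss_max_third_bound:
  "\<exists>C m0. \<forall>m\<ge>m0. gauss_max_third m \<le> C / sqrt (ln (real m)) ^ 3"
proof -
  obtain m0 where m0: "m0 \<ge> 3" "\<And>m. m0 \<le> m \<Longrightarrow>
      gauss_max_third m \<le> 8 * (\<integral>x. \<bar>gauss_max_dev m x\<bar> ^ 3 \<partial>std_exponential) / sqrt (2 * ln (real m)) ^ 3"
    using gauss_max_eventually by blast
  obtain C m1 where C: "\<And>m. m1 \<le> m \<Longrightarrow> (\<integral>x. \<bar>gauss_max_dev m x\<bar> ^ 3 \<partial>std_exponential) \<le> C"
    using gauss_max_dev_moments(3) by blast
  have "gauss_max_third m \<le> (8 * C) / sqrt (ln (real m)) ^ 3" if "max m0 m1 \<le> m" for m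
  proof -
    have m: "m0 \<le> m" "m1 \<le> m" "3 \<le> m" using that m0(1) by auto
    have L: "0 < ln (real m)" using m by simp
    have C0: "0 \<le> C" using C[OF m(2)] by (rule order_trans[rotated]) (auto intro!: integral_nonneg_AE)
    have "gauss_max_third m \<le> 8 * C / sqrt (2 * ln (real m)) ^ 3"
      using m0(2)[OF m(1)] C[OF m(2)] L by (elim order_trans) (auto intro!: divide_right_mono)
    also have "\<dots> \<le> 8 * C / sqrt (ln (real m)) ^ 3"
      using C0 L by (intro divide_left_mono power_mono) auto
    finally show ?thesis .
  qed
  then show ?thesis by blast
qed

text \<open>The error of the quantile expansion dominates; the mean deviation adds only a term of
  order 1 / sqrt (ln m), absorbed since ln (ln m) \<ge> 1.\<close>

lemma gauss_max_mean_asymp: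
  "\<exists>C m0. \<forall>m\<ge>m0. \<bar>gauss_max_mean m - sqrt (2 * ln (real m))\<bar> \<le> C * ln (ln (real m)) / sqrt (ln (real m))"
proof -
  obtain m0 where m0: "\<And>m. m0 \<le> m \<Longrightarrow>
      gauss_max_mean m = gumbel_quantile (ln (real m)) + (\<integral>x. gauss_max_dev m x \<partial>std_exponential) / sqrt (2 * ln (real m))"
    using gauss_max_eventually by blast
  obtain C u0 where C: "0 \<le> C" "3 \<le> u0" "\<And>u. u0 \<le> u \<Longrightarrow> \<bar>gumbel_quantile u - sqrt (2 * u)\<bar> \<le> C * ln u / sqrt u"
    using gumbel_quantile_asymp by blast
  obtain K where K: "0 < K" "\<And>m. norm (\<integral>x. gauss_max_dev m x \<partial>std_exponential) \<le> K"
    using convergent_imp_Bseq[OF convergentI[OF gauss_max_dev_moments(1)]] by (auto elim: BseqE)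
  have "eventually (\<lambda>m. u0 \<le> ln (real m)) sequentially" by real_asymp
  then have "eventually (\<lambda>m. \<bar>gauss_max_mean m - sqrt (2 * ln (real m))\<bar> \<le> (C + K) * ln (ln (real m)) / sqrt (ln (real m))) sequentially"
    using eventually_ge_at_top[of m0]
  proof eventually_elim
    case (elim m)
    define u where "u = ln (real m)"
    have u: "3 \<le> u" "u0 \<le> u" using elim C(2) by (auto simp: u_def)
    have lnu: "1 \<le> ln u"
    proof -
      have "exp 1 \<le> u" using u(1) exp_le by linarith
      then show ?thesis using u by (subst ln_ge_iff) auto
    qed
    have "\<bar>gauss_max_mean m - sqrt (2 * u)\<bar> \<le> \<bar>gumbel_quantile u - sqrt (2 * u)\<bar> + \<bar>(\<integral>x. gauss_max_dev m x \<partial>std_exponential) / sqrt (2 * u)\<bar>"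
      unfolding m0[OF elim(2)] u_def[symmetric] by linarith
    also have "\<dots> \<le> C * ln u / sqrt u + K * ln u / sqrt u"
    proof (rule add_mono[OF C(3)[OF u(2)]])
      have "\<bar>(\<integral>x. gauss_max_dev m x \<partial>std_exponential) / sqrt (2 * u)\<bar> \<le> K / sqrt (2 * u)"
        using K(2)[of m] u by (simp add: abs_divide divide_right_mono)
      also have "\<dots> \<le> (K * 1) / sqrt u" using K(1) u by (simp, intro divide_left_mono) auto
      also have "\<dots> \<le> (K * ln u) / sqrt u" using K(1) u lnu by (intro divide_right_mono mult_left_mono) auto
      finally show "\<bar>(\<integral>x. gauss_max_dev m x \<partial>std_exponential) / sqrt (2 * u)\<bar> \<le> K * ln u / sqrt u" .
    qed
    also have "\<dots> = (C + K) * ln u / sqrt u" by (simp add: algebra_simps add_divide_distrib)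
    finally show ?case by (simp add: u_def)
  qed
  then show ?thesis by (auto simp: eventually_sequentially)
qed

section \<open>The law of the greedy sum\<close>

lemma arg_max_on_cong:
  assumes "\<And>j. j \<in> S \<Longrightarrow> f j = g j"
  shows "arg_max_on f S = arg_max_on g S"
proof -
  have "is_arg_max f (\<lambda>j. j \<in> S) = is_arg_max g (\<lambda>j. j \<in> S)"
    using assms by (fastforce simp: is_arg_max_def fun_eq_iff)
  then show ?thesis by (simp add: arg_max_on_def arg_max_def)
qed

lemma greedy_perm_eq:
  assumes "i \<in> {1..n}"
  shows "greedy_perm n x i = arg_max_on (x i) ({1..n} - greedy_perm n x ` {1..<i})"
  using assms by (simp only: greedy_perm.simps[of n x i] if_True)

text \<open>Locality: the choice in row i looks at rows 1 to i only, which is what allows the past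
  to be expressed through the first rows alone.\<close>

lemma greedy_perm_cong:
  assumes "\<And>i' j. i' \<in> {1..i} \<Longrightarrow> j \<in> {1..n} \<Longrightarrow> x i' j = y i' j"
  shows "greedy_perm n x i = greedy_perm n y i"
  using assms
proof (induction i rule: less_induct)
  case (less i)
  show ?case
  proof (cases "i \<in> {1..n}")
    case True
    have "greedy_perm n x ` {1..<i} = greedy_perm n y ` {1..<i}"
      by (intro image_cong refl less.IH) (auto intro: less.prems)
    moreover have "arg_max_on (x i) ({1..n} - greedy_perm n y ` {1..<i}) = arg_max_on (y i) ({1..n} - greedy_perm n y ` {1..<i})"
      using True by (intro arg_max_on_cong less.prems) auto
    ultimately show ?thesis by (simp only: greedy_perm_eq[OF True])
  next
    case False
    then show ?thesis by (simp only: greedy_perm.simps[of n x i] greedy_perm.simps[of n y i] if_False)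
  qed
qed

lemma arg_max_on_eq_Max:
  fixes f :: "'a \<Rightarrow> real"
  assumes "finite S" "S \<noteq> {}"
  shows "f (arg_max_on f S) = Max (f ` S)"
proof -
  have "Max (f ` S) \<in> f ` S" using assms by simp
  then obtain m where m: "m \<in> S" "f m = Max (f ` S)" by auto
  have "is_arg_max f (\<lambda>j. j \<in> S) m"
    unfolding is_arg_max_def using m assms by (auto simp: not_less)
  then have "is_arg_max f (\<lambda>j. j \<in> S) (arg_max_on f S)"
    unfolding arg_max_on_def arg_max_def by (rule someI)
  then have "arg_max_on f S \<in> S" "\<And>j. j \<in> S \<Longrightarrow> f j \<le> f (arg_max_on f S)"
    by (auto simp: is_arg_max_def not_less)
  then show ?thesis using assms by (intro Max_eqI[symmetric]) auto
qed

lemma countable_finite_sets: "countable {A :: nat set. finite A}"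
  by (rule countable_Collect_finite)

text \<open>The finite sets of naturals form a countable space, taken with the discrete
  sigma-algebra; random subsets of this kind can then be handled case by case.\<close>

lemma measurable_finite_filter:
  assumes "finite S" and P: "\<And>j. j \<in> S \<Longrightarrow> Measurable.pred M (P j)"
  shows "(\<lambda>\<omega>. {j\<in>S. P j \<omega>}) \<in> M \<rightarrow>\<^sub>M count_space {A. finite A}"
  using assms
proof (induction S)
  case (insert a S)
  have IH: "(\<lambda>\<omega>. {j\<in>S. P j \<omega>}) \<in> M \<rightarrow>\<^sub>M count_space {A. finite A}" using insert by simp
  have "(\<lambda>\<omega>. insert a {j\<in>S. P j \<omega>}) \<in> M \<rightarrow>\<^sub>M count_space {A. finite A}"
    by (rule measurable_compose[OF IH]) auto
  then have "(\<lambda>\<omega>. if P a \<omega> then insert a {j\<in>S. P j \<omega>} else {j\<in>S. P j \<omega>}) \<in> M \<rightarrow>\<^sub>M count_space {A. finite A}"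
    using IH insert.prems[of a] by (intro measurable_If) (auto simp: pred_def)
  also have "(\<lambda>\<omega>. if P a \<omega> then insert a {j\<in>S. P j \<omega>} else {j\<in>S. P j \<omega>}) = (\<lambda>\<omega>. {j\<in>insert a S. P j \<omega>})"
    by (auto simp: fun_eq_iff)
  finally show ?case .
qed simp

lemma measurable_finite_image:
  fixes G :: "'b \<Rightarrow> 'a \<Rightarrow> nat"
  assumes "finite S" and G: "\<And>j. j \<in> S \<Longrightarrow> G j \<in> M \<rightarrow>\<^sub>M count_space UNIV"
  shows "(\<lambda>\<omega>. (\<lambda>j. G j \<omega>) ` S) \<in> M \<rightarrow>\<^sub>M count_space {A. finite A}"
  using assms
proof (induction S)
  case (insert a S)
  have IH: "(\<lambda>\<omega>. (\<lambda>j. G j \<omega>) ` S) \<in> M \<rightarrow>\<^sub>M count_space {A. finite A}" using insert by simp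
  have "(\<lambda>\<omega>. insert g ((\<lambda>j. G j \<omega>) ` S)) \<in> M \<rightarrow>\<^sub>M count_space {A. finite A}" for g
    by (rule measurable_compose[OF IH]) auto
  then have "(\<lambda>\<omega>. insert (G a \<omega>) ((\<lambda>j. G j \<omega>) ` S)) \<in> M \<rightarrow>\<^sub>M count_space {A. finite A}"
    by (rule measurable_compose_countable) (use insert.prems in auto)
  then show ?case by simp
qed simp

text \<open>\<open>arg_max_on\<close> is the choice operator applied to the random finite set of
  maximisers, and every function on a discrete space is measurable; ties therefore cause no
  difficulty.\<close>

lemma measurable_arg_max_on:
  fixes Y :: "nat \<Rightarrow> 'a \<Rightarrow> real"
  assumes "finite S" "\<And>j. j \<in> S \<Longrightarrow> Y j \<in> borel_measurable M"
  shows "(\<lambda>\<omega>. arg_max_on (\<lambda>j. Y j \<omega>) S) \<in> M \<rightarrow>\<^sub>M count_space UNIV"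
proof -
  have "(\<lambda>\<omega>. {j\<in>S. \<forall>l\<in>S. Y l \<omega> \<le> Y j \<omega>}) \<in> M \<rightarrow>\<^sub>M count_space {A. finite A}"
  proof (rule measurable_finite_filter[OF assms(1)])
    fix j assume j: "j \<in> S"
    show "Measurable.pred M (\<lambda>\<omega>. \<forall>l\<in>S. Y l \<omega> \<le> Y j \<omega>)"
    proof (rule pred_intros_finite(3)[OF assms(1)])
      fix l assume "l \<in> S"
      then show "Measurable.pred M (\<lambda>\<omega>. Y l \<omega> \<le> Y j \<omega>)"
        unfolding pred_def using assms(2) j by (intro borel_measurable_le) auto
    qed
  qed
  then have "(\<lambda>\<omega>. SOME j. j \<in> {j\<in>S. \<forall>l\<in>S. Y l \<omega> \<le> Y j \<omega>}) \<in> M \<rightarrow>\<^sub>M count_space UNIV"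
    by (rule measurable_compose) auto
  also have "(\<lambda>\<omega>. SOME j. j \<in> {j\<in>S. \<forall>l\<in>S. Y l \<omega> \<le> Y j \<omega>}) = (\<lambda>\<omega>. arg_max_on (\<lambda>j. Y j \<omega>) S)"
    by (intro ext) (simp add: arg_max_on_def arg_max_def is_arg_max_def, intro arg_cong[where f = Eps], auto simp: not_less)
  finally show ?thesis .
qed

text \<open>Induction on the row: the set of used columns takes countably many values, and for each
  fixed value the next choice is an ordinary maximiser.\<close>

lemma measurable_greedy_perm:
  fixes Y :: "nat \<Rightarrow> nat \<Rightarrow> 'a \<Rightarrow> real"
  assumes "i \<in> {1..n}" "\<And>i' j. i' \<in> {1..i} \<Longrightarrow> j \<in> {1..n} \<Longrightarrow> Y i' j \<in> borel_measurable M"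
  shows "(\<lambda>\<omega>. greedy_perm n (\<lambda>i j. Y i j \<omega>) i) \<in> M \<rightarrow>\<^sub>M count_space UNIV"
  using assms
proof (induction i rule: less_induct)
  case (less i)
  have "(\<lambda>\<omega>. (\<lambda>a. greedy_perm n (\<lambda>i j. Y i j \<omega>) a) ` {1..<i}) \<in> M \<rightarrow>\<^sub>M count_space {A. finite A}"
  proof (rule measurable_finite_image)
    fix a assume "a \<in> {1..<i}"
    then show "(\<lambda>\<omega>. greedy_perm n (\<lambda>i j. Y i j \<omega>) a) \<in> M \<rightarrow>\<^sub>M count_space UNIV"
      using less.prems by (intro less.IH) auto
  qed simp
  moreover have "(\<lambda>\<omega>. arg_max_on (\<lambda>j. Y i j \<omega>) ({1..n} - J)) \<in> M \<rightarrow>\<^sub>M count_space UNIV" for J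
    using less.prems by (intro measurable_arg_max_on) auto
  ultimately have "(\<lambda>\<omega>. arg_max_on (\<lambda>j. Y i j \<omega>) ({1..n} - (\<lambda>a. greedy_perm n (\<lambda>i j. Y i j \<omega>) a) ` {1..<i})) \<in> M \<rightarrow>\<^sub>M count_space UNIV"
    by (intro measurable_compose_countable'[where I = "{A. finite A}" and
          f = "\<lambda>J \<omega>. arg_max_on (\<lambda>j. Y i j \<omega>) ({1..n} - J)" and
          g = "\<lambda>\<omega>. (\<lambda>a. greedy_perm n (\<lambda>i j. Y i j \<omega>) a) ` {1..<i}"] countable_finite_sets) assumption+
  then show ?case using less.prems(1) by (simp add: greedy_perm_eq)
qed

lemma measurable_greedy_entry:
  fixes Y :: "nat \<Rightarrow> nat \<Rightarrow> 'a \<Rightarrow> real"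
  assumes "i \<in> {1..n}" "\<And>i' j. i' \<in> {1..i} \<Longrightarrow> j \<in> {1..n} \<Longrightarrow> Y i' j \<in> borel_measurable M"
  shows "(\<lambda>\<omega>. Y i (greedy_perm n (\<lambda>i j. Y i j \<omega>) i) \<omega>) \<in> borel_measurable M"
proof (rule measurable_compose_countable'[where I = "{1..n}" and f = "Y i"])
  show "Y i j \<in> borel_measurable M" if "j \<in> {1..n}" for j using assms that by auto
  have "greedy_perm n (\<lambda>i j. Y i j \<omega>) i \<in> {1..n}" for \<omega>
    using greedy_perm_in[OF assms(1)] by blast
  then show "(\<lambda>\<omega>. greedy_perm n (\<lambda>i j. Y i j \<omega>) i) \<in> M \<rightarrow>\<^sub>M count_space {1..n}"
    using measurable_greedy_perm[OF assms]
    by (auto simp: measurable_count_space_eq2 measurable_count_space_eq2_countable)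
qed simp

lemma greedy_entry_eq_Max:
  assumes "i \<in> {1..n}"
  shows "x i (greedy_perm n x i) = Max (x i ` ({1..n} - greedy_perm n x ` {1..<i}))"
proof -
  define S where "S = {1..n} - greedy_perm n x ` {1..<i}"
  have "S \<noteq> {}" using greedy_perm_in[OF assms, of x] by (auto simp only: S_def)
  then have "x i (arg_max_on (x i) S) = Max (x i ` S)" by (intro arg_max_on_eq_Max) (auto simp: S_def)
  then show ?thesis unfolding S_def by (simp only: greedy_perm_eq[OF assms, symmetric])
qed

lemma greedy_perm_card:
  assumes "k \<le> n"
  shows "card (greedy_perm n x ` {1..k}) = k"
  using card_image[OF permutes_inj_on[OF greedy_perm_permutes], of n x "{1..k}"] by simp

section \<open>Law of the selected entries and of their sum\<close>

lemma (in prob_space) distr_Max_std_normal: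
  assumes J: "finite J" "J \<noteq> {}" and ind: "indep_vars (\<lambda>_. borel) Z J"
    and Z: "\<And>j. j \<in> J \<Longrightarrow> distributed M lborel (Z j) std_normal_density"
  shows "distr M borel (\<lambda>\<omega>. Max ((\<lambda>j. Z j \<omega>) ` J)) = gauss_max (card J)"
proof (rule cdf_unique)
  have rv [measurable]: "Z j \<in> borel_measurable M" if "j \<in> J" for j
    using distributed_measurable[OF Z[OF that]] by simp
  have [measurable]: "(\<lambda>\<omega>. Max ((\<lambda>j. Z j \<omega>) ` J)) \<in> borel_measurable M"
    using J(1) rv by (intro borel_measurable_Max) auto
  show "real_distribution (distr M borel (\<lambda>\<omega>. Max ((\<lambda>j. Z j \<omega>) ` J)))"
    by (rule real_distribution_distr) measurable
  show "real_distribution (gauss_max (card J))" by (rule real_distribution_gauss_max)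
  show "cdf (distr M borel (\<lambda>\<omega>. Max ((\<lambda>j. Z j \<omega>) ` J))) = cdf (gauss_max (card J))"
  proof
    fix x
    have "cdf (distr M borel (\<lambda>\<omega>. Max ((\<lambda>j. Z j \<omega>) ` J))) x = prob ((\<lambda>\<omega>. Max ((\<lambda>j. Z j \<omega>) ` J)) -` {..x} \<inter> space M)"
      unfolding cdf_def by (subst measure_distr) auto
    also have "(\<lambda>\<omega>. Max ((\<lambda>j. Z j \<omega>) ` J)) -` {..x} \<inter> space M = (\<Inter>j\<in>J. Z j -` {..x} \<inter> space M)"
    proof -
      have "Max ((\<lambda>j. Z j \<omega>) ` J) \<le> x \<longleftrightarrow> (\<forall>j\<in>J. Z j \<omega> \<le> x)" for \<omega> using J by simp
      then show ?thesis using J(2) by auto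
    qed
    also have "prob \<dots> = (\<Prod>j\<in>J. prob (Z j -` {..x} \<inter> space M))"
      by (rule indep_varsD_finite[OF ind]) (use J in auto)
    also have "\<dots> = (\<Prod>j\<in>J. \<Phi> x)"
    proof (rule prod.cong[OF refl])
      fix j assume j: "j \<in> J"
      have "prob (Z j -` {..x} \<inter> space M) = measure (distr M lborel (Z j)) {..x}"
        using rv[OF j] by (subst measure_distr) auto
      also have "distr M lborel (Z j) = std_normal_distribution"
        using distributed_distr_eq_density[OF Z[OF j]] .
      finally show "prob (Z j -` {..x} \<inter> space M) = \<Phi> x" by (simp add: cdf_def)
    qed
    also have "\<dots> = cdf (gauss_max (card J)) x"
      using J by (subst cdf_gauss_max) (auto simp: Suc_le_eq card_gt_0_iff)
    finally show "cdf (distr M borel (\<lambda>\<omega>. Max ((\<lambda>j. Z j \<omega>) ` J))) x = cdf (gauss_max (card J)) x" .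
  qed
qed

locale gaussian_matrix = prob_space +
  fixes n :: nat and X :: "nat \<Rightarrow> nat \<Rightarrow> 'a \<Rightarrow> real"
  assumes indep: "indep_vars (\<lambda>_. borel) (\<lambda>(i, j). X i j) ({1..n} \<times> {1..n})"
    and gauss: "\<And>i j. i \<in> {1..n} \<Longrightarrow> j \<in> {1..n} \<Longrightarrow> distributed M lborel (X i j) std_normal_density"
begin

abbreviation greedy :: "'a \<Rightarrow> nat \<Rightarrow> nat" where
  "greedy \<omega> \<equiv> greedy_perm n (\<lambda>i j. X i j \<omega>)"

definition partial_sum :: "nat \<Rightarrow> 'a \<Rightarrow> real" where
  "partial_sum k \<omega> = (\<Sum>i=1..k. X i (greedy \<omega> i) \<omega>)"

lemma measurable_X: "i \<in> {1..n} \<Longrightarrow> j \<in> {1..n} \<Longrightarrow> X i j \<in> borel_measurable M"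
  using distributed_measurable[OF gauss] by simp

lemma measurable_partial_sum: "k \<le> n \<Longrightarrow> partial_sum k \<in> borel_measurable M"
  unfolding partial_sum_def
  by (intro borel_measurable_sum measurable_greedy_entry[where Y = X]) (auto intro!: measurable_X)

text \<open>Given the first \<open>k\<close> rows, the next greedy entry is the maximum of \<open>n - k\<close> fresh entries;
  its law depends on the past only through the number of columns already used.\<close>

lemma char_partial_sum_Suc:
  assumes k: "k < n"
  shows "char (distr M borel (partial_sum (Suc k))) t =
    char (distr M borel (partial_sum k)) t * char (gauss_max (n - k)) t"
proof -
  let ?R = "{1..k} \<times> {1..n}" and ?Q = "{Suc k} \<times> {1..n}"
  \<comment> \<open>The possible values of the set of columns used by the first k rows.\<close>
  define JJ where "JJ = {J. J \<subseteq> {1..n} \<and> card J = k}"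
  have finJJ: "finite JJ" unfolding JJ_def by (rule finite_subset[of _ "Pow {1..n}"]) auto
  \<comment> \<open>The indicator of the used set being J is included in the past factor. Fixing J
    makes the next factor a function of row k + 1 alone, hence independent of the past.\<close>
  define past where "past J w = (if greedy_perm n (\<lambda>i j. w (i, j)) ` {1..k} = J
     then iexp (t * (\<Sum>i=1..k. w (i, greedy_perm n (\<lambda>i j. w (i, j)) i))) else 0)" for J and w :: "nat \<times> nat \<Rightarrow> real"
  define future where "future J w = iexp (t * Max ((\<lambda>j. w (Suc k, j)) ` ({1..n} - J)))" for J and w :: "nat \<times> nat \<Rightarrow> real"
  define W where "W A \<omega> = (\<lambda>p\<in>A. (\<lambda>(i, j). X i j) p \<omega>)" for A \<omega>
  have meas_past: "past J \<in> borel_measurable (PiM ?R (\<lambda>_. borel))" for J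
  proof -
    let ?N = "PiM ?R (\<lambda>_. borel) :: (nat \<times> nat \<Rightarrow> real) measure"
    have comp: "(\<lambda>w. w (i, j)) \<in> borel_measurable ?N" if "i \<in> {1..k}" "j \<in> {1..n}" for i j
      using that by (intro measurable_component_singleton) auto
    have "(\<lambda>w. greedy_perm n (\<lambda>i j. w (i, j)) i) \<in> ?N \<rightarrow>\<^sub>M count_space UNIV" if "i \<in> {1..k}" for i
      by (rule measurable_greedy_perm[where Y = "\<lambda>i j w. w (i, j)"]) (use that k comp in auto)
    then have "(\<lambda>w. (\<lambda>i. greedy_perm n (\<lambda>i j. w (i, j)) i) ` {1..k}) \<in> ?N \<rightarrow>\<^sub>M count_space {A. finite A}"
      by (intro measurable_finite_image) auto
    then have "(\<lambda>w. (\<lambda>i. greedy_perm n (\<lambda>i j. w (i, j)) i) ` {1..k} = J) \<in> ?N \<rightarrow>\<^sub>M count_space UNIV"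
      by (rule measurable_compose) simp
    moreover have "(\<lambda>w. \<Sum>i=1..k. w (i, greedy_perm n (\<lambda>i j. w (i, j)) i)) \<in> borel_measurable ?N"
      by (intro borel_measurable_sum measurable_greedy_entry[where Y = "\<lambda>i j w. w (i, j)"]) (use k comp in auto)
    then have "(\<lambda>w. iexp (t * (\<Sum>i=1..k. w (i, greedy_perm n (\<lambda>i j. w (i, j)) i)))) \<in> borel_measurable ?N"
      by (rule measurable_compose[where g = "\<lambda>s. iexp (t * s)"]) measurable
    ultimately show ?thesis
      unfolding past_def by (intro measurable_If) (simp_all only: pred_def borel_measurable_const)
  qed
  have meas_future: "future J \<in> borel_measurable (PiM ?Q (\<lambda>_. borel))" for J
  proof -
    have "(\<lambda>w. Max ((\<lambda>j. w (Suc k, j)) ` ({1..n} - J))) \<in> borel_measurable (PiM ?Q (\<lambda>_. borel) :: (nat \<times> nat \<Rightarrow> real) measure)"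
      by (intro borel_measurable_Max) auto
    then show ?thesis unfolding future_def by measurable
  qed
  have ind: "indep_var (PiM ?R (\<lambda>_. borel)) (W ?R) (PiM ?Q (\<lambda>_. borel)) (W ?Q)"
    unfolding W_def by (rule indep_var_restrict[OF indep]) (use k in auto)
  have ind_pf: "indep_var borel (past J \<circ> W ?R) borel (future J \<circ> W ?Q)" for J
    by (rule indep_var_compose[OF ind meas_past meas_future])
  \<comment> \<open>The restricted matrix agrees with the full one on the first k rows, so locality
    applies.\<close>
  have greedy_W: "greedy_perm n (\<lambda>i j. W ?R \<omega> (i, j)) i = greedy \<omega> i" if "i \<in> {1..k}" for i \<omega>
    by (rule greedy_perm_cong) (use that in \<open>auto simp: W_def\<close>)
  have past_W: "past J (W ?R \<omega>) = (if greedy \<omega> ` {1..k} = J then iexp (t * partial_sum k \<omega>) else 0)" for J \<omega>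
  proof -
    have "greedy_perm n (\<lambda>i j. W ?R \<omega> (i, j)) ` {1..k} = greedy \<omega> ` {1..k}"
      by (intro image_cong refl greedy_W)
    moreover have "(\<Sum>i=1..k. W ?R \<omega> (i, greedy_perm n (\<lambda>i j. W ?R \<omega> (i, j)) i)) = partial_sum k \<omega>"
      unfolding partial_sum_def
    proof (rule sum.cong[OF refl])
      fix i assume i: "i \<in> {1..k}"
      then have "greedy \<omega> i \<in> {1..n}" using greedy_perm_in[of i n] k by auto
      then show "W ?R \<omega> (i, greedy_perm n (\<lambda>i j. W ?R \<omega> (i, j)) i) = X i (greedy \<omega> i) \<omega>"
        unfolding greedy_W[OF i] using i by (simp add: W_def)
    qed
    ultimately show ?thesis by (simp only: past_def)
  qed
  have future_W: "future J (W ?Q \<omega>) = iexp (t * Max ((\<lambda>j. X (Suc k) j \<omega>) ` ({1..n} - J)))" for J \<omega>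
    unfolding future_def W_def by (intro arg_cong[where f = "\<lambda>S. iexp (t * Max S)"] image_cong) auto
  have greedy_JJ: "greedy \<omega> ` {1..k} \<in> JJ" for \<omega>
  proof -
    have "greedy \<omega> ` {1..k} \<subseteq> {1..n}" using greedy_perm_in[of _ n] k by auto
    then show ?thesis using greedy_perm_card[of k n] k by (auto simp: JJ_def)
  qed
  \<comment> \<open>For each outcome exactly one J contributes to the sum.\<close>
  have split: "iexp (t * partial_sum (Suc k) \<omega>) = (\<Sum>J\<in>JJ. past J (W ?R \<omega>) * future J (W ?Q \<omega>))" for \<omega>
  proof -
    have "partial_sum (Suc k) \<omega> = partial_sum k \<omega> + X (Suc k) (greedy \<omega> (Suc k)) \<omega>"
      by (simp add: partial_sum_def)
    also have "X (Suc k) (greedy \<omega> (Suc k)) \<omega> = Max ((\<lambda>j. X (Suc k) j \<omega>) ` ({1..n} - greedy \<omega> ` {1..k}))"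
      using greedy_entry_eq_Max[of "Suc k" n "\<lambda>i j. X i j \<omega>"] k by (simp add: atLeastLessThanSuc_atLeastAtMost)
    finally have "iexp (t * partial_sum (Suc k) \<omega>) = iexp (t * partial_sum k \<omega>) * future (greedy \<omega> ` {1..k}) (W ?Q \<omega>)"
      by (simp only: future_W distrib_left of_real_add exp_add)
    also have "\<dots> = (\<Sum>J\<in>JJ. if greedy \<omega> ` {1..k} = J then iexp (t * partial_sum k \<omega>) * future J (W ?Q \<omega>) else 0)"
      using greedy_JJ[of \<omega>] finJJ by (simp add: sum.delta')
    also have "\<dots> = (\<Sum>J\<in>JJ. past J (W ?R \<omega>) * future J (W ?Q \<omega>))"
      by (intro sum.cong refl) (unfold past_W, simp)
    finally show ?thesis .
  qed
  have past_sum: "iexp (t * partial_sum k \<omega>) = (\<Sum>J\<in>JJ. past J (W ?R \<omega>))" for \<omega>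
    unfolding past_W using greedy_JJ[of \<omega>] finJJ by (simp add: sum.delta')
  have W_meas: "W ?R \<in> M \<rightarrow>\<^sub>M PiM ?R (\<lambda>_. borel)" "W ?Q \<in> M \<rightarrow>\<^sub>M PiM ?Q (\<lambda>_. borel)"
    using indep_var_rv1[OF ind] indep_var_rv2[OF ind] by auto
  have "norm (past J (W ?R \<omega>)) \<le> 1" for J \<omega> unfolding past_W by simp
  then have int_past: "integrable M (\<lambda>\<omega>. past J (W ?R \<omega>))" for J
    by (intro integrable_const_bound[where B = 1] AE_I2 measurable_compose[OF W_meas(1) meas_past])
  have "norm (future J (W ?Q \<omega>)) \<le> 1" for J \<omega> unfolding future_W by simp
  then have int_future: "integrable M (\<lambda>\<omega>. future J (W ?Q \<omega>))" for J
    by (intro integrable_const_bound[where B = 1] AE_I2 measurable_compose[OF W_meas(2) meas_future])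
  \<comment> \<open>Its expectation depends on J through the number of free columns only, so it is a
    common factor of the whole sum.\<close>
  have E_future: "(\<integral>\<omega>. future J (W ?Q \<omega>) \<partial>M) = char (gauss_max (n - k)) t" if J: "J \<in> JJ" for J
  proof -
    have card: "card ({1..n} - J) = n - k" using J by (auto simp: JJ_def card_Diff_subset finite_subset)
    then have ne: "{1..n} - J \<noteq> {}" using k by (metis card.empty zero_less_diff less_irrefl)
    have "indep_vars (\<lambda>_. borel) (\<lambda>j. (\<lambda>(i, j). X i j) (Suc k, j)) ({1..n} - J)"
    proof -
      have "indep_vars (\<lambda>j. PiM {(Suc k, j)} (\<lambda>_. borel)) (\<lambda>j \<omega>. \<lambda>p\<in>{(Suc k, j)}. (\<lambda>(i, j). X i j) p \<omega>) ({1..n} - J)"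
        by (rule indep_vars_restrict[OF indep]) (use k in \<open>auto simp: disjoint_family_on_def\<close>)
      from indep_vars_compose2[OF this, of "\<lambda>j w. w (Suc k, j)" "\<lambda>_. borel"]
      show ?thesis by simp
    qed
    then have law: "gauss_max (n - k) = distr M borel (\<lambda>\<omega>. Max ((\<lambda>j. X (Suc k) j \<omega>) ` ({1..n} - J)))"
      unfolding card[symmetric]
      by (intro distr_Max_std_normal[symmetric] ne gauss) (use k in auto)
    have meas: "(\<lambda>\<omega>. Max ((\<lambda>j. X (Suc k) j \<omega>) ` ({1..n} - J))) \<in> borel_measurable M"
      using k by (intro borel_measurable_Max measurable_X) auto
    show ?thesis unfolding law char_def future_W by (subst integral_distr[OF meas]) auto
  qed
  have "char (distr M borel (partial_sum (Suc k))) t = (\<integral>\<omega>. (\<Sum>J\<in>JJ. past J (W ?R \<omega>) * future J (W ?Q \<omega>)) \<partial>M)"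
    unfolding char_def split[symmetric] using measurable_partial_sum[of "Suc k"] k by (subst integral_distr) auto
  also have "\<dots> = (\<Sum>J\<in>JJ. \<integral>\<omega>. past J (W ?R \<omega>) * future J (W ?Q \<omega>) \<partial>M)"
    using indep_var_integrable[OF ind_pf] int_past int_future
    by (intro Bochner_Integration.integral_sum) (simp add: comp_def)
  also have "\<dots> = (\<Sum>J\<in>JJ. (\<integral>\<omega>. past J (W ?R \<omega>) \<partial>M) * char (gauss_max (n - k)) t)"
    using indep_var_lebesgue_integral[OF ind_pf] int_past int_future
    by (intro sum.cong refl) (simp add: comp_def E_future del: One_nat_def)
  also have "\<dots> = (\<integral>\<omega>. (\<Sum>J\<in>JJ. past J (W ?R \<omega>)) \<partial>M) * char (gauss_max (n - k)) t"
    using int_past by (simp add: Bochner_Integration.integral_sum sum_distrib_right)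
  also have "(\<integral>\<omega>. (\<Sum>J\<in>JJ. past J (W ?R \<omega>)) \<partial>M) = char (distr M borel (partial_sum k)) t"
    unfolding char_def past_sum[symmetric] using measurable_partial_sum[of k] k by (subst integral_distr) auto
  finally show ?thesis .
qed

lemma char_partial_sum:
  assumes "k \<le> n"
  shows "char (distr M borel (partial_sum k)) t = (\<Prod>i<k. char (gauss_max (n - i)) t)"
  using assms
proof (induction k)
  case 0
  show ?case by (simp add: partial_sum_def[abs_def] char_def) (subst integral_return, auto)
next
  case (Suc k)
  then show ?case by (simp add: char_partial_sum_Suc)
qed

definition greedy_sum :: "'a \<Rightarrow> real" where
  "greedy_sum \<omega> = perm_sum n (\<lambda>i j. X i j \<omega>) (greedy \<omega>)"

lemma greedy_sum_eq: "greedy_sum = partial_sum n"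
  by (simp add: fun_eq_iff greedy_sum_def perm_sum_def partial_sum_def)

lemma measurable_greedy_sum [measurable]: "greedy_sum \<in> borel_measurable M"
  by (simp add: greedy_sum_eq measurable_partial_sum)

lemma char_greedy_sum: "char (distr M borel greedy_sum) t = (\<Prod>m=1..n. char (gauss_max m) t)"
proof -
  have "(\<Prod>i<n. char (gauss_max (n - i)) t) = (\<Prod>m=1..n. char (gauss_max m) t)"
    by (rule prod.reindex_bij_witness[of _ "\<lambda>m. n - m" "\<lambda>i. n - i"]) auto
  then show ?thesis by (simp add: greedy_sum_eq char_partial_sum)
qed

end

section \<open>Asymptotics of sums\<close>

lemma bigo_cmult:
  fixes f g :: "nat \<Rightarrow> real"
  assumes "f \<in> O(g)"
  shows "(\<lambda>n. c * f n) \<in> O(g)"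
  using assms by (cases "c = 0") auto

text \<open>Equivalent to n^n \<le> n! e^n. It shows that ln m may be replaced by ln n at an average
  cost of at most 1.\<close>

lemma sum_ln_ratio_le: "(\<Sum>m=1..n. ln (real n / real m)) \<le> real n"
proof (cases "n = 0")
  case False
  have "(\<Sum>m=1..n. ln (real n / real m)) = (\<Sum>m=1..n. ln (real n) - ln (real m))"
    using False by (intro sum.cong refl) (simp add: ln_div)
  also have "\<dots> = real n * ln (real n) - (\<Sum>m=1..n. ln (real m))" by (simp add: sum_subtractf)
  also have "(\<Sum>m=1..n. ln (real m)) = ln (fact n)"
    by (subst ln_prod[symmetric]) (auto simp: fact_prod)
  also have "real n * ln (real n) = ln (real n ^ n)" using False by (simp add: ln_realpow)
  also have "\<dots> \<le> ln (fact n * exp (real n))"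
    using False power_le_fact_times_exp[of "real n" n] by simp
  also have "\<dots> = ln (fact n) + real n" by (simp add: ln_mult)
  finally show ?thesis by simp
qed simp

text \<open>At most sqrt n indices lie below sqrt n, and a uniform bound serves for them; above, ln
  m and ln n are comparable.\<close>

lemma sum_split_at_sqrt:
  fixes x :: "nat \<Rightarrow> real"
  assumes K: "0 \<le> K" "\<And>m. 1 \<le> m \<Longrightarrow> m \<le> n \<Longrightarrow> x m \<le> K" and G: "\<And>m. 1 \<le> m \<Longrightarrow> m \<le> n \<Longrightarrow> sqrt (real n) \<le> real m \<Longrightarrow> x m \<le> g m" "\<And>m. 1 \<le> m \<Longrightarrow> m \<le> n \<Longrightarrow> 0 \<le> g m"
  shows "(\<Sum>m=1..n. x m) \<le> K * sqrt (real n) + (\<Sum>m=1..n. g m)"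
proof -
  have "(\<Sum>m=1..n. x m) \<le> (\<Sum>m=1..n. (if real m < sqrt (real n) then K else 0) + g m)"
  proof (rule sum_mono)
    fix m assume "m \<in> {1..n}"
    then have m: "1 \<le> m" "m \<le> n" by auto
    show "x m \<le> (if real m < sqrt (real n) then K else 0) + g m"
      using K(2)[OF m] G(1)[OF m] G(2)[OF m] by (auto simp: not_less)
  qed
  also have "\<dots> = K * real (card {m\<in>{1..n}. real m < sqrt (real n)}) + (\<Sum>m=1..n. g m)"
    by (simp add: sum.distrib sum.If_cases Int_def conj_commute)
  also have "K * real (card {m\<in>{1..n}. real m < sqrt (real n)}) \<le> K * sqrt (real n)"
  proof (rule mult_left_mono[OF _ K(1)])
    have "{m\<in>{1..n}. real m < sqrt (real n)} \<subseteq> {1..nat \<lfloor>sqrt (real n)\<rfloor>}"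
      by (auto simp: le_nat_floor)
    from card_mono[OF _ this] have "card {m\<in>{1..n}. real m < sqrt (real n)} \<le> nat \<lfloor>sqrt (real n)\<rfloor>" by simp
    also have "real (nat \<lfloor>sqrt (real n)\<rfloor>) \<le> sqrt (real n)" by (intro of_nat_floor) simp
    finally show "real (card {m\<in>{1..n}. real m < sqrt (real n)}) \<le> sqrt (real n)" by simp
  qed
  finally show ?thesis by simp
qed

lemma half_ln_le:
  assumes "1 \<le> n" "sqrt (real n) \<le> real m"
  shows "ln (real n) / 2 \<le> ln (real m)"
proof -
  have "0 < sqrt (real n)" using assms by simp
  then have "ln (sqrt (real n)) \<le> ln (real m)" using assms(2) by (subst ln_le_cancel_iff) linarith+
  then show ?thesis using assms by (simp add: ln_sqrt)
qed

lemma eventually_bounded_imp_bounded: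
  fixes x :: "nat \<Rightarrow> real"
  assumes "\<And>m. m0 \<le> m \<Longrightarrow> \<bar>x m\<bar> \<le> C"
  shows "\<exists>K>0. \<forall>m. \<bar>x m\<bar> \<le> K"
proof (intro exI conjI allI)
  fix m
  show "\<bar>x m\<bar> \<le> 1 + \<bar>C\<bar> + (\<Sum>i<m0. \<bar>x i\<bar>)"
  proof (cases "m0 \<le> m")
    case True
    have "0 \<le> (\<Sum>i<m0. \<bar>x i\<bar>)" by (intro sum_nonneg) auto
    then show ?thesis using assms[OF True] abs_ge_self[of C] by linarith
  next
    case False
    then have "\<bar>x m\<bar> \<le> (\<Sum>i<m0. \<bar>x i\<bar>)" by (intro member_le_sum) auto
    then show ?thesis by simp
  qed
qed (auto intro!: add_pos_nonneg sum_nonneg)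

text \<open>With L = ln n it suffices to bound the sum of |L v m - c| by \<open>\<epsilon>\<close>
  n. Half of \<open>\<epsilon>\<close> pays for the convergence of (ln m) v m, a quarter for the
  indices below sqrt n, and a quarter for replacing ln m by L.\<close>

lemma sum_asymp_div_ln:
  fixes v :: "nat \<Rightarrow> real"
  assumes lim: "(\<lambda>m. ln (real m) * v m) \<longlonglongrightarrow> c" and c: "0 \<le> c"
    and K: "0 \<le> K" "\<And>m. \<bar>v m\<bar> \<le> K"
  shows "(\<lambda>n. (\<Sum>m=1..n. v m) - c * (real n / ln (real n))) \<in> o(\<lambda>n. real n / ln (real n))"
proof (rule landau_o.smallI)
  fix \<epsilon> :: real assume \<epsilon>: "0 < \<epsilon>"
  have "eventually (\<lambda>m. \<bar>ln (real m) * v m - c\<bar> < \<epsilon> / 4) sequentially"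
    using tendstoD[OF lim, of "\<epsilon> / 4"] \<epsilon> by (simp add: dist_real_def)
  then obtain m0 where m0: "\<And>m. m0 \<le> m \<Longrightarrow> \<bar>ln (real m) * v m - c\<bar> < \<epsilon> / 4"
    by (auto simp: eventually_sequentially)
  have "filterlim (\<lambda>n. sqrt (real n)) at_top sequentially" by real_asymp
  then have "eventually (\<lambda>n. real m0 \<le> sqrt (real n)) sequentially" by (simp add: filterlim_at_top)
  moreover have "eventually (\<lambda>n. (K * ln (real n) + c) * sqrt (real n) \<le> \<epsilon> / 4 * real n) sequentially"
    using \<epsilon> by real_asymp
  moreover have "eventually (\<lambda>n. 2 * c * (real n / ln (real n)) \<le> \<epsilon> / 4 * real n) sequentially"
    using \<epsilon> by real_asymp
  ultimately show "eventually (\<lambda>n. norm ((\<Sum>m=1..n. v m) - c * (real n / ln (real n))) \<le> \<epsilon> * norm (real n / ln (real n))) sequentially"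
    using eventually_ge_at_top[of 3]
  proof eventually_elim
    case (elim n)
    define L where "L = ln (real n)"
    have L: "0 < L" using elim by (simp add: L_def)
    have "(\<Sum>m=1..n. \<bar>L * v m - c\<bar>) \<le> (K * L + c) * sqrt (real n) + (\<Sum>m=1..n. \<epsilon> / 2 + 2 * c / L * ln (real n / real m))"
    proof (rule sum_split_at_sqrt)
      show "0 \<le> K * L + c" using K c L by simp
      fix m assume m: "1 \<le> m" "m \<le> n"
      have "\<bar>L * v m - c\<bar> \<le> L * \<bar>v m\<bar> + c" 
        using abs_triangle_ineq4[of "L * v m" c] c L by (simp add: abs_mult)
      also have "L * \<bar>v m\<bar> \<le> L * K" using K(2)[of m] L by (intro mult_left_mono) auto
      finally show "\<bar>L * v m - c\<bar> \<le> K * L + c" by (simp add: mult.commute)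
      have lnr: "0 \<le> ln (real n / real m)" using m by simp
      then show "0 \<le> \<epsilon> / 2 + 2 * c / L * ln (real n / real m)" using \<epsilon> c L by simp
      assume sq: "sqrt (real n) \<le> real m"
      then have "m0 \<le> m" using elim(1) by linarith
      define l where "l = ln (real m)"
      have l: "L / 2 \<le> l" using half_ln_le[of n m] sq m by (simp add: L_def l_def)
      then have l0: "0 < l" using L by simp
      \<comment> \<open>Separates the error of the limit from that of the weight; the ratio L / l is
        at most 2.\<close>
      have "L * v m - c = L / l * (l * v m - c) + c * (L - l) / l"
        using l0 by (simp add: field_simps)
      then have "\<bar>L * v m - c\<bar> \<le> \<bar>L / l * (l * v m - c)\<bar> + \<bar>c * (L - l) / l\<bar>" by (simp only: abs_triangle_ineq)
      also have "\<bar>L / l * (l * v m - c)\<bar> = L / l * \<bar>l * v m - c\<bar>" using L l0 by (simp add: abs_mult)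
      also have "\<dots> \<le> 2 * (\<epsilon> / 4)"
        using m0[OF \<open>m0 \<le> m\<close>] l l0 L by (intro mult_mono) (auto simp: l_def field_simps)
      also have "L - l = ln (real n / real m)" using m by (simp add: L_def l_def ln_div)
      also have "\<bar>c * ln (real n / real m) / l\<bar> = c * ln (real n / real m) * (1 / l)" using c lnr l0 by simp
      also have "\<dots> \<le> c * ln (real n / real m) * (2 / L)"
        using c lnr l l0 L by (intro mult_left_mono) (auto simp: field_simps)
      finally show "\<bar>L * v m - c\<bar> \<le> \<epsilon> / 2 + 2 * c / L * ln (real n / real m)" by (simp add: mult_ac)
    qed
    also have "(\<Sum>m=1..n. \<epsilon> / 2 + 2 * c / L * ln (real n / real m)) = \<epsilon> / 2 * real n + 2 * c / L * (\<Sum>m=1..n. ln (real n / real m))"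
      by (simp add: sum.distrib sum_distrib_left)
    also have "\<dots> \<le> \<epsilon> / 2 * real n + 2 * c / L * real n"
      using sum_ln_ratio_le[of n] c L by (intro add_left_mono mult_left_mono) auto
    also have "(K * L + c) * sqrt (real n) \<le> \<epsilon> / 4 * real n" using elim(2) by (simp add: L_def)
    also have "2 * c / L * real n \<le> \<epsilon> / 4 * real n" using elim(3) by (simp add: L_def)
    finally have "(\<Sum>m=1..n. \<bar>L * v m - c\<bar>) \<le> \<epsilon> * real n" by simp
    then have le: "\<bar>\<Sum>m=1..n. (L * v m - c)\<bar> \<le> \<epsilon> * real n"
      by (rule order_trans[OF sum_abs])
    have eq: "(\<Sum>m=1..n. (L * v m - c)) = L * ((\<Sum>m=1..n. v m) - c * (real n / L))"
      using L by (simp add: sum_subtractf sum_distrib_left right_diff_distrib)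
    have "L * \<bar>(\<Sum>m=1..n. v m) - c * (real n / L)\<bar> = \<bar>\<Sum>m=1..n. (L * v m - c)\<bar>"
      unfolding eq using L by (simp only: abs_mult abs_of_pos)
    with le have "L * \<bar>(\<Sum>m=1..n. v m) - c * (real n / L)\<bar> \<le> \<epsilon> * real n" by simp
    then show ?case using L by (simp add: L_def field_simps)
  qed
qed

lemma sum_gauss_max_var_asymp:
  "(\<lambda>n. (\<Sum>m=1..n. gauss_max_var m) - pi\<^sup>2 / 12 * (real n / ln (real n))) \<in> o(\<lambda>n. real n / ln (real n))"
  and gauss_max_var_bounded: "\<exists>K>0. \<forall>m. \<bar>gauss_max_var m\<bar> \<le> K"
proof -
  obtain C where C: "0 < C" "\<And>m. norm (ln (real m) * gauss_max_var m) \<le> C"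
    using convergent_imp_Bseq[OF convergentI[OF gauss_max_var_asymp]] by (auto elim: BseqE)
  have "\<bar>gauss_max_var m\<bar> \<le> C" if "3 \<le> m" for m
  proof -
    have "exp 1 \<le> real m" using that exp_le by linarith
    then have "1 \<le> ln (real m)" using that by (subst ln_ge_iff) auto
    then have "1 * \<bar>gauss_max_var m\<bar> \<le> ln (real m) * \<bar>gauss_max_var m\<bar>" by (intro mult_right_mono) auto
    then show ?thesis using C(2)[of m] \<open>1 \<le> ln (real m)\<close> by (simp add: abs_mult)
  qed
  then show ex: "\<exists>K>0. \<forall>m. \<bar>gauss_max_var m\<bar> \<le> K" by (rule eventually_bounded_imp_bounded)
  then obtain K where "K > 0" "\<And>m. \<bar>gauss_max_var m\<bar> \<le> K" by blast
  then show "(\<lambda>n. (\<Sum>m=1..n. gauss_max_var m) - pi\<^sup>2 / 12 * (real n / ln (real n))) \<in> o(\<lambda>n. real n / ln (real n))"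
    by (intro sum_asymp_div_ln[OF gauss_max_var_asymp, where K = K]) auto
qed

lemma sum_gauss_max_third_bigo:
  "(\<lambda>n. \<Sum>m=1..n. gauss_max_third m) \<in> O(\<lambda>n. real n / sqrt (ln (real n)) ^ 3)"
proof -
  have nonneg: "0 \<le> gauss_max_third m" for m unfolding gauss_max_third_def by (intro integral_nonneg_AE) auto
  obtain C m0 where C: "\<And>m. m0 \<le> m \<Longrightarrow> gauss_max_third m \<le> C / sqrt (ln (real m)) ^ 3"
    using gauss_max_third_bound by blast
  have C': "gauss_max_third m \<le> \<bar>C\<bar> / sqrt (ln (real m)) ^ 3" if "m0 \<le> m" "3 \<le> m" for m
    using C[OF that(1)] that by (elim order_trans) (auto intro!: divide_right_mono)
  have "\<bar>gauss_max_third m\<bar> \<le> \<bar>C\<bar>" if "max 3 m0 \<le> m" for m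
  proof -
    have "exp 1 \<le> real m" using that exp_le by linarith
    then have "1 \<le> ln (real m)" using that by (subst ln_ge_iff) auto
    then have "1 \<le> sqrt (ln (real m)) ^ 3" by (intro one_le_power) auto
    then have "\<bar>C\<bar> / sqrt (ln (real m)) ^ 3 \<le> \<bar>C\<bar> / 1"
      using \<open>1 \<le> ln (real m)\<close> by (intro divide_left_mono) auto
    then show ?thesis using C'[of m] nonneg[of m] that by simp
  qed
  from eventually_bounded_imp_bounded[of "max 3 m0" gauss_max_third, OF this]
  obtain K where K: "K > 0" "\<And>m. \<bar>gauss_max_third m\<bar> \<le> K" by blast
  have "filterlim (\<lambda>n. sqrt (real n)) at_top sequentially" by real_asymp
  then have "eventually (\<lambda>n. real (max 3 m0) \<le> sqrt (real n)) sequentially" by (simp add: filterlim_at_top)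
  then have "eventually (\<lambda>n. norm (\<Sum>m=1..n. gauss_max_third m) \<le>
      1 * norm (K * sqrt (real n) + \<bar>C\<bar> * (real n / sqrt (ln (real n) / 2) ^ 3))) sequentially"
    using eventually_ge_at_top[of 3]
  proof eventually_elim
    case (elim n)
    have L: "0 < ln (real n) / 2" using elim by simp
    have "(\<Sum>m=1..n. gauss_max_third m) \<le> K * sqrt (real n) + (\<Sum>m=1..n. \<bar>C\<bar> / sqrt (ln (real n) / 2) ^ 3)"
    proof (rule sum_split_at_sqrt)
      fix m assume m: "1 \<le> m" "m \<le> n"
      show "gauss_max_third m \<le> K" using K(2)[of m] by simp
      show "0 \<le> \<bar>C\<bar> / sqrt (ln (real n) / 2) ^ 3" using L by simp
      assume sq: "sqrt (real n) \<le> real m"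
      then have "m0 \<le> m" "3 \<le> m" using elim(1) by linarith+
      note C'[OF this]
      also have "\<bar>C\<bar> / sqrt (ln (real m)) ^ 3 \<le> \<bar>C\<bar> / sqrt (ln (real n) / 2) ^ 3"
      proof -
        have "ln (real n) / 2 \<le> ln (real m)" using half_ln_le[of n m] sq m by simp
        then show ?thesis using L by (intro divide_left_mono power_mono) auto
      qed
      finally show "gauss_max_third m \<le> \<bar>C\<bar> / sqrt (ln (real n) / 2) ^ 3" .
    qed (use K in simp)
    moreover have "0 \<le> (\<Sum>m=1..n. gauss_max_third m)" by (intro sum_nonneg nonneg)
    ultimately show ?case by (simp add: mult_ac)
  qed
  then have "(\<lambda>n. \<Sum>m=1..n. gauss_max_third m) \<in> O(\<lambda>n. K * sqrt (real n) + \<bar>C\<bar> * (real n / sqrt (ln (real n) / 2) ^ 3))"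
    by (rule bigoI)
  also have "(\<lambda>n. K * sqrt (real n) + \<bar>C\<bar> * (real n / sqrt (ln (real n) / 2) ^ 3)) \<in> O(\<lambda>n. real n / sqrt (ln (real n)) ^ 3)"
  proof (rule sum_in_bigo)
    have "(\<lambda>n. sqrt (real n)) \<in> O(\<lambda>n. real n / sqrt (ln (real n)) ^ 3)" by real_asymp
    then show "(\<lambda>n. K * sqrt (real n)) \<in> O(\<lambda>n. real n / sqrt (ln (real n)) ^ 3)" by simp
    have "(\<lambda>n. real n / sqrt (ln (real n) / 2) ^ 3) \<in> O(\<lambda>n. real n / sqrt (ln (real n)) ^ 3)" by real_asymp
    then show "(\<lambda>n. \<bar>C\<bar> * (real n / sqrt (ln (real n) / 2) ^ 3)) \<in> O(\<lambda>n. real n / sqrt (ln (real n)) ^ 3)"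
      by (rule bigo_cmult)
  qed
  finally show ?thesis .
qed

text \<open>Two errors: that of the individual means, which gives the stated order, and that of
  replacing ln m by ln n under the root, which is only of order n / sqrt (ln n).\<close>

lemma sum_gauss_max_mean_bigo:
  "(\<lambda>n. (\<Sum>m=1..n. gauss_max_mean m) - real n * sqrt (2 * ln (real n)))
     \<in> O(\<lambda>n. real n * ln (ln (real n)) / sqrt (ln (real n)))"
proof -
  define d where "d m = gauss_max_mean m - sqrt (2 * ln (real m))" for m
  obtain C m0 where C: "\<And>m. m0 \<le> m \<Longrightarrow> \<bar>d m\<bar> \<le> C * ln (ln (real m)) / sqrt (ln (real m))"
    using gauss_max_mean_asymp by (auto simp: d_def)
  define m1 where "m1 = max m0 16"
  have lnln: "1 \<le> ln (real m)" "0 \<le> ln (ln (real m))" if "m1 \<le> m" for m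
  proof -
    have "exp 1 \<le> real m" using that exp_le by (auto simp: m1_def)
    then show "1 \<le> ln (real m)" using that by (subst ln_ge_iff) (auto simp: m1_def)
    then show "0 \<le> ln (ln (real m))" by simp
  qed
  have C': "\<bar>d m\<bar> \<le> \<bar>C\<bar> * ln (ln (real m)) / sqrt (ln (real m))" if "m1 \<le> m" for m
  proof -
    have "C * ln (ln (real m)) / sqrt (ln (real m)) \<le> \<bar>C\<bar> * ln (ln (real m)) / sqrt (ln (real m))"
      using lnln[OF that] by (intro divide_right_mono mult_right_mono) auto
    then show ?thesis using C[of m] that by (simp add: m1_def)
  qed
  have "\<bar>d m\<bar> \<le> 2 * \<bar>C\<bar>" if "m1 \<le> m" for m
  proof -
    define s where "s = sqrt (ln (real m))"
    have s: "1 \<le> s" "ln (real m) = s\<^sup>2" using lnln[OF that] by (auto simp: s_def)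
    have "ln (ln (real m)) = 2 * ln s" using s by (simp add: ln_realpow)
    also have "\<dots> \<le> 2 * s" using ln_le_minus_one[of s] s by simp
    finally have "ln (ln (real m)) / s \<le> 2" using s by (simp add: field_simps)
    then have "\<bar>C\<bar> * (ln (ln (real m)) / s) \<le> \<bar>C\<bar> * 2" by (intro mult_left_mono) auto
    then show ?thesis using C'[OF that] by (simp add: s_def)
  qed
  from eventually_bounded_imp_bounded[of m1 d, OF this]
  obtain K where K: "K > 0" "\<And>m. \<bar>d m\<bar> \<le> K" by blast
  have "filterlim (\<lambda>n. sqrt (real n)) at_top sequentially" by real_asymp
  then have "eventually (\<lambda>n. real m1 \<le> sqrt (real n)) sequentially" by (simp add: filterlim_at_top)
  then have "eventually (\<lambda>n. norm ((\<Sum>m=1..n. gauss_max_mean m) - real n * sqrt (2 * ln (real n))) \<le>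
      1 * norm (K * sqrt (real n) + \<bar>C\<bar> * (real n * ln (ln (real n)) / sqrt (ln (real n) / 2)) + 2 * (real n / sqrt (2 * ln (real n))))) sequentially"
    using eventually_ge_at_top[of m1]
  proof eventually_elim
    case (elim n)
    have n: "m1 \<le> n" "16 \<le> n" using elim by (auto simp: m1_def)
    have L: "0 < ln (real n) / 2" using n by simp
    have "(\<Sum>m=1..n. \<bar>d m\<bar>) \<le> K * sqrt (real n) + (\<Sum>m=1..n. \<bar>C\<bar> * ln (ln (real n)) / sqrt (ln (real n) / 2))"
    proof (rule sum_split_at_sqrt)
      fix m assume m: "1 \<le> m" "m \<le> n"
      show "\<bar>d m\<bar> \<le> K" by (rule K)
      show "0 \<le> \<bar>C\<bar> * ln (ln (real n)) / sqrt (ln (real n) / 2)" using L lnln(2)[OF n(1)] by simp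
      assume sq: "sqrt (real n) \<le> real m"
      then have m1: "m1 \<le> m" using elim(1) by linarith
      note C'[OF m1]
      also have "\<bar>C\<bar> * ln (ln (real m)) / sqrt (ln (real m)) \<le> \<bar>C\<bar> * ln (ln (real n)) / sqrt (ln (real n) / 2)"
      proof (rule frac_le)
        have "ln (real n) / 2 \<le> ln (real m)" using half_ln_le[of n m] sq m by simp
        then show "sqrt (ln (real n) / 2) \<le> sqrt (ln (real m))" by simp
        have "ln (real m) \<le> ln (real n)" using m by simp
        then have "ln (ln (real m)) \<le> ln (ln (real n))" using lnln(1)[OF m1] by (subst ln_le_cancel_iff) auto
        then show "\<bar>C\<bar> * ln (ln (real m)) \<le> \<bar>C\<bar> * ln (ln (real n))" by (intro mult_left_mono) auto
        show "0 \<le> \<bar>C\<bar> * ln (ln (real n))" using lnln(2)[OF n(1)] by simp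
      qed (use L in simp)
      finally show "\<bar>d m\<bar> \<le> \<bar>C\<bar> * ln (ln (real n)) / sqrt (ln (real n) / 2)" .
    qed (use K in simp)
    then have 1: "(\<Sum>m=1..n. \<bar>d m\<bar>) \<le> K * sqrt (real n) + \<bar>C\<bar> * (real n * ln (ln (real n)) / sqrt (ln (real n) / 2))"
      by (simp add: mult_ac)
    \<comment> \<open>From b - a \<le> (b^2 - a^2) / b, which leaves a logarithmic ratio whose sum
      is at most n.\<close>
    have 2: "\<bar>sqrt (2 * ln (real m)) - sqrt (2 * ln (real n))\<bar> \<le> 2 / sqrt (2 * ln (real n)) * ln (real n / real m)"
      if "m \<in> {1..n}" for m
    proof -
      define a b where "a = sqrt (2 * ln (real m))" and "b = sqrt (2 * ln (real n))"
      have ab: "0 \<le> a" "0 < b" "a \<le> b" using that n by (auto simp: a_def b_def)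
      have "b * (b - a) \<le> (b + a) * (b - a)" using ab by (intro mult_right_mono) auto
      also have "\<dots> = b\<^sup>2 - a\<^sup>2" by (simp add: power2_eq_square algebra_simps)
      also have "\<dots> = 2 * ln (real n / real m)" using that n by (simp add: a_def b_def ln_div)
      finally have "b - a \<le> 2 / b * ln (real n / real m)" using ab by (simp add: field_simps)
      then show ?thesis using ab by (simp add: a_def b_def)
    qed
    have "(\<Sum>m=1..n. gauss_max_mean m) - real n * sqrt (2 * ln (real n)) =
        (\<Sum>m=1..n. d m) + (\<Sum>m=1..n. sqrt (2 * ln (real m)) - sqrt (2 * ln (real n)))"
      by (simp add: d_def sum_subtractf)
    also have "\<bar>\<dots>\<bar> \<le> (\<Sum>m=1..n. \<bar>d m\<bar>) + (\<Sum>m=1..n. \<bar>sqrt (2 * ln (real m)) - sqrt (2 * ln (real n))\<bar>)"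
      by (rule order_trans[OF abs_triangle_ineq]) (intro add_mono sum_abs)
    also have "(\<Sum>m=1..n. \<bar>sqrt (2 * ln (real m)) - sqrt (2 * ln (real n))\<bar>) \<le> (\<Sum>m=1..n. 2 / sqrt (2 * ln (real n)) * ln (real n / real m))"
      by (intro sum_mono 2)
    also have "\<dots> = 2 / sqrt (2 * ln (real n)) * (\<Sum>m=1..n. ln (real n / real m))" by (simp add: sum_distrib_left)
    also have "\<dots> \<le> 2 / sqrt (2 * ln (real n)) * real n" using L by (intro mult_left_mono sum_ln_ratio_le) auto
    also note 1
    finally have "\<bar>(\<Sum>m=1..n. gauss_max_mean m) - real n * sqrt (2 * ln (real n))\<bar> \<le>
      K * sqrt (real n) + \<bar>C\<bar> * (real n * ln (ln (real n)) / sqrt (ln (real n) / 2)) + 2 * (real n / sqrt (2 * ln (real n)))" by simp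
    then show ?case by simp
  qed
  then have "(\<lambda>n. (\<Sum>m=1..n. gauss_max_mean m) - real n * sqrt (2 * ln (real n))) \<in>
      O(\<lambda>n. K * sqrt (real n) + \<bar>C\<bar> * (real n * ln (ln (real n)) / sqrt (ln (real n) / 2)) + 2 * (real n / sqrt (2 * ln (real n))))"
    by (rule bigoI)
  also have "(\<lambda>n. K * sqrt (real n) + \<bar>C\<bar> * (real n * ln (ln (real n)) / sqrt (ln (real n) / 2)) + 2 * (real n / sqrt (2 * ln (real n))))
      \<in> O(\<lambda>n. real n * ln (ln (real n)) / sqrt (ln (real n)))"
  proof (intro sum_in_bigo)
    show "(\<lambda>n. K * sqrt (real n)) \<in> O(\<lambda>n. real n * ln (ln (real n)) / sqrt (ln (real n)))"
      by (rule bigo_cmult) real_asymp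
    show "(\<lambda>n. \<bar>C\<bar> * (real n * ln (ln (real n)) / sqrt (ln (real n) / 2))) \<in> O(\<lambda>n. real n * ln (ln (real n)) / sqrt (ln (real n)))"
      by (rule bigo_cmult) real_asymp
    show "(\<lambda>n. 2 * (real n / sqrt (2 * ln (real n)))) \<in> O(\<lambda>n. real n * ln (ln (real n)) / sqrt (ln (real n)))"
      by (rule bigo_cmult) real_asymp
  qed
  finally show ?thesis .
qed

section \<open>The central limit theorem\<close>

text \<open>Square integrability of the sum belongs to the conclusion because the induction step
  needs it for the partial sum.\<close>

lemma (in prob_space) variance_sum_indep:
  fixes Z :: "'i \<Rightarrow> 'a \<Rightarrow> real"
  assumes "finite I" "indep_vars (\<lambda>_. borel) Z I" "\<And>i. i \<in> I \<Longrightarrow> integrable M (\<lambda>\<omega>. (Z i \<omega>)\<^sup>2)"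
  shows "integrable M (\<lambda>\<omega>. (\<Sum>i\<in>I. Z i \<omega>)\<^sup>2) \<and> variance (\<lambda>\<omega>. \<Sum>i\<in>I. Z i \<omega>) = (\<Sum>i\<in>I. variance (Z i))"
  using assms
proof (induction I)
  case empty
  then show ?case by (simp add: prob_space)
next
  case (insert a I)
  have IH: "integrable M (\<lambda>\<omega>. (\<Sum>i\<in>I. Z i \<omega>)\<^sup>2)" "variance (\<lambda>\<omega>. \<Sum>i\<in>I. Z i \<omega>) = (\<Sum>i\<in>I. variance (Z i))"
    using insert.IH insert.prems indep_vars_subset[OF insert.prems(1), of I] by auto
  define U V where "U = Z a" and "V = (\<lambda>\<omega>. \<Sum>i\<in>I. Z i \<omega>)"
  have ind: "indep_var borel U borel V"
    unfolding U_def V_def by (rule indep_vars_sum[OF insert.hyps insert.prems(1)])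
  have [measurable]: "U \<in> borel_measurable M" "V \<in> borel_measurable M"
    using indep_var_rv1[OF ind] indep_var_rv2[OF ind] by auto
  have sq: "integrable M (\<lambda>\<omega>. (U \<omega>)\<^sup>2)" "integrable M (\<lambda>\<omega>. (V \<omega>)\<^sup>2)"
    using insert.prems(2)[of a] IH(1) by (auto simp: U_def V_def)
  have int: "integrable M U" "integrable M V"
    using sq by (auto intro: square_integrable_imp_integrable)
  have UV: "integrable M (\<lambda>\<omega>. U \<omega> * V \<omega>)" "expectation (\<lambda>\<omega>. U \<omega> * V \<omega>) = expectation U * expectation V"
    by (rule indep_var_integrable[OF ind int], rule indep_var_lebesgue_integral[OF ind int])
  have sq_eq: "(U \<omega> + V \<omega>)\<^sup>2 = (U \<omega>)\<^sup>2 + (V \<omega>)\<^sup>2 + 2 * (U \<omega> * V \<omega>)" for \<omega>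
    by (simp add: power2_sum)
  have int_sq: "integrable M (\<lambda>\<omega>. (U \<omega> + V \<omega>)\<^sup>2)"
    unfolding sq_eq using sq UV by auto
  have int_sum: "integrable M (\<lambda>\<omega>. U \<omega> + V \<omega>)" using int by auto
  have "variance (\<lambda>\<omega>. U \<omega> + V \<omega>) = expectation (\<lambda>\<omega>. (U \<omega>)\<^sup>2 + (V \<omega>)\<^sup>2 + 2 * (U \<omega> * V \<omega>)) - (expectation U + expectation V)\<^sup>2"
    using variance_eq[OF int_sum int_sq] int by (simp add: sq_eq)
  also have "\<dots> = variance U + variance V"
    using variance_eq[OF int(1) sq(1)] variance_eq[OF int(2) sq(2)] sq UV
    by (simp add: power2_sum)
  finally have "variance (\<lambda>\<omega>. U \<omega> + V \<omega>) = variance U + variance V" .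
  moreover have "(\<lambda>\<omega>. \<Sum>i\<in>insert a I. Z i \<omega>) = (\<lambda>\<omega>. U \<omega> + V \<omega>)"
    using insert.hyps by (simp add: U_def V_def)
  ultimately show ?case using int_sq IH(2) insert.hyps by (simp add: U_def V_def)
qed

section \<open>Independent summands realised on a product space\<close>

lemma indep_vars_PiM_coordinates:
  assumes I: "I \<noteq> {}" and N: "\<And>i. i \<in> I \<Longrightarrow> real_distribution (N i)"
  shows "prob_space.indep_vars (PiM I N) (\<lambda>_. borel) (\<lambda>i w. w i) I"
proof -
  have psp: "prob_space (N i)" and sets_N [simp]: "sets (N i) = sets borel" if "i \<in> I" for i
    using N[OF that] by (auto simp: real_distribution_def real_distribution_axioms_def)
  interpret P: prob_space "PiM I N" by (rule prob_space_PiM[OF psp])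
  have coord: "(\<lambda>w. w i) \<in> borel_measurable (PiM I N)" if "i \<in> I" for i
    using measurable_component_singleton[OF that, of N] measurable_cong_sets[OF refl sets_N[OF that]] by auto
  have comp: "distr (PiM I N) borel (\<lambda>w. w i) = N i" if "i \<in> I" for i
  proof -
    have "distr (PiM I N) borel (\<lambda>w. w i) = distr (PiM I N) (N i) (\<lambda>w. w i)"
      by (intro distr_cong) (use that in auto)
    also have "\<dots> = N i" using that psp by (intro distr_PiM_component)
    finally show ?thesis .
  qed
  have "distr (PiM I N) (\<Pi>\<^sub>M i\<in>I. borel) (\<lambda>w. \<lambda>i\<in>I. w i) = distr (PiM I N) (PiM I N) (\<lambda>w. w)"
  proof (rule distr_cong[OF refl])
    show "sets (\<Pi>\<^sub>M i\<in>I. borel) = sets (PiM I N)" by (rule sets_PiM_cong) auto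
    show "(\<lambda>i\<in>I. w i) = w" if "w \<in> space (PiM I N)" for w
      using that by (auto simp: space_PiM PiE_def extensional_restrict)
  qed
  also have "\<dots> = PiM I N" by (rule distr_id2) simp
  also have "\<dots> = (\<Pi>\<^sub>M i\<in>I. distr (PiM I N) borel (\<lambda>w. w i))"
    by (intro PiM_cong refl comp[symmetric])
  finally show ?thesis
    using P.indep_vars_iff_distr_eq_PiM'[where M' = "\<lambda>_. borel" and X = "\<lambda>i w. w i", OF I coord] by simp
qed

context gaussian_matrix
begin

text \<open>The factorised characteristic function and Levy uniqueness identify the law of the
  greedy sum with that of a sum of coordinates, so that mean and variance can be computed with
  genuinely independent variables.\<close>

lemma distr_greedy_sum:
  assumes n: "1 \<le> n"
  shows "distr M borel greedy_sum = distr (PiM {1..n} gauss_max) borel (\<lambda>w. \<Sum>m=1..n. w m)"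
    and "prob_space.indep_vars (PiM {1..n} gauss_max) (\<lambda>_. borel) (\<lambda>m w. w m) {1..n}"
    and "\<And>m. m \<in> {1..n} \<Longrightarrow> distr (PiM {1..n} gauss_max) borel (\<lambda>w. w m) = gauss_max m"
proof -
  let ?P = "PiM {1..n} gauss_max"
  have psp: "prob_space (gauss_max m)" and sets_gm: "sets (gauss_max m) = sets borel" for m
    using real_distribution_gauss_max[of m] by (auto simp: real_distribution_def real_distribution_axioms_def)
  interpret P: prob_space ?P by (rule prob_space_PiM[OF psp])
  show ind: "P.indep_vars (\<lambda>_. borel) (\<lambda>m w. w m) {1..n}"
    using n by (intro indep_vars_PiM_coordinates real_distribution_gauss_max) auto
  show comp: "distr ?P borel (\<lambda>w. w m) = gauss_max m" if "m \<in> {1..n}" for m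
  proof -
    have "distr ?P borel (\<lambda>w. w m) = distr ?P (gauss_max m) (\<lambda>w. w m)"
      by (intro distr_cong) (auto simp: sets_gm)
    also have "\<dots> = gauss_max m" using that psp by (intro distr_PiM_component)
    finally show ?thesis .
  qed
  have sum_rv: "(\<lambda>w. \<Sum>m=1..n. w m) \<in> borel_measurable ?P"
    using ind unfolding P.indep_vars_def by (intro borel_measurable_sum) auto
  show "distr M borel greedy_sum = distr ?P borel (\<lambda>w. \<Sum>m=1..n. w m)"
  proof (intro Levy_uniqueness ext)
    fix t
    have "char (distr ?P borel (\<lambda>w. \<Sum>m=1..n. w m)) t = (\<Prod>m=1..n. char (distr ?P borel (\<lambda>w. w m)) t)"
      by (rule P.char_distr_sum[OF ind])
    also have "\<dots> = (\<Prod>m=1..n. char (gauss_max m) t)" by (intro prod.cong refl) (simp only: comp)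
    finally show "char (distr M borel greedy_sum) t = char (distr ?P borel (\<lambda>w. \<Sum>m=1..n. w m)) t"
      by (simp only: char_greedy_sum)
  qed (intro P.real_distribution_distr[OF sum_rv] real_distribution_distr measurable_greedy_sum)+
qed

lemma gauss_max_second_moment:
  assumes "1 \<le> m"
  shows "integrable (gauss_max m) (\<lambda>x. x)" "integrable (gauss_max m) (\<lambda>x. x\<^sup>2)"
  using integrable_gauss_max_abs_power[OF assms, of 2] integrable_gauss_max_abs_power[OF assms, of 1]
  by (auto simp: real_distribution.space_eq_univ[OF real_distribution_gauss_max] gauss_max_def
      dest: integrable_abs_cancel)

lemma greedy_sum_mean_var:
  assumes n: "1 \<le> n"
  shows "expectation greedy_sum = (\<Sum>m=1..n. gauss_max_mean m)"
    and "variance greedy_sum = (\<Sum>m=1..n. gauss_max_var m)"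
proof -
  let ?P = "PiM {1..n} gauss_max"
  note law = distr_greedy_sum[OF n]
  have psp: "prob_space (gauss_max m)" for m
    using real_distribution_gauss_max[of m] by (auto simp: real_distribution_def)
  interpret P: prob_space ?P by (rule prob_space_PiM[OF psp])
  have rv: "(\<lambda>w. w m) \<in> borel_measurable ?P" if "m \<in> {1..n}" for m
    using law(2) that unfolding P.indep_vars_def by auto
  then have sum_rv: "(\<lambda>w. \<Sum>m=1..n. w m) \<in> borel_measurable ?P" by (intro borel_measurable_sum)
  have transfer: "(\<integral>\<omega>. f (greedy_sum \<omega>) \<partial>M) = (\<integral>w. f (\<Sum>m=1..n. w m) \<partial>?P)"
    if "f \<in> borel_measurable borel" for f :: "real \<Rightarrow> real"
    using integral_distr[OF measurable_greedy_sum that] integral_distr[OF sum_rv that] law(1) by simp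
  have coord: "(\<integral>w. f (w m) \<partial>?P) = (\<integral>x. f x \<partial>gauss_max m)"
    and coord_int: "integrable ?P (\<lambda>w. f (w m)) \<longleftrightarrow> integrable (gauss_max m) f"
    if "m \<in> {1..n}" "f \<in> borel_measurable borel" for m and f :: "real \<Rightarrow> real"
    using integral_distr[OF rv[OF that(1)] that(2)] integrable_distr_eq[OF rv[OF that(1)] that(2)] law(3)[OF that(1)]
    by simp_all
  have int1: "integrable ?P (\<lambda>w. w m)" and int2: "integrable ?P (\<lambda>w. (w m)\<^sup>2)" if "m \<in> {1..n}" for m
    using coord_int[OF that, of "\<lambda>x. x"] coord_int[OF that, of "\<lambda>x. x\<^sup>2"] gauss_max_second_moment[of m] that by auto
  have mean_coord: "P.expectation (\<lambda>w. w m) = gauss_max_mean m" if "m \<in> {1..n}" for m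
    using coord[OF that, of "\<lambda>x. x"] by (simp add: gauss_max_mean_def)
  show mean: "expectation greedy_sum = (\<Sum>m=1..n. gauss_max_mean m)"
    using transfer[of "\<lambda>x. x"] int1 mean_coord by (simp add: Bochner_Integration.integral_sum)
  have mean_P: "P.expectation (\<lambda>w. \<Sum>m=1..n. w m) = expectation greedy_sum"
    using transfer[of "\<lambda>x. x"] by simp
  have "variance greedy_sum = P.variance (\<lambda>w. \<Sum>m=1..n. w m)"
    unfolding mean_P by (rule transfer[of "\<lambda>x. (x - expectation greedy_sum)\<^sup>2"]) measurable
  also have "\<dots> = (\<Sum>m=1..n. P.variance (\<lambda>w. w m))"
    using P.variance_sum_indep[OF _ law(2)] int2 by auto
  also have "\<dots> = (\<Sum>m=1..n. gauss_max_var m)"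
  proof (rule sum.cong[OF refl])
    fix m assume m: "m \<in> {1..n}"
    show "P.variance (\<lambda>w. w m) = gauss_max_var m"
      unfolding mean_coord[OF m] gauss_max_var_def by (rule coord[OF m]) measurable
  qed
  finally show "variance greedy_sum = (\<Sum>m=1..n. gauss_max_var m)" .
qed

end

section \<open>Centred maxima and the rate of convergence\<close>

definition centered_gauss_max :: "nat \<Rightarrow> real measure" where
  "centered_gauss_max m = distr (gauss_max m) borel (\<lambda>x. x - gauss_max_mean m)"

lemma sets_gauss_max [measurable_cong]: "sets (gauss_max m) = sets borel"
  by (simp add: gauss_max_def)

lemma centered_distribution_centered_gauss_max:
  assumes "1 \<le> m"
  shows "centered_distribution (centered_gauss_max m)"
proof -
  interpret G: real_distribution "gauss_max m" by (rule real_distribution_gauss_max)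
  interpret C: real_distribution "centered_gauss_max m"
    unfolding centered_gauss_max_def by (rule G.real_distribution_distr) simp
  show ?thesis
  proof unfold_locales
    have int: "integrable (gauss_max m) (\<lambda>x. \<bar>x\<bar> ^ k)" for k by (rule integrable_gauss_max_abs_power[OF assms])
    have int1: "integrable (gauss_max m) (\<lambda>x. x)" using int[of 1] by (auto intro: integrable_abs_cancel)
    have "integrable (gauss_max m) (\<lambda>x. \<bar>x - gauss_max_mean m\<bar> ^ 3)"
    proof (rule Bochner_Integration.integrable_bound)
      let ?a = "\<bar>gauss_max_mean m\<bar>"
      show "integrable (gauss_max m) (\<lambda>x. 8 * \<bar>x\<bar> ^ 3 + 8 * ?a ^ 3)" using int[of 3] by auto
      show "AE x in gauss_max m. norm (\<bar>x - gauss_max_mean m\<bar> ^ 3) \<le> norm (8 * \<bar>x\<bar> ^ 3 + 8 * ?a ^ 3)"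
      proof (rule AE_I2)
        fix x :: real
        have "\<bar>x - gauss_max_mean m\<bar> ^ 3 \<le> (2 * max \<bar>x\<bar> ?a) ^ 3" by (intro power_mono) auto
        also have "\<dots> = 8 * max \<bar>x\<bar> ?a ^ 3" by (simp add: power_mult_distrib)
        also have "\<dots> \<le> 8 * \<bar>x\<bar> ^ 3 + 8 * ?a ^ 3" by (auto simp: max_def)
        finally show "norm (\<bar>x - gauss_max_mean m\<bar> ^ 3) \<le> norm (8 * \<bar>x\<bar> ^ 3 + 8 * ?a ^ 3)" by simp
      qed
    qed simp
    then show "integrable (centered_gauss_max m) (\<lambda>x. \<bar>x\<bar> ^ 3)"
      unfolding centered_gauss_max_def by (subst integrable_distr_eq) auto
    show "C.expectation (\<lambda>x. x) = 0"
    proof -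
      have "C.expectation (\<lambda>x. x) = (\<integral>x. x - gauss_max_mean m \<partial>gauss_max m)"
        unfolding centered_gauss_max_def by (rule integral_distr) measurable
      also have "\<dots> = (\<integral>x. x \<partial>gauss_max m) - (\<integral>x. gauss_max_mean m \<partial>gauss_max m)"
        using int1 by (intro Bochner_Integration.integral_diff) auto
      also have "(\<integral>x. gauss_max_mean m \<partial>gauss_max m) = gauss_max_mean m"
        using G.prob_space by simp
      finally show ?thesis by (simp only: gauss_max_mean_def)
    qed
  qed
qed

lemma centered_gauss_max_moments:
  "(\<integral>x. x\<^sup>2 \<partial>centered_gauss_max m) = gauss_max_var m"
  "(\<integral>x. \<bar>x\<bar> ^ 3 \<partial>centered_gauss_max m) = gauss_max_third m"
  unfolding centered_gauss_max_def gauss_max_var_def gauss_max_third_def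
  by (subst integral_distr; simp)+

lemma char_centered_gauss_max:
  "char (centered_gauss_max m) t = iexp (- (t * gauss_max_mean m)) * char (gauss_max m) t"
proof -
  have "char (centered_gauss_max m) t = (\<integral>x. iexp (- (t * gauss_max_mean m)) * iexp (t * x) \<partial>gauss_max m)"
    unfolding char_def centered_gauss_max_def
    by (subst integral_distr) (auto simp: right_diff_distrib algebra_simps mult_exp_exp intro!: Bochner_Integration.integral_cong)
  then show ?thesis by (simp add: char_def)
qed

definition (in gaussian_matrix) normalized_law :: "real measure" where
  "normalized_law = distr M borel (\<lambda>\<omega>. (greedy_sum \<omega> - expectation greedy_sum) / sqrt (variance greedy_sum))"

lemma (in gaussian_matrix) char_normalized_greedy_sum:
  assumes n: "1 \<le> n"
  shows "char (distr M borel (\<lambda>\<omega>. (greedy_sum \<omega> - expectation greedy_sum) / b)) t =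
    (\<Prod>m=1..n. char (centered_gauss_max m) (t / b))"
proof -
  define s where "s = t / b"
  have "char (distr M borel (\<lambda>\<omega>. (greedy_sum \<omega> - expectation greedy_sum) / b)) t =
      (\<integral>\<omega>. iexp (t * ((greedy_sum \<omega> - expectation greedy_sum) / b)) \<partial>M)"
    unfolding char_def by (subst integral_distr) auto
  also have "\<dots> = (\<integral>\<omega>. iexp (- (s * expectation greedy_sum)) * iexp (s * greedy_sum \<omega>) \<partial>M)"
  proof (intro Bochner_Integration.integral_cong refl)
    fix \<omega>
    have "t * ((greedy_sum \<omega> - expectation greedy_sum) / b) = - (s * expectation greedy_sum) + s * greedy_sum \<omega>"
      by (simp add: s_def diff_divide_distrib right_diff_distrib)
    then show "iexp (t * ((greedy_sum \<omega> - expectation greedy_sum) / b)) = iexp (- (s * expectation greedy_sum)) * iexp (s * greedy_sum \<omega>)"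
      by (simp only: of_real_add distrib_left exp_add)
  qed
  also have "\<dots> = iexp (- (s * expectation greedy_sum)) * (\<integral>\<omega>. iexp (s * greedy_sum \<omega>) \<partial>M)"
    by (rule integral_mult_right_zero)
  also have "(\<integral>\<omega>. iexp (s * greedy_sum \<omega>) \<partial>M) = char (distr M borel greedy_sum) s"
    unfolding char_def by (subst integral_distr) auto
  also have "\<dots> = (\<Prod>m=1..n. char (gauss_max m) s)" by (rule char_greedy_sum)
  also have "iexp (- (s * expectation greedy_sum)) = (\<Prod>m=1..n. iexp (- (s * gauss_max_mean m)))"
    unfolding greedy_sum_mean_var(1)[OF n]
    by (subst exp_sum[symmetric]) (auto simp: sum_distrib_left sum_negf)
  finally show ?thesis by (simp add: char_centered_gauss_max prod.distrib s_def)
qed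

text \<open>Constant and threshold are chosen before the space and the matrix, which is possible
  since the law depends on n only; this uniformity permits spaces that vary with n.\<close>

lemma greedy_sum_berry_esseen:
  "\<exists>K. eventually (\<lambda>n. \<forall>(M :: 'a measure) X. gaussian_matrix M n X \<longrightarrow>
     (\<forall>x. \<bar>cdf (gaussian_matrix.normalized_law M n X) x - \<Phi> x\<bar> \<le> K / sqrt (real n))) sequentially"
proof -
  obtain C where C: "\<forall>(I :: nat set) N B M. finite I \<longrightarrow> (\<forall>i\<in>I. centered_distribution (N i)) \<longrightarrow>
     real_distribution M \<longrightarrow> 0 < B \<longrightarrow> B\<^sup>2 = (\<Sum>i\<in>I. \<integral>x. x\<^sup>2 \<partial>N i) \<longrightarrow>
     (\<forall>i\<in>I. (\<integral>x. x\<^sup>2 \<partial>N i) \<le> B\<^sup>2 / 4) \<longrightarrow>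
     (\<forall>t. char M t = (\<Prod>i\<in>I. char (N i) (t / B))) \<longrightarrow>
     (\<forall>x. \<bar>cdf M x - \<Phi> x\<bar> \<le> C * (\<Sum>i\<in>I. \<integral>x. \<bar>x\<bar> ^ 3 \<partial>N i) / B ^ 3)"
    using berry_esseen by (rule exE)
  obtain Kv where Kv: "Kv > 0" "\<And>m. \<bar>gauss_max_var m\<bar> \<le> Kv" using gauss_max_var_bounded by blast
  obtain D where D: "D > 0" and D': "eventually (\<lambda>n. norm (\<Sum>m=1..n. gauss_max_third m) \<le> D * norm (real n / sqrt (ln (real n)) ^ 3)) sequentially"
    using sum_gauss_max_third_bigo by (auto elim: landau_o.bigE)
  define V where "V n = (\<Sum>m=1..n. gauss_max_var m)" for n
  \<comment> \<open>As pi^2 / 12 exceeds 3/4, an error of 1/4 leaves V n at least half of n / ln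
    n.\<close>
  have "eventually (\<lambda>n. norm (V n - pi\<^sup>2 / 12 * (real n / ln (real n))) \<le> 1 / 4 * norm (real n / ln (real n))) sequentially"
    unfolding V_def by (rule landau_o.smallD[OF sum_gauss_max_var_asymp]) simp
  \<comment> \<open>Makes each single variance less than a quarter of the total, as the
    Berry--Esseen bound demands.\<close>
  moreover have "eventually (\<lambda>n. 16 * Kv \<le> real n / ln (real n)) sequentially" by real_asymp
  ultimately have "eventually (\<lambda>n. \<forall>(M :: 'a measure) X. gaussian_matrix M n X \<longrightarrow>
     (\<forall>x. \<bar>cdf (gaussian_matrix.normalized_law M n X) x - \<Phi> x\<bar> \<le> (8 * \<bar>C\<bar> * D) / sqrt (real n))) sequentially"
    using D' eventually_ge_at_top[of 3]
  proof eventually_elim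
    case (elim n)
    show ?case
    proof (intro allI impI)
      fix M :: "'a measure" and X x
      assume "gaussian_matrix M n X"
      then interpret gaussian_matrix M n X .
      have n: "1 \<le> n" using elim by simp
      define L where "L = ln (real n)"
      define q where "q = real n / L"
      have L: "0 < L" using elim by (simp add: L_def)
      have q: "0 < q" using L n by (simp add: q_def)
      have V: "\<bar>V n - pi\<^sup>2 / 12 * q\<bar> \<le> 1 / 4 * q"
        using elim(1) q by (simp add: L_def[symmetric] q_def[symmetric])
      have "9 \<le> pi\<^sup>2" using power_mono[of 3 pi 2] pi_gt3 by simp
      then have "1 / 2 * q \<le> (pi\<^sup>2 / 12 - 1 / 4) * q" using q by (intro mult_right_mono) auto
      also have "\<dots> \<le> V n"
        unfolding left_diff_distrib using V by linarith
      finally have Vq: "q / 2 \<le> V n" by simp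
      define B where "B = sqrt (V n)"
      have B: "0 < B" "B\<^sup>2 = V n" using Vq q by (auto simp: B_def)
      have var: "variance greedy_sum = V n" using greedy_sum_mean_var(2)[OF n] by (simp add: V_def)
      have "\<forall>x. \<bar>cdf (distr M borel (\<lambda>\<omega>. (greedy_sum \<omega> - expectation greedy_sum) / B)) x - \<Phi> x\<bar>
          \<le> C * (\<Sum>m\<in>{1..n}. \<integral>x. \<bar>x\<bar> ^ 3 \<partial>centered_gauss_max m) / B ^ 3"
      proof (rule C[rule_format, THEN allI])
        show "centered_distribution (centered_gauss_max m)" if "m \<in> {1..n}" for m
          using that by (intro centered_distribution_centered_gauss_max) auto
        show "B\<^sup>2 = (\<Sum>m\<in>{1..n}. \<integral>x. x\<^sup>2 \<partial>centered_gauss_max m)"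
          by (simp add: B V_def centered_gauss_max_moments)
        show "(\<integral>x. x\<^sup>2 \<partial>centered_gauss_max m) \<le> B\<^sup>2 / 4" if "m \<in> {1..n}" for m
          using Kv(2)[of m] elim(2) Vq by (simp add: B centered_gauss_max_moments L_def[symmetric] q_def[symmetric])
        show "char (distr M borel (\<lambda>\<omega>. (greedy_sum \<omega> - expectation greedy_sum) / B)) t =
            (\<Prod>m\<in>{1..n}. char (centered_gauss_max m) (t / B))" for t
          by (rule char_normalized_greedy_sum[OF n])
        show "real_distribution (distr M borel (\<lambda>\<omega>. (greedy_sum \<omega> - expectation greedy_sum) / B))"
          by (rule real_distribution_distr) measurable
      qed (use B in auto)
      then have "\<bar>cdf (distr M borel (\<lambda>\<omega>. (greedy_sum \<omega> - expectation greedy_sum) / B)) x - \<Phi> x\<bar>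
          \<le> C * (\<Sum>m\<in>{1..n}. \<integral>x. \<bar>x\<bar> ^ 3 \<partial>centered_gauss_max m) / B ^ 3" ..
      also have "\<dots> = C * ((\<Sum>m=1..n. gauss_max_third m) / B ^ 3)" by (simp add: centered_gauss_max_moments)
      also have "\<dots> \<le> \<bar>C\<bar> * (8 * D / sqrt (real n))"
      proof -
        have th: "0 \<le> (\<Sum>m=1..n. gauss_max_third m)"
          unfolding gauss_max_third_def by (intro sum_nonneg integral_nonneg_AE) auto
        \<comment> \<open>Using q / 4 instead of q / 2 keeps the root free of sqrt 2 and gives the
          factor 8; the powers of ln n cancel.\<close>
        have "(\<Sum>m=1..n. gauss_max_third m) / B ^ 3 \<le> (D * (real n / sqrt L ^ 3)) / (sqrt (q / 4) ^ 3)"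
        proof (rule frac_le)
          show "(\<Sum>m=1..n. gauss_max_third m) \<le> D * (real n / sqrt L ^ 3)"
            using elim(3) th L by (simp add: L_def)
          have "sqrt (q / 4) \<le> B" unfolding B_def using Vq q by simp
          then show "sqrt (q / 4) ^ 3 \<le> B ^ 3" using q by (intro power_mono) auto
        qed (use q L D in auto)
        also have "\<dots> = 8 * D / sqrt (real n)"
        proof -
          define a l where "a = sqrt (real n)" and "l = sqrt L"
          have al: "0 < a" "0 < l" "real n = a\<^sup>2" using n L by (auto simp: a_def l_def)
          have sq: "sqrt (q / 4) = a / l / 2" by (simp only: q_def a_def l_def real_sqrt_divide real_sqrt_four)
          show ?thesis unfolding a_def[symmetric] l_def[symmetric] sq al(3)
            using al(1,2) by (simp add: power_divide field_simps power2_eq_square power3_eq_cube)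
        qed
        finally have le: "(\<Sum>m=1..n. gauss_max_third m) / B ^ 3 \<le> 8 * D / sqrt (real n)" .
        have "C * ((\<Sum>m=1..n. gauss_max_third m) / B ^ 3) \<le> \<bar>C\<bar> * ((\<Sum>m=1..n. gauss_max_third m) / B ^ 3)"
          using th B by (intro mult_right_mono) auto
        also have "\<dots> \<le> \<bar>C\<bar> * (8 * D / sqrt (real n))" using le by (intro mult_left_mono) auto
        finally show ?thesis .
      qed
      finally show "\<bar>cdf normalized_law x - \<Phi> x\<bar> \<le> (8 * \<bar>C\<bar> * D) / sqrt (real n)"
        unfolding normalized_law_def var B_def[symmetric] by (simp add: mult_ac)
    qed
  qed
  then show ?thesis by (intro exI[of _ "8 * \<bar>C\<bar> * D"])
qed

theorem theorem2:
  fixes M :: "nat \<Rightarrow> 'a measure"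
    and X :: "nat \<Rightarrow> nat \<Rightarrow> nat \<Rightarrow> 'a \<Rightarrow> real"
    and S :: "nat \<Rightarrow> 'a \<Rightarrow> real"
    and A B :: "nat \<Rightarrow> real"
  assumes prob: "\<And>n. n \<ge> 1 \<Longrightarrow> prob_space (M n)"
    and indep: "\<And>n. n \<ge> 1 \<Longrightarrow>
      prob_space.indep_vars (M n) (\<lambda>_. borel) (\<lambda>(i, j). X n i j) ({1..n} \<times> {1..n})"
    and gauss: "\<And>n i j. n \<ge> 1 \<Longrightarrow> i \<in> {1..n} \<Longrightarrow> j \<in> {1..n} \<Longrightarrow>
      distributed (M n) lborel (X n i j) std_normal_density"
  defines "S \<equiv> \<lambda>n \<omega>. perm_sum n (\<lambda>i j. X n i j \<omega>) (greedy_perm n (\<lambda>i j. X n i j \<omega>))"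
    and "A \<equiv> \<lambda>n. prob_space.expectation (M n) (S n)"
    and "B \<equiv> \<lambda>n. sqrt (prob_space.variance (M n) (S n))"
  shows "weak_conv_m (\<lambda>n. distr (M n) borel (\<lambda>\<omega>. (S n \<omega> - A n) / B n)) std_normal_distribution
    \<and> (\<lambda>n. A n - real n * sqrt (2 * ln (real n)))
        \<in> O(\<lambda>n. real n * ln (ln (real n)) / sqrt (ln (real n)))
    \<and> (\<lambda>n. (B n)\<^sup>2 - pi\<^sup>2 / 12 * (real n / ln (real n))) \<in> o(\<lambda>n. real n / ln (real n))
    \<and> (\<lambda>n. SUP r. \<bar>\<P>(\<omega> in M n. (S n \<omega> - A n) / B n \<le> r) - cdf std_normal_distribution r\<bar>)
        \<in> O(\<lambda>n. 1 / sqrt (real n))"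
proof -
  have gm: "gaussian_matrix (M n) n (X n)" if "1 \<le> n" for n
    using prob[OF that] indep[OF that] gauss[OF that]
    by (auto simp: gaussian_matrix_def gaussian_matrix_axioms_def)
  have S: "S n = gaussian_matrix.greedy_sum n (X n)" if "1 \<le> n" for n
    by (simp add: S_def fun_eq_iff gaussian_matrix.greedy_sum_def[OF gm[OF that]])
  have A: "A n = (\<Sum>m=1..n. gauss_max_mean m)" if "1 \<le> n" for n
    unfolding A_def S[OF that] by (rule gaussian_matrix.greedy_sum_mean_var(1)[OF gm[OF that] that])
  have B2: "(B n)\<^sup>2 = (\<Sum>m=1..n. gauss_max_var m)" if "1 \<le> n" for n
  proof -
    have "(B n)\<^sup>2 = prob_space.variance (M n) (S n)" unfolding B_def by (simp add: integral_nonneg_AE)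
    also have "\<dots> = (\<Sum>m=1..n. gauss_max_var m)"
      unfolding S[OF that] by (rule gaussian_matrix.greedy_sum_mean_var(2)[OF gm[OF that] that])
    finally show ?thesis .
  qed
  define F where "F n = cdf (distr (M n) borel (\<lambda>\<omega>. (S n \<omega> - A n) / B n))" for n
  obtain K where K: "eventually (\<lambda>n. \<forall>x. \<bar>F n x - \<Phi> x\<bar> \<le> K / sqrt (real n)) sequentially"
  proof -
    obtain K where K: "eventually (\<lambda>n. \<forall>(M :: 'a measure) X. gaussian_matrix M n X \<longrightarrow>
     (\<forall>x. \<bar>cdf (gaussian_matrix.normalized_law M n X) x - \<Phi> x\<bar> \<le> K / sqrt (real n))) sequentially"
      using greedy_sum_berry_esseen by (rule exE)
    from K eventually_ge_at_top[of 1]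
    have "eventually (\<lambda>n. \<forall>x. \<bar>F n x - \<Phi> x\<bar> \<le> K / sqrt (real n)) sequentially"
    proof eventually_elim
      case (elim n)
      from elim(1)[rule_format, OF gm[OF elim(2)]] show ?case
        unfolding F_def A_def B_def S[OF elim(2)] gaussian_matrix.normalized_law_def[OF gm[OF elim(2)]] by blast
    qed
    then show ?thesis by (rule that)
  qed
  have weak: "weak_conv_m (\<lambda>n. distr (M n) borel (\<lambda>\<omega>. (S n \<omega> - A n) / B n)) std_normal_distribution"
    unfolding weak_conv_m_def weak_conv_def F_def[symmetric]
  proof (intro allI impI)
    fix x
    \<comment> \<open>Convergence in distribution is read off from the rate at each point.\<close>
    have "(\<lambda>n. F n x - \<Phi> x) \<longlonglongrightarrow> 0"
    proof (rule Lim_null_comparison)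
      show "eventually (\<lambda>n. norm (F n x - \<Phi> x) \<le> K / sqrt (real n)) sequentially"
        using K by eventually_elim simp
      show "(\<lambda>n. K / sqrt (real n)) \<longlonglongrightarrow> 0" by real_asymp
    qed
    then show "(\<lambda>n. F n x) \<longlonglongrightarrow> \<Phi> x" by (rule LIM_zero_cancel)
  qed
  have mean: "(\<lambda>n. A n - real n * sqrt (2 * ln (real n))) \<in> O(\<lambda>n. real n * ln (ln (real n)) / sqrt (ln (real n)))"
    by (rule landau_o.big.in_cong[THEN iffD2, OF _ sum_gauss_max_mean_bigo])
       (use eventually_ge_at_top[of 1] in \<open>eventually_elim, simp add: A\<close>)
  have var: "(\<lambda>n. (B n)\<^sup>2 - pi\<^sup>2 / 12 * (real n / ln (real n))) \<in> o(\<lambda>n. real n / ln (real n))"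
    by (rule landau_o.small.in_cong[THEN iffD2, OF _ sum_gauss_max_var_asymp])
       (use eventually_ge_at_top[of 1] in \<open>eventually_elim, simp add: B2\<close>)
  have "(\<lambda>n. SUP r. \<bar>\<P>(\<omega> in M n. (S n \<omega> - A n) / B n \<le> r) - \<Phi> r\<bar>) \<in> O(\<lambda>n. 1 / sqrt (real n))"
  proof (rule bigoI)
    show "eventually (\<lambda>n. norm (SUP r. \<bar>\<P>(\<omega> in M n. (S n \<omega> - A n) / B n \<le> r) - \<Phi> r\<bar>) \<le> \<bar>K\<bar> * norm (1 / sqrt (real n))) sequentially"
      using K eventually_ge_at_top[of 1]
    proof eventually_elim
      case (elim n)
      interpret gaussian_matrix "M n" n "X n" by (rule gm[OF elim(2)])
      have Sm: "S n \<in> borel_measurable (M n)" unfolding S[OF elim(2)] by (rule measurable_greedy_sum)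
      have "\<P>(\<omega> in M n. (S n \<omega> - A n) / B n \<le> r) = F n r" for r
        unfolding F_def cdf_def using Sm
        by (subst measure_distr) (auto intro!: arg_cong[where f = prob])
      then have eq: "(SUP r. \<bar>\<P>(\<omega> in M n. (S n \<omega> - A n) / B n \<le> r) - \<Phi> r\<bar>) = (SUP r. \<bar>F n r - \<Phi> r\<bar>)" by simp
      have "(SUP r. \<bar>F n r - \<Phi> r\<bar>) \<le> K / sqrt (real n)" using elim(1) by (intro cSUP_least) auto
      \<comment> \<open>One value suffices to see that the supremum is nonnegative, so its norm is
        itself; the uniform bound makes the supremum proper.\<close>
      moreover have "\<bar>F n 0 - \<Phi> 0\<bar> \<le> (SUP r. \<bar>F n r - \<Phi> r\<bar>)"
        using elim(1) by (intro cSUP_upper bdd_aboveI[of _ "K / sqrt (real n)"]) auto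
      moreover have "K / sqrt (real n) \<le> \<bar>K\<bar> / sqrt (real n)" by (intro divide_right_mono) auto
      ultimately show ?case unfolding eq by simp
    qed
  qed
  with weak mean var show ?thesis by blast
qed

end
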